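(* Let $\mathfrak g$ be a unimodular Lie algebra of dimension $\ge 4$ which admits a Vaisman structure. Then $\mathfrak g$ is isomorphic to one of the following: (i) $\mathfrak{u}(2)=\mathbb{R}\oplus\mathfrak{su}(2)$; (ii) $\mathfrak{gl}(2,\mathbb{R})=\mathbb{R}\oplus\mathfrak{sl}(2,\mathbb{R})$; (iii) a solvable unimodular Lie algebra $\mathfrak{gh}(\psi)$ associated with a linear map $\psi:\mathbb{R}^{2p+1}\to\mathfrak{t}^q\cong\mathbb{R}^q$.
   Context: All Lie algebras are finite-dimensional and real. Vaisman structures. A Hermitian structure on a Lie algebra $\mathfrak g$ is a pair $(\langle\cdot,\cdot\rangle,J)$ of a (positive definite) scalar product and a skew-symmetric endomorphism $J$ with $J^2=-\mathrm{Id}$ and vanishing Nijenhuis tensor $N_J(X,Y)=[JX,JY]-[X,Y]-J[X,JY]-J[JX,Y]$. Its fundamental form is $\omega=\langle\cdot,J\cdot\rangle$. It is locally conformally Kähler (lcK) if $d\omega=\omega\wedge\theta$ for some closed $1$-form $\theta\in\mathfrak g^*$ (called the Lee form), where $d$ is the Chevalley–Eilenberg differential. An lcK structure is called Vaisman if $\nabla\theta=0$, where $\nabla\in\mathfrak g^*\otimes\mathfrak{so}(\mathfrak g)$ is the Levi-Civita connection of $(\mathfrak g,\langle\cdot,\cdot\rangle)$. The Lie algebras $\mathfrak{gh}(\psi)$. Let $\mathfrak t^q\cong\mathbb{R}^q$ be the Cartan subalgebra of $\mathfrak u(q)$ consisting of purely imaginary diagonal matrices. Given a linear map $\psi:\mathbb{R}^{2p+1}\to\mathfrak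 t^q$, let $\mathfrak m=\mathbb{R}^{2p+1}\ltimes_\psi\mathbb{C}^q$ be the Lie algebra in which $\mathbb{R}^{2p+1}$ is an abelian subalgebra acting on the abelian ideal $\mathbb{C}^q$ by $\psi$, i.e. $[X,Y]_{\mathfrak m}=\psi(X)Y$ for $X\in\mathbb{R}^{2p+1}$, $Y\in\mathbb{C}^q$. Decompose $\mathbb{R}^{2p+1}=\mathbb{R}Z_0\oplus\mathbb{C}^p$, and let $\omega$ be the standard symplectic form on $V=\mathbb{C}^p\oplus\mathbb{C}^q=\mathbb{C}^m=\mathbb{R}^{2m}$, $m=p+q$. Let $\omega_{\mathfrak m}$ be the pull-back of $\omega$ to $\mathfrak m$ via the projection $\mathfrak m\to V$, $\lambda Z_0+v\mapsto v$ ($\lambda\in\mathbb{R}$, $v\in V$); it is a $2$-cocycle on $\mathfrak m$. Then $\mathfrak{gh}(\psi)=\mathbb{R}Z_1\oplus\mathfrak m$ is the one-dimensional central extension of $\mathfrak m$ defined by $\omega_{\mathfrak m}$, with brackets $[X,Y]=[X,Y]_{\mathfrak m}+\omega_{\mathfrak m}(X,Y)Z_1$ for $X,Y\in\mathfrak m$, and $[Z_1,\mathfrak m]=0$.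
   Formalization: A Vaisman structure is required to have nonzero Lee form θ; with θ = 0 allowed the claim fails, e.g. for abelian R^4 with its flat Kähler structure, which is none of (i)–(iii). *)

theory Defs
  imports "HOL-Analysis.Analysis" "HOL-Analysis.Finite_Function_Topology"
begin

section \<open>Real Lie algebras\<close>

text \<open>A Lie algebra is given by a finite-dimensional subspace \<open>L\<close> of some real vector space
  together with a bracket; all maps are total functions of which only the values on \<open>L\<close> matter.
  The model algebras below have dimensions depending on natural numbers, so that they
  cannot be types.\<close>

definition linear_on :: "'a::real_vector set \<Rightarrow> ('a \<Rightarrow> 'b::real_vector) \<Rightarrow> bool" where
  "linear_on L f \<longleftrightarrow>
     (\<forall>x\<in>L. \<forall>y\<in>L. f (x + y) = f x + f y) \<and> (\<forall>c. \<forall>x\<in>L. f (c *\<^sub>R x) = c *\<^sub>R f x)"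

definition bilinear_on :: "'a::real_vector set \<Rightarrow> ('a \<Rightarrow> 'a \<Rightarrow> 'b::real_vector) \<Rightarrow> bool" where
  "bilinear_on L f \<longleftrightarrow> (\<forall>x\<in>L. linear_on L (f x)) \<and> (\<forall>y\<in>L. linear_on L (\<lambda>x. f x y))"

definition lie_algebra :: "'a::real_vector set \<Rightarrow> ('a \<Rightarrow> 'a \<Rightarrow> 'a) \<Rightarrow> bool" where
  "lie_algebra L br \<longleftrightarrow>
     (\<exists>B. finite B \<and> L = span B) \<and>
     (\<forall>x\<in>L. \<forall>y\<in>L. br x y \<in> L) \<and>
     bilinear_on L br \<and>
     (\<forall>x\<in>L. br x x = 0) \<and>
     (\<forall>x\<in>L. \<forall>y\<in>L. \<forall>z\<in>L. br x (br y z) + br y (br z x) + br z (br x y) = 0)"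

definition lie_isomorphic ::
  "'a::real_vector set \<Rightarrow> ('a \<Rightarrow> 'a \<Rightarrow> 'a) \<Rightarrow> 'b::real_vector set \<Rightarrow> ('b \<Rightarrow> 'b \<Rightarrow> 'b) \<Rightarrow> bool" where
  "lie_isomorphic L br L' br' \<longleftrightarrow>
     (\<exists>f. linear_on L f \<and> bij_betw f L L' \<and> (\<forall>x\<in>L. \<forall>y\<in>L. f (br x y) = br' (f x) (f y)))"

text \<open>The trace of an endomorphism of a finite-dimensional subspace \<open>L\<close>,
  computed in an arbitrary basis of \<open>L\<close>.\<close>

definition trace_on :: "'a::real_vector set \<Rightarrow> ('a \<Rightarrow> 'a) \<Rightarrow> real" where
  "trace_on L f =
     (let B = (SOME B. independent B \<and> span B = L) in \<Sum>b\<in>B. representation B (f b) b)"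

definition unimodular :: "'a::real_vector set \<Rightarrow> ('a \<Rightarrow> 'a \<Rightarrow> 'a) \<Rightarrow> bool" where
  "unimodular L br \<longleftrightarrow> (\<forall>x\<in>L. trace_on L (br x) = 0)"

fun derived_series :: "'a::real_vector set \<Rightarrow> ('a \<Rightarrow> 'a \<Rightarrow> 'a) \<Rightarrow> nat \<Rightarrow> 'a set" where
  "derived_series L br 0 = L"
| "derived_series L br (Suc n) =
     span {br x y | x y. x \<in> derived_series L br n \<and> y \<in> derived_series L br n}"

definition solvable :: "'a::real_vector set \<Rightarrow> ('a \<Rightarrow> 'a \<Rightarrow> 'a) \<Rightarrow> bool" where
  "solvable L br \<longleftrightarrow> (\<exists>n. derived_series L br n = {0})"


section \<open>Vaisman structures\<close>

definition scalar_product_on :: "'a::real_vector set \<Rightarrow> ('a \<Rightarrow> 'a \<Rightarrow> real) \<Rightarrow> bool" where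
  "scalar_product_on L ip \<longleftrightarrow>
     bilinear_on L ip \<and> (\<forall>x\<in>L. \<forall>y\<in>L. ip x y = ip y x) \<and> (\<forall>x\<in>L. x \<noteq> 0 \<longrightarrow> ip x x > 0)"

definition endo_on :: "'a::real_vector set \<Rightarrow> ('a \<Rightarrow> 'a) \<Rightarrow> bool" where
  "endo_on L f \<longleftrightarrow> linear_on L f \<and> (\<forall>x\<in>L. f x \<in> L)"

definition skew_on :: "'a::real_vector set \<Rightarrow> ('a \<Rightarrow> 'a \<Rightarrow> real) \<Rightarrow> ('a \<Rightarrow> 'a) \<Rightarrow> bool" where
  "skew_on L ip f \<longleftrightarrow> (\<forall>x\<in>L. \<forall>y\<in>L. ip (f x) y = - ip x (f y))"

definition nijenhuis ::
  "('a::real_vector \<Rightarrow> 'a \<Rightarrow> 'a) \<Rightarrow> ('a \<Rightarrow> 'a) \<Rightarrow> 'a \<Rightarrow> 'a \<Rightarrow> 'a" where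
  "nijenhuis br J x y = br (J x) (J y) - br x y - J (br x (J y)) - J (br (J x) y)"

definition hermitian_structure ::
  "'a::real_vector set \<Rightarrow> ('a \<Rightarrow> 'a \<Rightarrow> 'a) \<Rightarrow> ('a \<Rightarrow> 'a \<Rightarrow> real) \<Rightarrow> ('a \<Rightarrow> 'a) \<Rightarrow> bool" where
  "hermitian_structure L br ip J \<longleftrightarrow>
     scalar_product_on L ip \<and> endo_on L J \<and> skew_on L ip J \<and>
     (\<forall>x\<in>L. J (J x) = - x) \<and>
     (\<forall>x\<in>L. \<forall>y\<in>L. nijenhuis br J x y = 0)"

definition fundamental_form :: "('a \<Rightarrow> 'a \<Rightarrow> real) \<Rightarrow> ('a \<Rightarrow> 'a) \<Rightarrow> 'a \<Rightarrow> 'a \<Rightarrow> real" where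
  "fundamental_form ip J x y = ip x (J y)"

text \<open>The Chevalley--Eilenberg differential (trivial coefficients) on 1-forms and on 2-forms, and
  the wedge product of a 2-form with a 1-form.\<close>

definition ce_d1 :: "('a \<Rightarrow> 'a \<Rightarrow> 'a) \<Rightarrow> ('a \<Rightarrow> real) \<Rightarrow> 'a \<Rightarrow> 'a \<Rightarrow> real" where
  "ce_d1 br \<alpha> x y = - \<alpha> (br x y)"

definition ce_d2 :: "('a \<Rightarrow> 'a \<Rightarrow> 'a) \<Rightarrow> ('a \<Rightarrow> 'a \<Rightarrow> real) \<Rightarrow> 'a \<Rightarrow> 'a \<Rightarrow> 'a \<Rightarrow> real" where
  "ce_d2 br \<beta> x y z = - \<beta> (br x y) z + \<beta> (br x z) y - \<beta> (br y z) x"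

definition wedge21 :: "('a \<Rightarrow> 'a \<Rightarrow> real) \<Rightarrow> ('a \<Rightarrow> real) \<Rightarrow> 'a \<Rightarrow> 'a \<Rightarrow> 'a \<Rightarrow> real" where
  "wedge21 \<beta> \<alpha> x y z = \<beta> x y * \<alpha> z - \<beta> x z * \<alpha> y + \<beta> y z * \<alpha> x"

definition lck_structure ::
  "'a::real_vector set \<Rightarrow> ('a \<Rightarrow> 'a \<Rightarrow> 'a) \<Rightarrow> ('a \<Rightarrow> 'a \<Rightarrow> real) \<Rightarrow> ('a \<Rightarrow> 'a) \<Rightarrow> ('a \<Rightarrow> real) \<Rightarrow> bool" where
  "lck_structure L br ip J \<theta> \<longleftrightarrow>
     hermitian_structure L br ip J \<and>
     linear_on L \<theta> \<and>
     (\<forall>x\<in>L. \<forall>y\<in>L. ce_d1 br \<theta> x y = 0) \<and>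
     (\<forall>x\<in>L. \<forall>y\<in>L. \<forall>z\<in>L.
        ce_d2 br (fundamental_form ip J) x y z = wedge21 (fundamental_form ip J) \<theta> x y z)"

definition levi_civita ::
  "'a::real_vector set \<Rightarrow> ('a \<Rightarrow> 'a \<Rightarrow> 'a) \<Rightarrow> ('a \<Rightarrow> 'a \<Rightarrow> real) \<Rightarrow> ('a \<Rightarrow> 'a \<Rightarrow> 'a) \<Rightarrow> bool" where
  "levi_civita L br ip nabla \<longleftrightarrow>
     bilinear_on L nabla \<and>
     (\<forall>x\<in>L. \<forall>y\<in>L. nabla x y \<in> L) \<and>
     (\<forall>x\<in>L. skew_on L ip (nabla x)) \<and>
     (\<forall>x\<in>L. \<forall>y\<in>L. nabla x y - nabla y x = br x y)"

text \<open>The covariant derivative of a left-invariant 1-form.\<close>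

definition cov_deriv1 :: "('a \<Rightarrow> 'a \<Rightarrow> 'a) \<Rightarrow> ('a \<Rightarrow> real) \<Rightarrow> 'a \<Rightarrow> 'a \<Rightarrow> real" where
  "cov_deriv1 nabla \<theta> x y = - \<theta> (nabla x y)"

text \<open>The Lee form is required to be nonzero, i.e. Kaehler structures do not count as Vaisman
  structures: the flat Kaehler structure on the abelian Lie algebra of dimension 4 has
  \<open>\<theta> = 0\<close> and is to be excluded. The Levi-Civita connection exists and is unique on \<open>L\<close>,
  so the quantifier over \<open>nabla\<close> could equally be universal.\<close>

definition vaisman_structure ::
  "'a::real_vector set \<Rightarrow> ('a \<Rightarrow> 'a \<Rightarrow> 'a) \<Rightarrow> ('a \<Rightarrow> 'a \<Rightarrow> real) \<Rightarrow> ('a \<Rightarrow> 'a) \<Rightarrow> bool" where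
  "vaisman_structure L br ip J \<longleftrightarrow>
     (\<exists>\<theta> nabla. lck_structure L br ip J \<theta> \<and> (\<exists>x\<in>L. \<theta> x \<noteq> 0) \<and>
        levi_civita L br ip nabla \<and> (\<forall>x\<in>L. \<forall>y\<in>L. cov_deriv1 nabla \<theta> x y = 0))"


section \<open>The Lie algebras u(2) and gl(2,R)\<close>

definition commutator :: "'a::ring_1 ^ 'n ^ 'n \<Rightarrow> 'a ^ 'n ^ 'n \<Rightarrow> 'a ^ 'n ^ 'n" where
  "commutator A B = A ** B - B ** A"

definition u2 :: "(complex ^ 2 ^ 2) set" where
  "u2 = {A. \<forall>i j. cnj (A $ j $ i) = - (A $ i $ j)}"

definition gl2R :: "(real ^ 2 ^ 2) set" where
  "gl2R = UNIV"


section \<open>The Lie algebras gh(psi)\<close>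

text \<open>Complex \<open>n\<close>-space is realised inside the real vector space of finitely supported sequences.\<close>

type_synonym cvec = "nat \<Rightarrow>\<^sub>0 complex"

definition cspace :: "nat \<Rightarrow> cvec set" where
  "cspace n = {z. Poly_Mapping.keys z \<subseteq> {..<n}}"

text \<open>\<open>torus q\<close> consists of the purely imaginary diagonal matrices of size \<open>q\<close>, given by their
  diagonals; \<open>diag_act d\<close> is multiplication by the diagonal matrix with diagonal \<open>d\<close>.\<close>

definition torus :: "nat \<Rightarrow> cvec set" where
  "torus q = {d \<in> cspace q. \<forall>k. Re (Poly_Mapping.lookup d k) = 0}"

definition diag_act :: "cvec \<Rightarrow> cvec \<Rightarrow> cvec" where
  "diag_act d w = Poly_Mapping.mapp (\<lambda>k z. Poly_Mapping.lookup d k * z) w"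

definition std_symplectic :: "nat \<Rightarrow> cvec \<Rightarrow> cvec \<Rightarrow> real" where
  "std_symplectic n z w =
     (\<Sum>k<n. Re (Poly_Mapping.lookup z k) * Im (Poly_Mapping.lookup w k)
           - Im (Poly_Mapping.lookup z k) * Re (Poly_Mapping.lookup w k))"

text \<open>The pair \<open>(\<lambda>, v)\<close> stands for \<open>\<lambda> Z\<^sub>0 + v\<close>, so \<open>odd_space p\<close> is
  \<open>2 p + 1\<close>-dimensional Euclidean space.\<close>

definition odd_space :: "nat \<Rightarrow> (real \<times> cvec) set" where
  "odd_space p = UNIV \<times> cspace p"

definition m_bracket ::
  "(real \<times> cvec \<Rightarrow> cvec) \<Rightarrow> (real \<times> cvec) \<times> cvec \<Rightarrow> (real \<times> cvec) \<times> cvec \<Rightarrow> (real \<times> cvec) \<times> cvec" where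
  "m_bracket \<psi> X Y = (0, diag_act (\<psi> (fst X)) (snd Y) - diag_act (\<psi> (fst Y)) (snd X))"

definition omega_m ::
  "nat \<Rightarrow> nat \<Rightarrow> (real \<times> cvec) \<times> cvec \<Rightarrow> (real \<times> cvec) \<times> cvec \<Rightarrow> real" where
  "omega_m p q X Y =
     std_symplectic p (snd (fst X)) (snd (fst Y)) + std_symplectic q (snd X) (snd Y)"

text \<open>The pair \<open>(c, X)\<close> stands for \<open>c Z\<^sub>1 + X\<close>.\<close>

definition gh :: "nat \<Rightarrow> nat \<Rightarrow> (real \<times> (real \<times> cvec) \<times> cvec) set" where
  "gh p q = UNIV \<times> (odd_space p \<times> cspace q)"

definition gh_bracket ::
  "nat \<Rightarrow> nat \<Rightarrow> (real \<times> cvec \<Rightarrow> cvec) \<Rightarrow>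
   real \<times> (real \<times> cvec) \<times> cvec \<Rightarrow> real \<times> (real \<times> cvec) \<times> cvec \<Rightarrow> real \<times> (real \<times> cvec) \<times> cvec" where
  "gh_bracket p q \<psi> X Y = (omega_m p q (snd X) (snd Y), m_bracket \<psi> (snd X) (snd Y))"

end

(* Let A be the vector dual to the Lee form, xi = J A and h the orthogonal complement of A and xi.
   Both ad A and ad xi are skew, commute with J and preserve h, and on h one has
   [x, y] = [x, y]_h + <J x, y> xi. So h carries a "transversal" Kaehler connection G, whose
   curvature is R(x, y) = [G x, G y] - G [x, y]_h - <J x, y> D with D = ad xi.

   Unimodularity makes every left-invariant divergence vanish. Applied to the Ricci form this shows
   that the transversal geometry is Einstein; applied to the Chern-Simons form of G (in contracted
   form) it gives, with n = dim h, D0 the trace-free part of D and R0 that of R,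
     sum tr (R0(e, f)^2) = - (n (n - 2) / 2) tr (D0^2).
   The left side is nonpositive and the right side nonnegative, so R = - mu <J x, y> J and D = mu J,
   and the Bianchi identity forces mu = 0 or n = 2.

   If mu is nonzero, the algebra is u(2) or gl(2,R), depending on the sign of mu. If mu = 0, then g / R xi is a
   flat metric Lie algebra; there the operators G x commute and G (G x y) = 0 (an algebraic version
   of Milnor's theorem), and diagonalising them simultaneously exhibits g as gh(psi). *)
theory Submission
  imports Defs "HOL-Computational_Algebra.Fundamental_Theorem_Algebra"
begin

text \<open>The obstacle is that \<open>h\<close> need not be a Lie algebra: its bracket violates
  the Jacobi identity as soon as \<open>D\<close> is nonzero, so structure theory cannot be applied
  to it. The \<open>D\<close> term of the curvature is the correction that restores both Bianchi
  identities. Unimodularity plays the part of compactness: contractions of left-invariant tensors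
  can be integrated by parts. The Ricci form, shifted by a multiple of the Kaehler form, is exact
  and coclosed, hence zero. The Einstein condition so obtained makes the curvature divergence-free,
  and its squared norm then reduces to traces of products of commutators \<open>[G x, G y]\<close>.
  Type (1,1) and the Jacobi identity for the trace form evaluate these in terms of \<open>D\<close>
  and \<open>J\<close> alone. The constant mu is the coefficient of \<open>J\<close> in
  \<open>D\<close> with respect to the trace form. The factor n - 2 is why the plane stands apart:
  there the identity says nothing about \<open>D\<close>, but skew operators of a plane are
  multiples of \<open>J\<close> anyway.\<close>

section \<open>Linear operators and traces in an orthonormal frame\<close>

text \<open>Endomorphisms are total linear maps of the ambient space, so that they form a ring and
  operator identities become noncommutative algebra.\<close>

typedef (overloaded) ('a::real_vector) lin = "{f::'a \<Rightarrow> 'a. linear f}"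
  morphisms app Lin
  by (rule exI[of _ "\<lambda>x. 0"]) (simp add: linear_iff)

notation app (infixr "\<cdot>" 75)

setup_lifting type_definition_lin

instantiation lin :: (real_vector) real_algebra
begin

lift_definition zero_lin :: "'a lin" is "\<lambda>x. 0" by (simp add: linear_iff)
lift_definition plus_lin :: "'a lin \<Rightarrow> 'a lin \<Rightarrow> 'a lin" is "\<lambda>f g x. f x + g x"
  by (simp add: linear_iff algebra_simps)
lift_definition minus_lin :: "'a lin \<Rightarrow> 'a lin \<Rightarrow> 'a lin" is "\<lambda>f g x. f x - g x"
  by (simp add: linear_iff algebra_simps)
lift_definition uminus_lin :: "'a lin \<Rightarrow> 'a lin" is "\<lambda>f x. - f x"
  by (simp add: linear_iff)
lift_definition times_lin :: "'a lin \<Rightarrow> 'a lin \<Rightarrow> 'a lin" is "\<lambda>f g x. f (g x)"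
  by (simp add: linear_iff)
lift_definition scaleR_lin :: "real \<Rightarrow> 'a lin \<Rightarrow> 'a lin" is "\<lambda>c f x. c *\<^sub>R f x"
  by (simp add: linear_iff algebra_simps)

instance
  by standard (transfer; auto simp: fun_eq_iff linear_iff algebra_simps)+

end

lemma app_linear: "linear (app F)"
  using app by auto

lemma app_Lin: "linear f \<Longrightarrow> Lin f \<cdot> x = f x"
  by (simp add: Lin_inverse)

lemma lin_eqI: "(\<And>x. F \<cdot> x = G \<cdot> x) \<Longrightarrow> F = G"
  by (simp add: app_inject[symmetric] fun_eq_iff)

lemma app_simps [simp]:
  "0 \<cdot> x = 0" "(F + G) \<cdot> x = F \<cdot> x + G \<cdot> x" "(F - G) \<cdot> x = F \<cdot> x - G \<cdot> x"
  "(- F) \<cdot> x = - (F \<cdot> x)" "(F * G) \<cdot> x = F \<cdot> (G \<cdot> x)" "(c *\<^sub>R F) \<cdot> x = c *\<^sub>R (F \<cdot> x)"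
  by (transfer; simp)+

lemma app_vec [simp]:
  "F \<cdot> (x + y) = F \<cdot> x + F \<cdot> y" "F \<cdot> (x - y) = F \<cdot> x - F \<cdot> y" "F \<cdot> (- x) = - (F \<cdot> x)"
  "F \<cdot> 0 = 0" "F \<cdot> (c *\<^sub>R x) = c *\<^sub>R (F \<cdot> x)" "F \<cdot> (sum g A) = (\<Sum>a\<in>A. F \<cdot> g a)"
  using app_linear[of F]
  by (simp_all add: linear_add linear_diff linear_neg linear_0 linear_cmul linear_sum)

lemma app_sum: "sum F A \<cdot> x = (\<Sum>a\<in>A. F a \<cdot> x)"
  by (induction A rule: infinite_finite_induct) auto

lemma bilinI:
  assumes "\<And>x y z. b (x + y) z = b x z + b y z" "\<And>c x z. b (c *\<^sub>R x) z = c *\<^sub>R b x z"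
    "\<And>x y z. b z (x + y) = b z x + b z y" "\<And>c x z. b z (c *\<^sub>R x) = c *\<^sub>R b z x"
  shows "bilinear b"
  using assms by (simp add: bilinear_def linear_iff)

text \<open>The form \<open>ip\<close> is positive definite on the span of \<open>E\<close> and is extended to the ambient
  space by the projection \<open>P\<close> onto that span; this is what \<open>parseval\<close> expresses. All structures below
  are extended by \<open>P\<close> in the same way, which makes their identities unconditional.\<close>

locale frame =
  fixes ip :: "'a::real_vector \<Rightarrow> 'a \<Rightarrow> real" and E :: "'a set"
  assumes finE [simp]: "finite E" and ip_bil: "bilinear ip" and ip_sym: "ip x y = ip y x"
    and ip_E: "e \<in> E \<Longrightarrow> f \<in> E \<Longrightarrow> ip e f = (if e = f then 1 else 0)"
    and parseval: "ip x y = (\<Sum>e\<in>E. ip x e * ip y e)"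
begin

lemma ip_lin [simp]:
  "ip (x + y) z = ip x z + ip y z" "ip z (x + y) = ip z x + ip z y"
  "ip (x - y) z = ip x z - ip y z" "ip z (x - y) = ip z x - ip z y"
  "ip (- x) z = - ip x z" "ip z (- x) = - ip z x"
  "ip (c *\<^sub>R x) z = c * ip x z" "ip z (c *\<^sub>R x) = c * ip z x"
  "ip 0 z = 0" "ip z 0 = 0"
  using ip_bil by (simp_all add: bilinear_ladd bilinear_radd bilinear_lsub bilinear_rsub
      bilinear_lneg bilinear_rneg bilinear_lmul bilinear_rmul bilinear_lzero bilinear_rzero)

lemma ip_sum: "ip (sum f A) z = (\<Sum>a\<in>A. ip (f a) z)" "ip z (sum f A) = (\<Sum>a\<in>A. ip z (f a))"
  by (induction A rule: infinite_finite_induct) auto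

definition P :: "'a lin" where "P = Lin (\<lambda>x. \<Sum>e\<in>E. ip x e *\<^sub>R e)"

lemma P_app: "P \<cdot> x = (\<Sum>e\<in>E. ip x e *\<^sub>R e)"
  unfolding P_def by (rule app_Lin)
    (simp add: linear_iff sum.distrib scaleR_sum_right scaleR_left_distrib)

lemma P_E: "e \<in> E \<Longrightarrow> P \<cdot> e = e"
proof -
  assume e: "e \<in> E"
  have "P \<cdot> e = (\<Sum>f\<in>E. if e = f then f else 0)"
    unfolding P_app by (rule sum.cong) (use e in \<open>auto simp: ip_E\<close>)
  then show ?thesis using e by simp
qed

lemma PP: "P * P = P"
proof (rule lin_eqI)
  fix x
  have "P \<cdot> (\<Sum>e\<in>E. ip x e *\<^sub>R e) = (\<Sum>e\<in>E. ip x e *\<^sub>R e)" by (simp add: P_E)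
  then show "(P * P) \<cdot> x = P \<cdot> x" by (simp add: P_app[of x])
qed

lemma ip_P [simp]: "ip (P \<cdot> x) y = ip x y" "ip x (P \<cdot> y) = ip x y"
proof -
  show "ip (P \<cdot> x) y = ip x y" for x y
    by (subst (2) parseval) (simp add: P_app ip_sum ip_sym[of _ y])
  then show "ip x (P \<cdot> y) = ip x y" by (metis ip_sym)
qed

lemma sum_E_expand:
  assumes "linear \<phi>"
  shows "(\<Sum>e\<in>E. ip x e *\<^sub>R \<phi> e) = \<phi> (P \<cdot> x)"
  by (simp add: P_app linear_sum[OF assms] linear_cmul[OF assms])

lemma ip_eqI: "P \<cdot> x = x \<Longrightarrow> P \<cdot> y = y \<Longrightarrow> (\<And>t. ip x t = ip y t) \<Longrightarrow> x = y"
  by (metis (mono_tags, lifting) P_app sum.cong)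

lemma ip_self_nonneg: "ip x x \<ge> 0"
  by (subst parseval) (simp add: sum_nonneg)

lemma ip_self_0: "P \<cdot> x = x \<Longrightarrow> ip x x = 0 \<Longrightarrow> x = 0"
proof -
  assume a: "P \<cdot> x = x" "ip x x = 0"
  have "(\<Sum>e\<in>E. ip x e * ip x e) = 0" using a(2) parseval[of x x] by simp
  then have "\<forall>e\<in>E. ip x e = 0" by (subst (asm) sum_nonneg_eq_0_iff) auto
  then show ?thesis using a(1) by (simp add: P_app)
qed

definition tr :: "'a lin \<Rightarrow> real" where "tr F = (\<Sum>e\<in>E. ip (F \<cdot> e) e)"

lemma tr_simps [simp]: "tr (F + G) = tr F + tr G" "tr (F - G) = tr F - tr G" "tr (- F) = - tr F"
  "tr (c *\<^sub>R F) = c * tr F" "tr 0 = 0"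
  by (simp_all add: tr_def sum.distrib sum_subtractf sum_negf sum_distrib_left)

lemma tr_sum: "tr (sum F A) = (\<Sum>a\<in>A. tr (F a))"
  by (induction A rule: infinite_finite_induct) auto

text \<open>Only the values are constrained. This suffices for cyclicity of \<open>tr\<close> and,
  unlike skewness, is stable under products.\<close>

definition im_in :: "'a lin \<Rightarrow> bool" where "im_in F \<longleftrightarrow> P * F = F"

lemma im_inD: "im_in F \<Longrightarrow> P \<cdot> (F \<cdot> x) = F \<cdot> x"
  by (metis app_simps(5) im_in_def)

lemma im_in_intros [simp, intro]: "im_in F \<Longrightarrow> im_in G \<Longrightarrow> im_in (F + G)"
  "im_in F \<Longrightarrow> im_in G \<Longrightarrow> im_in (F - G)" "im_in F \<Longrightarrow> im_in (- F)" "im_in F \<Longrightarrow> im_in (c *\<^sub>R F)"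
  "im_in 0" "im_in F \<Longrightarrow> im_in (F * G)" "im_in P"
  by (simp_all add: im_in_def algebra_simps PP mult.assoc[symmetric])

lemma im_in_sum: "(\<And>a. a \<in> A \<Longrightarrow> im_in (F a)) \<Longrightarrow> im_in (sum F A)"
  by (induction A rule: infinite_finite_induct) auto

lemma tr_commute:
  assumes "im_in F" "im_in G"
  shows "tr (F * G) = tr (G * F)"
proof -
  have 1: "tr (F * G) = (\<Sum>e\<in>E. \<Sum>f\<in>E. ip (G \<cdot> e) f * ip (F \<cdot> f) e)" if "im_in G" for F G
  proof -
    have "F \<cdot> G \<cdot> e = (\<Sum>f\<in>E. ip (G \<cdot> e) f *\<^sub>R F \<cdot> f)" for e
      by (subst sum_E_expand[OF app_linear]) (simp add: im_inD that)
    then show ?thesis by (simp add: tr_def ip_sum)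
  qed
  show ?thesis
    unfolding 1[OF assms(2)] 1[OF assms(1)] by (subst sum.swap) (simp add: mult.commute)
qed

text \<open>Skew operators are normalised to vanish on the kernel of \<open>P\<close>, so that they
  are determined by their values on the frame.\<close>

definition skew :: "'a lin \<Rightarrow> bool" where
  "skew S \<longleftrightarrow> P * S = S \<and> S * P = S \<and> (\<forall>x y. ip (S \<cdot> x) y = - ip x (S \<cdot> y))"

lemma skew_im [simp, intro]: "skew S \<Longrightarrow> im_in S"
  by (simp add: skew_def im_in_def)

lemma skewD: "skew S \<Longrightarrow> ip (S \<cdot> x) y = - ip x (S \<cdot> y)"
  by (simp add: skew_def)

lemma skew_P: "skew S \<Longrightarrow> P \<cdot> (S \<cdot> x) = S \<cdot> x" "skew S \<Longrightarrow> S \<cdot> (P \<cdot> x) = S \<cdot> x"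
  unfolding skew_def by (metis app_simps(5))+

lemma skew_intros [simp, intro]: "skew F \<Longrightarrow> skew G \<Longrightarrow> skew (F + G)"
  "skew F \<Longrightarrow> skew G \<Longrightarrow> skew (F - G)" "skew F \<Longrightarrow> skew (- F)" "skew F \<Longrightarrow> skew (c *\<^sub>R F)"
  "skew 0"
  by (simp_all add: skew_def algebra_simps)

lemma skew_commutator [simp, intro]: "skew F \<Longrightarrow> skew G \<Longrightarrow> skew (F * G - G * F)"
  unfolding skew_def
  by (auto simp: algebra_simps mult.assoc[symmetric])

lemma skew_self: "skew S \<Longrightarrow> ip (S \<cdot> x) x = 0"
  using skewD[of S x x] ip_sym[of x] by simp

text \<open>The tensor summing \<open>e\<close> with \<open>e\<close> is invariant under skew
  operators, so such an operator passes from one slot to the other with a sign. The form may be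
  operator-valued; the integrations by parts below rest on this.\<close>

lemma skew_shift:
  assumes b: "bilinear b" and S: "skew S"
  shows "(\<Sum>e\<in>E. b (S \<cdot> e) e) = - (\<Sum>e\<in>E. b e (S \<cdot> e))"
proof -
  have l: "linear (\<lambda>x. b x e)" "linear (b e)" for e
    using b by (auto simp: bilinear_def)
  have "b (S \<cdot> e) e = (\<Sum>f\<in>E. ip (S \<cdot> e) f *\<^sub>R b f e)" for e
    by (subst sum_E_expand[OF l(1)]) (simp add: skew_P S)
  then have "(\<Sum>e\<in>E. b (S \<cdot> e) e) = (\<Sum>e\<in>E. \<Sum>f\<in>E. ip (S \<cdot> e) f *\<^sub>R b f e)" by simp
  also have "\<dots> = (\<Sum>f\<in>E. \<Sum>e\<in>E. ip (S \<cdot> e) f *\<^sub>R b f e)" by (rule sum.swap)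
  also have "\<dots> = (\<Sum>f\<in>E. \<Sum>e\<in>E. - (ip (S \<cdot> f) e *\<^sub>R b f e))"
  proof (intro sum.cong refl)
    show "ip (S \<cdot> e) f *\<^sub>R b f e = - (ip (S \<cdot> f) e *\<^sub>R b f e)" for e f
      using skewD[OF S, of e f] ip_sym[of e "S \<cdot> f"] by simp
  qed
  also have "\<dots> = - (\<Sum>f\<in>E. b f (S \<cdot> f))"
    by (simp add: sum_negf sum_E_expand[OF l(2)] skew_P S)
  finally show ?thesis .
qed

lemma skew_sym_zero:
  assumes b: "bilinear b" and S: "skew S" and sym: "\<And>x y. b x y = b y x"
  shows "(\<Sum>e\<in>E. b e (S \<cdot> e)) = 0"
proof -
  have "(\<Sum>e\<in>E. b e (S \<cdot> e)) = - (\<Sum>e\<in>E. b e (S \<cdot> e))"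
    using skew_shift[OF b S] by (simp add: sym)
  then have "2 *\<^sub>R (\<Sum>e\<in>E. b e (S \<cdot> e)) = 0"
    by (metis add.right_inverse scaleR_2)
  then show ?thesis by simp
qed

lemma tr_skew_mult_skew: "skew S \<Longrightarrow> tr (S * S) = - (\<Sum>e\<in>E. ip (S \<cdot> e) (S \<cdot> e))"
  by (simp add: tr_def skewD[of S "S \<cdot> _"] sum_negf)

lemma tr_skew_sq_nonpos: "skew S \<Longrightarrow> tr (S * S) \<le> 0"
  by (simp add: tr_skew_mult_skew sum_nonneg ip_self_nonneg)

lemma tr_skew_sq_0:
  assumes S: "skew S" and "tr (S * S) = 0"
  shows "S = 0"
proof -
  have "(\<Sum>e\<in>E. ip (S \<cdot> e) (S \<cdot> e)) = 0" using assms by (simp add: tr_skew_mult_skew)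
  then have "\<forall>e\<in>E. ip (S \<cdot> e) (S \<cdot> e) = 0"
    by (subst (asm) sum_nonneg_eq_0_iff) (auto simp: ip_self_nonneg)
  then have z: "\<forall>e\<in>E. S \<cdot> e = 0" using ip_self_0 skew_P(1)[OF S] by blast
  show ?thesis
  proof (rule lin_eqI)
    fix x
    have "S \<cdot> x = S \<cdot> (P \<cdot> x)" by (simp add: skew_P S)
    also have "\<dots> = 0" using z by (simp add: P_app)
    finally show "S \<cdot> x = 0 \<cdot> x" by simp
  qed
qed

end

text \<open>The form may be degenerate off the span, as happens after extension by a projection;
  positivity is therefore asked only there. The expansion clause encodes that \<open>F\<close>
  spans.\<close>

lemma gram_schmidt_span:
  fixes \<phi> :: "'a::real_vector \<Rightarrow> 'a \<Rightarrow> real"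
  assumes "finite B" and bil: "bilinear \<phi>" and sym: "\<And>x y. \<phi> x y = \<phi> y x"
    and "\<And>x. x \<in> span B \<Longrightarrow> x \<noteq> 0 \<Longrightarrow> \<phi> x x > 0"
  shows "\<exists>F. finite F \<and> F \<subseteq> span B \<and> (\<forall>f\<in>F. \<forall>g\<in>F. \<phi> f g = (if f = g then 1 else 0)) \<and>
    (\<forall>x\<in>span B. (\<Sum>f\<in>F. \<phi> x f *\<^sub>R f) = x)"
  using assms(1,4)
proof (induction B rule: finite_induct)
  case empty
  then show ?case by (intro exI[of _ "{}"]) auto
next
  case (insert b B)
  note lin = bilinear_ladd[OF bil] bilinear_radd[OF bil] bilinear_lmul[OF bil] bilinear_rmul[OF bil]
    bilinear_lsub[OF bil] bilinear_rsub[OF bil] bilinear_lzero[OF bil] bilinear_rzero[OF bil]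
  have sub: "span B \<subseteq> span (insert b B)" by (simp add: span_mono subset_insertI)
  obtain F where F: "finite F" "F \<subseteq> span B" "\<And>f g. f \<in> F \<Longrightarrow> g \<in> F \<Longrightarrow> \<phi> f g = (if f = g then 1 else 0)"
    "\<And>x. x \<in> span B \<Longrightarrow> (\<Sum>f\<in>F. \<phi> x f *\<^sub>R f) = x"
  proof -
    have "\<phi> x x > 0" if "x \<in> span B" "x \<noteq> 0" for x
      using insert.prems[of x] that sub by blast
    from insert.IH[OF this] that show thesis by blast
  qed
  define s where "s = (\<Sum>f\<in>F. \<phi> b f *\<^sub>R f)"
  define r where "r = b - s"
  have s: "s \<in> span B" unfolding s_def using F(2) by (intro span_sum span_scale) auto
  have lsum: "\<phi> (sum h A) z = (\<Sum>a\<in>A. \<phi> (h a) z)" for h A z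
    by (induction A rule: infinite_finite_induct) (auto simp: lin)
  have rF: "\<phi> r f = 0" if "f \<in> F" for f
  proof -
    have "\<phi> s f = (\<Sum>g\<in>F. if g = f then \<phi> b g else 0)"
      unfolding s_def lsum by (rule sum.cong) (use that F(3) in \<open>auto simp: lin\<close>)
    then show ?thesis using that F(1) by (simp add: r_def lin)
  qed
  have r: "r \<in> span (insert b B)"
    unfolding r_def using s sub by (intro span_diff) (auto intro: span_base)
  show ?case
  proof (cases "r = 0")
    case True
    then have "b \<in> span B" using s by (simp add: r_def)
    then have "span (insert b B) = span B" by (simp add: span_redundant)
    then show ?thesis using F by (intro exI[of _ F]) simp
  next
    case False
    define c where "c = sqrt (\<phi> r r)"
    have pos: "\<phi> r r > 0" using insert.prems[OF r False] .
    then have c: "c > 0" "c * c = \<phi> r r" by (simp_all add: c_def)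
    define g where "g = (1 / c) *\<^sub>R r"
    have gg: "\<phi> g g = 1" using c pos by (simp add: g_def lin)
    have gF: "\<phi> g f = 0" "\<phi> f g = 0" if "f \<in> F" for f
      using rF[OF that] sym[of f g] by (simp_all add: g_def lin)
    have notin: "g \<notin> F" using gF gg by force
    have vg: "\<phi> v g = 0" if "v \<in> span B" for v
    proof -
      have "\<phi> v g = \<phi> (\<Sum>f\<in>F. \<phi> v f *\<^sub>R f) g" using F(4)[OF that] by simp
      also have "\<dots> = 0" by (simp add: lsum lin gF)
      finally show ?thesis .
    qed
    have rg: "\<phi> r g *\<^sub>R g = r" using c pos by (simp add: g_def lin)
    have "(\<Sum>f\<in>insert g F. \<phi> x f *\<^sub>R f) = x" if xs: "x \<in> span (insert b B)" for x
    proof -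
      \<comment> \<open>Modulo the old span, \<open>x\<close> is a multiple of \<open>b\<close> and
        hence of the residual \<open>r\<close>; the new vector \<open>g\<close> takes up that
        multiple.\<close>
      obtain k where k: "x - k *\<^sub>R b \<in> span B" using iffD1[OF span_breakdown_eq xs] by blast
      define v where "v = x - k *\<^sub>R b + k *\<^sub>R s"
      have v: "v \<in> span B" unfolding v_def using k s by (intro span_add span_scale)
      have x: "x = k *\<^sub>R r + v" by (simp add: v_def r_def algebra_simps)
      have "(\<Sum>f\<in>F. \<phi> x f *\<^sub>R f) = (\<Sum>f\<in>F. \<phi> v f *\<^sub>R f)"
        by (rule sum.cong) (simp_all add: x lin rF)
      also have "\<dots> = v" using F(4)[OF v] by simp
      finally have "(\<Sum>f\<in>F. \<phi> x f *\<^sub>R f) = v" .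
      moreover have "\<phi> x g *\<^sub>R g = k *\<^sub>R r"
        unfolding x using rg by (simp add: lin vg[OF v] flip: scaleR_scaleR)
      ultimately show ?thesis using F(1) notin x by simp
    qed
    moreover have "insert g F \<subseteq> span (insert b B)"
      using r F(2) sub by (auto simp: g_def intro: span_scale)
    moreover have "\<forall>f\<in>insert g F. \<forall>h\<in>insert g F. \<phi> f h = (if f = h then 1 else 0)"
      using F(3) gg gF notin by auto
    ultimately show ?thesis using F(1) by (intro exI[of _ "insert g F"]) blast
  qed
qed

lemma gram_schmidt:
  fixes \<phi> :: "'a::real_vector \<Rightarrow> 'a \<Rightarrow> real"
  assumes "finite E" "subspace V" "V \<subseteq> span E"
    and "bilinear \<phi>" "\<And>x y. \<phi> x y = \<phi> y x" "\<And>x. x \<in> V \<Longrightarrow> x \<noteq> 0 \<Longrightarrow> \<phi> x x > 0"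
  obtains F where "finite F" "F \<subseteq> V" "\<And>f g. f \<in> F \<Longrightarrow> g \<in> F \<Longrightarrow> \<phi> f g = (if f = g then 1 else 0)"
    "\<And>x. x \<in> V \<Longrightarrow> (\<Sum>f\<in>F. \<phi> x f *\<^sub>R f) = x"
proof -
  obtain B where B: "B \<subseteq> V" "independent B" "V \<subseteq> span B"
    using maximal_independent_subset by blast
  then have "finite B"
    using independent_span_bound[OF assms(1), of B] assms(3) by blast
  moreover have "span B = V" using B assms(2) by (simp add: span_minimal subset_antisym)
  ultimately show ?thesis using gram_schmidt_span[of B \<phi>] assms(4-6) that by auto
qed

section \<open>Hermitian frames and simultaneous diagonalisation\<close>

text \<open>The ambient space may be infinite-dimensional, so finiteness of both bases comes from
  \<open>E\<close>. A basis of the smaller space stays independent when \<open>x\<close> is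
  adjoined.\<close>

lemma dim_psubset:
  fixes W :: "'a::real_vector set"
  assumes "finite E" "W \<subseteq> span E" "subspace W'" "W' \<subseteq> W" "x \<in> W" "x \<notin> W'"
  shows "dim W' < dim W"
proof -
  obtain B' where B': "B' \<subseteq> W'" "independent B'" "W' \<subseteq> span B'" "card B' = dim W'"
    using basis_exists by blast
  obtain B where B: "B \<subseteq> W" "independent B" "W \<subseteq> span B" "card B = dim W"
    using basis_exists by blast
  have fin: "finite B" "finite B'"
    using independent_span_bound[OF assms(1), of B] independent_span_bound[OF assms(1), of B'] B B' assms
    by auto
  have "span B' = W'" using B' assms(3) by (simp add: span_minimal subset_antisym)
  then have "x \<notin> B'" and "x \<notin> span B'" using B' assms(6) by auto
  then have "independent (insert x B')"
    using B' by (simp add: independent_insert)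
  moreover have "insert x B' \<subseteq> span B" using B B' assms by auto
  ultimately have "card (insert x B') \<le> card B"
    using independent_span_bound[OF fin(1)] by blast
  then show ?thesis using B B' fin \<open>x \<notin> B'\<close> by simp
qed

text \<open>More than \<open>card E\<close> vectors in the span are dependent. The family is
  indexed, so repetitions are treated separately: there the difference of two equal members is the
  relation. It is meant for the powers of an operator applied to a vector.\<close>

lemma linear_relation:
  fixes x :: "nat \<Rightarrow> 'a::real_vector"
  assumes "finite E" "\<And>k. x k \<in> span E"
  obtains n c where "\<exists>k\<le>n. c k \<noteq> (0::real)" "(\<Sum>k\<le>n. c k *\<^sub>R x k) = 0"
proof (cases "inj_on x {..card E}")
  case True
  define S where "S = x ` {..card E}"
  have "card S = Suc (card E)" "finite S" using True by (simp_all add: S_def card_image)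
  moreover have "S \<subseteq> span E" using assms(2) by (auto simp: S_def)
  ultimately have "dependent S"
    using independent_span_bound[OF assms(1), of S] by auto
  then obtain u where u: "\<exists>v\<in>S. u v \<noteq> (0::real)" "(\<Sum>v\<in>S. u v *\<^sub>R v) = 0"
    using dependent_finite[of S] \<open>dependent S\<close> by (auto simp: S_def)
  from u(2) have "(\<Sum>k\<le>card E. u (x k) *\<^sub>R x k) = 0"
    unfolding S_def by (subst (asm) sum.reindex[OF True]) simp
  moreover have "\<exists>k\<le>card E. u (x k) \<noteq> 0" using u(1) by (auto simp: S_def)
  ultimately show ?thesis using that[of "card E" "\<lambda>k. u (x k)"] by blast
next
  case False
  then obtain i j where ij: "i \<le> card E" "j \<le> card E" "i \<noteq> j" "x i = x j"
    by (auto simp: inj_on_def)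
  define c where "c k = (if k = i then 1 else if k = j then -1 else (0::real))" for k
  have ex: "\<exists>k\<le>card E. c k \<noteq> 0" using ij by (intro exI[of _ i]) (simp add: c_def)
  have "(\<Sum>k\<le>card E. c k *\<^sub>R x k) = (\<Sum>k\<in>{i, j}. c k *\<^sub>R x k)"
    by (rule sum.mono_neutral_right) (use ij in \<open>auto simp: c_def\<close>)
  also have "\<dots> = 0" using ij by (simp add: c_def)
  finally have "(\<Sum>k\<le>card E. c k *\<^sub>R x k) = 0" .
  with ex show ?thesis by (rule that)
qed

locale hermitian_frame = frame ip E for ip :: "'a::real_vector \<Rightarrow> 'a \<Rightarrow> real" and E +
  fixes J :: "'a lin"
  assumes skew_J: "skew J" and JJ: "J * J = - P"
begin

lemma JJ_app [simp]: "J \<cdot> (J \<cdot> x) = - (P \<cdot> x)"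
  using arg_cong[OF JJ, of "\<lambda>F. F \<cdot> x"] by simp

lemma PJ [simp]: "P \<cdot> (J \<cdot> x) = J \<cdot> x" "J \<cdot> (P \<cdot> x) = J \<cdot> x"
  using skew_P[OF skew_J] by auto

lemma PP_app [simp]: "P \<cdot> (P \<cdot> x) = P \<cdot> x"
  using arg_cong[OF PP, of "\<lambda>F. F \<cdot> x"] by simp

lemma ipJ: "ip (J \<cdot> x) y = - ip x (J \<cdot> y)" and ipJJ: "ip (J \<cdot> x) (J \<cdot> y) = ip x y"
  using skewD[OF skew_J] by auto

lemma J_shift:
  assumes "bilinear b"
  shows "(\<Sum>e\<in>E. b (J \<cdot> e) e) = - (\<Sum>e\<in>E. b e (J \<cdot> e))"
  using skew_shift[OF assms skew_J] .


text \<open>Skew operators of a plane form a line, spanned by the rotation through a right angle,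
  which is \<open>J\<close> up to sign.\<close>

lemma skew_dim_2:
  assumes "card E = 2" and K: "skew K"
  obtains c where "K = c *\<^sub>R J"
proof -
  obtain e f where E: "E = {e, f}" "e \<noteq> f" using assms by (meson card_2_iff)
  define d where "d = ip (K \<cdot> e) f"
  define c where "c = ip (J \<cdot> e) f"
  have sk: "ip (X \<cdot> f) e = - ip (X \<cdot> e) f" if "skew X" for X
    using skewD[OF that, of f e] ip_sym by simp
  have Pv: "P \<cdot> v = ip v e *\<^sub>R e + ip v f *\<^sub>R f" for v
    unfolding P_app using E by simp
  have X: "X \<cdot> e = ip (X \<cdot> e) f *\<^sub>R f" "X \<cdot> f = - ip (X \<cdot> e) f *\<^sub>R e" if X: "skew X" for X
  proof -
    have "X \<cdot> e = P \<cdot> (X \<cdot> e)" "X \<cdot> f = P \<cdot> (X \<cdot> f)" by (simp_all add: skew_P X)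
    then show "X \<cdot> e = ip (X \<cdot> e) f *\<^sub>R f" "X \<cdot> f = - ip (X \<cdot> e) f *\<^sub>R e"
      unfolding Pv sk[OF X] by (simp_all add: skew_self X)
  qed
  have Je: "J \<cdot> e = c *\<^sub>R f" and Jf: "J \<cdot> f = - c *\<^sub>R e"
    using X[OF skew_J] by (simp_all add: c_def)
  have Ke: "K \<cdot> e = d *\<^sub>R f" and Kf: "K \<cdot> f = - d *\<^sub>R e"
    using X[OF K] by (simp_all add: d_def)
  have ef: "ip e e = 1" "ip f f = 1" using ip_E E by auto
  have cc: "c * c = 1" using ipJJ[of e e] by (simp add: Je ef)
  then have cc': "c * (c * r) = r" for r by (simp flip: mult.assoc)
  \<comment> \<open>Since \<open>c\<close> is its own inverse, this coefficient is the quotient of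
    \<open>d\<close> by \<open>c\<close>.\<close>
  have "K = (d * c) *\<^sub>R J"
  proof (rule lin_eqI)
    fix x
    have "K \<cdot> x = K \<cdot> (P \<cdot> x)" by (simp add: skew_P K)
    also have "\<dots> = (d * c) *\<^sub>R (J \<cdot> (P \<cdot> x))"
      by (simp only: Pv app_vec Ke Kf Je Jf) (simp add: algebra_simps cc')
    finally show "K \<cdot> x = ((d * c) *\<^sub>R J) \<cdot> x" by simp
  qed
  then show ?thesis by (rule that)
qed

lemma in_span: "P \<cdot> x = x \<Longrightarrow> x \<in> span E"
proof -
  assume "P \<cdot> x = x"
  then have "x = (\<Sum>e\<in>E. ip x e *\<^sub>R e)" by (simp flip: P_app)
  also have "\<dots> \<in> span E" by (intro span_sum span_scale span_base)
  finally show ?thesis .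
qed

text \<open>Complex scalars act through \<open>J\<close>. This is multiplicative only on the image
  of \<open>P\<close>, where the square of \<open>J\<close> is -1.\<close>

definition cs :: "complex \<Rightarrow> 'a \<Rightarrow> 'a" where
  "cs z v = Re z *\<^sub>R v + Im z *\<^sub>R (J \<cdot> v)"

lemma cs_simps [simp]: "cs 0 v = 0" "cs z 0 = 0" "cs (a + b) v = cs a v + cs b v"
  "cs z (v + u) = cs z v + cs z u" "cs (- z) v = - cs z v" "cs (complex_of_real r) v = r *\<^sub>R v"
  by (simp_all add: cs_def algebra_simps)

lemma cs_cs: "P \<cdot> v = v \<Longrightarrow> cs a (cs b v) = cs (a * b) v"
  by (simp add: cs_def algebra_simps)

text \<open>As \<open>T\<close> commutes with \<open>J\<close>, complex polynomials in
  \<open>T\<close> act on \<open>v\<close>. Linear dependence of the powers yields an annihilating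
  polynomial; its roots are split off until a cofactor sends \<open>v\<close> to a nonzero
  eigenvector. Skewness makes the eigenvalue imaginary.\<close>

lemma complex_eigenvector:
  fixes T :: "'a lin"
  assumes W: "subspace W" "\<And>x. x \<in> W \<Longrightarrow> P \<cdot> x = x" "\<And>x. x \<in> W \<Longrightarrow> J \<cdot> x \<in> W" "\<And>x. x \<in> W \<Longrightarrow> T \<cdot> x \<in> W"
    and T: "skew T" "\<And>x. T \<cdot> (J \<cdot> x) = J \<cdot> (T \<cdot> x)" and v: "v \<in> W" "v \<noteq> 0"
  obtains d w where "w \<in> W" "w \<noteq> 0" "T \<cdot> w = d *\<^sub>R (J \<cdot> w)"
proof -
  \<comment> \<open>Horner evaluation: \<open>ev p\<close> is the polynomial \<open>p\<close> in
    \<open>T\<close>, applied to \<open>v\<close>.\<close>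
  define ev where "ev p = fold_coeffs (\<lambda>a y. cs a v + T \<cdot> y) p 0" for p
  have ev0: "ev 0 = 0" by (simp add: ev_def)
  have evC: "ev (pCons a p) = cs a v + T \<cdot> ev p" for a p
    by (cases "p = 0"; cases "a = 0") (simp_all add: ev_def)
  have csW: "cs z x \<in> W" if "x \<in> W" for z x
    using W(3)[OF that] that by (simp add: cs_def subspace_add subspace_scale W(1))
  have evW: "ev p \<in> W" for p
  proof (induction p)
    case 0
    then show ?case using W(1) by (simp add: ev0 subspace_0)
  next
    case (pCons a p)
    then show ?case unfolding evC by (intro subspace_add W csW v)
  qed
  have Tcs: "T \<cdot> cs z x = cs z (T \<cdot> x)" for z x by (simp add: cs_def T)
  have ev_add: "ev (p + q) = ev p + ev q" for p q
  proof (induction p arbitrary: q)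
    case (pCons a p)
    obtain b r where "q = pCons b r" by (cases q)
    then show ?case using pCons.IH[of r] by (simp add: evC algebra_simps)
  qed (simp add: ev0)
  have ev_smult: "ev (smult c p) = cs c (ev p)" for c p
    by (induction p) (simp_all add: ev0 evC Tcs cs_cs W v)
  have ev_root: "ev ([:-z, 1:] * q) = T \<cdot> ev q - cs z (ev q)" for z q
  proof -
    have "[:-z, 1:] * q = smult (- z) q + pCons 0 q" by simp
    then show ?thesis by (simp only: ev_add ev_smult evC) simp
  qed
  \<comment> \<open>Let \<open>q\<close> be the cofactor of a root. If \<open>q\<close> still
    annihilates \<open>v\<close>, the degree has dropped; otherwise \<open>ev q\<close> is the
    eigenvector.\<close>
  have main: "\<exists>w z. w \<in> W \<and> w \<noteq> 0 \<and> T \<cdot> w = cs z w" if "p \<noteq> 0" "ev p = 0" for p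
    using that
  proof (induction "degree p" arbitrary: p rule: less_induct)
    case less
    show ?case
    proof (cases "degree p = 0")
      case True
      then obtain a where p: "p = [:a:]" by (meson degree_eq_zeroE)
      then have "a \<noteq> 0" using less.prems by auto
      have "cs (inverse a) (cs a v) = 0" using less.prems(2) by (simp add: p evC ev0)
      then have "v = 0" using \<open>a \<noteq> 0\<close> cs_cs[of v "inverse a" a] W v by (simp add: cs_def)
      then show ?thesis using v by simp
    next
      case False
      then have "\<not> constant (poly p)" by (simp add: constant_degree)
      then obtain z where "poly p z = 0" using fundamental_theorem_of_algebra by blast
      then obtain q where q: "p = [:-z, 1:] * q" by (auto simp: poly_eq_0_iff_dvd)
      then have "q \<noteq> 0" using less.prems by auto
      then have deg: "degree q < degree p" using degree_mult_eq[of "[:-z, 1:]" q] \<open>q \<noteq> 0\<close> unfolding q by simp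
      show ?thesis
      proof (cases "ev q = 0")
        case True
        then show ?thesis using less.hyps[OF deg \<open>q \<noteq> 0\<close>] by simp
      next
        case False
        moreover have "T \<cdot> ev q = cs z (ev q)" using less.prems(2) q ev_root[of z q] by simp
        ultimately show ?thesis using evW by blast
      qed
    qed
  qed
  have spanE: "x \<in> span E" if "x \<in> W" for x
    using in_span W(2)[OF that] by blast
  have ev_monom: "ev (monom (complex_of_real c) k) = c *\<^sub>R ((app T ^^ k) v)" for c k
    by (induction k) (simp_all add: monom_0 monom_Suc evC ev0)
  have powW: "(app T ^^ k) v \<in> W" for k by (induction k) (use v W in auto)
  obtain n c where c: "\<exists>k\<le>n. c k \<noteq> (0::real)" "(\<Sum>k\<le>n. c k *\<^sub>R (app T ^^ k) v) = 0"
    using linear_relation[OF finE, of "\<lambda>k. (app T ^^ k) v"] spanE[OF powW] by blast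
  define p where "p = (\<Sum>k\<le>n. monom (complex_of_real (c k)) k)"
  have "ev (sum h A) = (\<Sum>k\<in>A. ev (h k))" for h and A :: "nat set"
    by (induction A rule: infinite_finite_induct) (simp_all add: ev0 ev_add)
  then have "ev p = 0" using c(2) by (simp add: p_def ev_monom)
  moreover have "p \<noteq> 0"
  proof -
    obtain k where k: "k \<le> n" "c k \<noteq> 0" using c(1) by blast
    have "coeff p k = complex_of_real (c k)" using k(1) by (simp add: p_def coeff_sum)
    then show ?thesis using k(2) by auto
  qed
  ultimately obtain w z where w: "w \<in> W" "w \<noteq> 0" "T \<cdot> w = cs z w" using main by blast
  have "ip (T \<cdot> w) w = Re z * ip w w" by (simp add: w(3) cs_def skew_self[OF skew_J])
  then have "Re z * ip w w = 0" by (simp add: skew_self T)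
  then have "Re z = 0" using ip_self_0[OF W(2)[OF w(1)]] w(2) by auto
  then show ?thesis using that[of w "Im z"] w by (simp add: cs_def)
qed

text \<open>The family may be infinite, so there is no induction over its members. In an invariant
  nonzero subspace of least dimension, an eigenspace of one operator is again invariant because the
  operators commute, hence it is everything: every vector there is a common eigenvector.\<close>

lemma common_eigenvector:
  fixes \<T> :: "'a lin set"
  assumes V: "subspace V" "\<And>x. x \<in> V \<Longrightarrow> P \<cdot> x = x" "\<And>x. x \<in> V \<Longrightarrow> J \<cdot> x \<in> V"
      "\<And>T x. T \<in> \<T> \<Longrightarrow> x \<in> V \<Longrightarrow> T \<cdot> x \<in> V"
    and T: "\<And>T. T \<in> \<T> \<Longrightarrow> skew T" "\<And>T x. T \<in> \<T> \<Longrightarrow> T \<cdot> (J \<cdot> x) = J \<cdot> (T \<cdot> x)"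
      "\<And>T S x. T \<in> \<T> \<Longrightarrow> S \<in> \<T> \<Longrightarrow> T \<cdot> (S \<cdot> x) = S \<cdot> (T \<cdot> x)"
    and v: "v \<in> V" "v \<noteq> 0"
  obtains w where "w \<in> V" "ip w w = 1" "\<And>T. T \<in> \<T> \<Longrightarrow> \<exists>d. T \<cdot> w = d *\<^sub>R (J \<cdot> w)"
proof -
  define Q where "Q W \<longleftrightarrow> subspace W \<and> W \<subseteq> V \<and> (\<forall>x\<in>W. J \<cdot> x \<in> W) \<and> (\<forall>T\<in>\<T>. \<forall>x\<in>W. T \<cdot> x \<in> W)
    \<and> (\<exists>x\<in>W. x \<noteq> 0)" for W
  have "Q V" using V v by (auto simp: Q_def)
  then obtain W where W: "Q W" "\<And>W'. Q W' \<Longrightarrow> dim W \<le> dim W'"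
    using ex_has_least_nat[of Q V dim] by blast
  obtain w where w: "w \<in> W" "w \<noteq> 0" using W(1) by (auto simp: Q_def)
  have WV: "W \<subseteq> V" and sW: "subspace W" and JW: "\<And>x. x \<in> W \<Longrightarrow> J \<cdot> x \<in> W"
    and TW: "\<And>T x. T \<in> \<T> \<Longrightarrow> x \<in> W \<Longrightarrow> T \<cdot> x \<in> W" using W(1) by (auto simp: Q_def)
  have PW: "P \<cdot> x = x" if "x \<in> W" for x using V(2) WV that by auto
  have WE: "W \<subseteq> span E" using PW in_span by blast
  have ev: "\<exists>d. T \<cdot> w = d *\<^sub>R (J \<cdot> w)" if "T \<in> \<T>" for T
  proof -
    note TT = that
    obtain d x where x: "x \<in> W" "x \<noteq> 0" "T \<cdot> x = d *\<^sub>R (J \<cdot> x)"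
      by (rule complex_eigenvector[of W T w]) (use sW PW JW TW TT T w in blast)+
    define W' where "W' = {x \<in> W. T \<cdot> x = d *\<^sub>R (J \<cdot> x)}"
    have sW': "subspace W'" unfolding W'_def using sW by (auto simp: subspace_def algebra_simps)
    have "S \<cdot> y \<in> W'" if "S \<in> \<T>" "y \<in> W'" for S y
    proof -
      have "T \<cdot> (S \<cdot> y) = d *\<^sub>R (J \<cdot> (S \<cdot> y))"
        using that by (simp add: T(3)[OF TT that(1)] T(2)[OF that(1), symmetric] W'_def)
      then show ?thesis using that TW by (simp add: W'_def)
    qed
    then have "Q W'"
      unfolding Q_def using sW' WV JW x by (auto simp: W'_def T(2)[OF TT])
    then have "\<not> dim W' < dim W" using W(2)[of W'] by simp
    then have "w \<in> W'"
      using dim_psubset[OF finE WE sW', of w] w(1) by (auto simp: W'_def)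
    then show ?thesis by (auto simp: W'_def)
  qed
  have pos: "ip w w > 0"
    using ip_self_nonneg[of w] ip_self_0[OF PW[OF w(1)]] w(2) by (simp add: order_le_less) blast
  define c where "c = 1 / sqrt (ip w w)"
  have "ip (c *\<^sub>R w) (c *\<^sub>R w) = 1" using pos by (simp add: c_def real_div_sqrt)
  moreover have "c *\<^sub>R w \<in> V" using V(1) w(1) WV by (auto intro: subspace_scale)
  moreover have "\<exists>d. T \<cdot> (c *\<^sub>R w) = d *\<^sub>R (J \<cdot> (c *\<^sub>R w))" if "T \<in> \<T>" for T
    using ev[OF that] by (metis app_vec(5) scaleR_left_commute)
  ultimately show ?thesis using that by blast
qed

text \<open>The two scalar conditions are the real and the imaginary part of Hermitian
  orthonormality, so that \<open>F\<close> together with its image under \<open>J\<close> is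
  orthonormal over the reals.\<close>

definition unitary :: "'a set \<Rightarrow> bool" where
  "unitary F \<longleftrightarrow> finite F \<and> (\<forall>f\<in>F. P \<cdot> f = f) \<and>
     (\<forall>f\<in>F. \<forall>g\<in>F. ip f g = (if f = g then 1 else 0) \<and> ip f (J \<cdot> g) = 0)"

lemma unitary_card: "unitary F \<Longrightarrow> card F \<le> card E"
proof -
  assume F: "unitary F"
  have "F \<subseteq> span E"
    using F in_span by (auto simp: unitary_def)
  moreover have "independent F"
  proof
    assume "dependent F"
    then obtain u f where u: "f \<in> F" "u f \<noteq> (0::real)" "(\<Sum>g\<in>F. u g *\<^sub>R g) = 0"
      using F dependent_finite[of F] by (auto simp: unitary_def)
    have "ip (\<Sum>g\<in>F. u g *\<^sub>R g) f = (\<Sum>g\<in>F. if g = f then u g else 0)"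
      unfolding ip_sum by (rule sum.cong) (use F u in \<open>auto simp: unitary_def\<close>)
    then show False using u F by (simp add: unitary_def)
  qed
  ultimately show ?thesis using independent_span_bound[OF finE] by blast
qed

text \<open>Let \<open>F\<close> be a unitary set of joint eigenvectors of largest size. The
  complement of \<open>F\<close> and \<open>J F\<close> is invariant, and a nonzero vector in it
  would provide one more joint eigenvector.\<close>

lemma unitary_eigenbasis:
  fixes \<T> :: "'a lin set"
  assumes T: "\<And>T. T \<in> \<T> \<Longrightarrow> skew T" "\<And>T x. T \<in> \<T> \<Longrightarrow> T \<cdot> (J \<cdot> x) = J \<cdot> (T \<cdot> x)"
      "\<And>T S x. T \<in> \<T> \<Longrightarrow> S \<in> \<T> \<Longrightarrow> T \<cdot> (S \<cdot> x) = S \<cdot> (T \<cdot> x)"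
  obtains F where "unitary F" "\<And>T f. T \<in> \<T> \<Longrightarrow> f \<in> F \<Longrightarrow> \<exists>d. T \<cdot> f = d *\<^sub>R (J \<cdot> f)"
    "\<And>x. P \<cdot> x = (\<Sum>f\<in>F. ip x f *\<^sub>R f + ip x (J \<cdot> f) *\<^sub>R (J \<cdot> f))"
proof -
  define Q where "Q F \<longleftrightarrow> unitary F \<and> (\<forall>T\<in>\<T>. \<forall>f\<in>F. \<exists>d. T \<cdot> f = d *\<^sub>R (J \<cdot> f))" for F
  have "Q {}" by (simp add: Q_def unitary_def)
  moreover have "\<forall>F. Q F \<longrightarrow> card F < card E + 1"
    using unitary_card by (auto simp: Q_def less_Suc_eq_le)
  ultimately obtain F where F: "Q F" "\<And>F'. Q F' \<Longrightarrow> card F' \<le> card F"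
    using ex_has_greatest_nat[of Q "{}" card "card E + 1"] by blast
  define V where "V = {x. P \<cdot> x = x \<and> (\<forall>f\<in>F. ip x f = 0 \<and> ip x (J \<cdot> f) = 0)}"
  have uF: "unitary F" using F(1) by (simp add: Q_def)
  have sV: "subspace V" by (auto simp: subspace_def V_def)
  have JV: "J \<cdot> x \<in> V" if "x \<in> V" for x
    using that by (simp add: V_def ipJ)
  have TV: "T \<cdot> x \<in> V" if "T \<in> \<T>" "x \<in> V" for T x
  proof -
    have "ip (T \<cdot> x) f = 0 \<and> ip (T \<cdot> x) (J \<cdot> f) = 0" if fF: "f \<in> F" for f
    proof -
      obtain d where d: "T \<cdot> f = d *\<^sub>R (J \<cdot> f)" using F(1) \<open>T \<in> \<T>\<close> fF by (auto simp: Q_def)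
      then show ?thesis
        using \<open>x \<in> V\<close> fF by (simp add: skewD[OF T(1)[OF \<open>T \<in> \<T>\<close>]] T(2)[OF \<open>T \<in> \<T>\<close>] V_def)
    qed
    then show ?thesis by (simp add: V_def skew_P T(1) that)
  qed
  have V0: "v = 0" if "v \<in> V" for v
  proof (rule ccontr)
    assume "v \<noteq> 0"
    obtain w where w: "w \<in> V" "ip w w = 1" "\<And>T. T \<in> \<T> \<Longrightarrow> \<exists>d. T \<cdot> w = d *\<^sub>R (J \<cdot> w)"
      using common_eigenvector[OF sV _ JV TV T \<open>v \<in> V\<close> \<open>v \<noteq> 0\<close>] by (auto simp: V_def)
    have "w \<notin> F" using w(1,2) by (auto simp: V_def)
    have wf: "ip w f = 0" "ip f w = 0" "ip w (J \<cdot> f) = 0" "ip f (J \<cdot> w) = 0" if "f \<in> F" for f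
      using w(1) that ipJ[of f w] ip_sym[of f w] ip_sym[of w "J \<cdot> f"] by (auto simp: V_def)
    have "ip w (J \<cdot> w) = 0" using skew_self[OF skew_J, of w] ip_sym by metis
    then have "Q (insert w F)"
      using F(1) w wf \<open>w \<notin> F\<close> unfolding Q_def unitary_def by (auto simp: V_def)
    then show False using F(2)[of "insert w F"] uF \<open>w \<notin> F\<close> by (simp add: unitary_def)
  qed
  have "P \<cdot> x = (\<Sum>f\<in>F. ip x f *\<^sub>R f + ip x (J \<cdot> f) *\<^sub>R (J \<cdot> f))" for x
  proof -
    define s where "s = (\<Sum>f\<in>F. ip x f *\<^sub>R f + ip x (J \<cdot> f) *\<^sub>R (J \<cdot> f))"
    have "P \<cdot> s = s" using uF by (simp add: s_def unitary_def)
    moreover have "ip s f = ip x f \<and> ip s (J \<cdot> f) = ip x (J \<cdot> f)" if "f \<in> F" for f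
    proof -
      have fg: "ip (J \<cdot> g) f = 0" if "g \<in> F" for g
        using uF that \<open>f \<in> F\<close> ip_sym[of "J \<cdot> g" f] by (simp add: unitary_def)
      have "ip s f = (\<Sum>g\<in>F. if g = f then ip x g else 0)"
        unfolding s_def ip_sum by (rule sum.cong) (use uF that fg in \<open>auto simp: unitary_def\<close>)
      moreover have "ip s (J \<cdot> f) = (\<Sum>g\<in>F. if g = f then ip x (J \<cdot> g) else 0)"
        unfolding s_def ip_sum by (rule sum.cong) (use uF that in \<open>auto simp: unitary_def ipJJ\<close>)
      ultimately show ?thesis using uF that by (simp add: unitary_def)
    qed
    ultimately have "P \<cdot> x - s \<in> V" by (simp add: V_def)
    then show ?thesis using V0[of "P \<cdot> x - s"] by (simp add: s_def)
  qed
  then show ?thesis using that[of F] F(1) uF by (auto simp: Q_def)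
qed

end

section \<open>Rigidity of the transversal geometry\<close>

text \<open>\<open>G\<close> is the transversal Levi-Civita connection, \<open>D\<close> the action of the Reeb vector on the
  contact hyperplane; \<open>G_div\<close> is unimodularity.\<close>

locale transversal_data = hermitian_frame ip E J
  for ip :: "'a::real_vector \<Rightarrow> 'a \<Rightarrow> real" and E and J +
  fixes D :: "'a lin" and G :: "'a \<Rightarrow> 'a lin"
  assumes skew_D: "skew D" and DJ: "D * J = J * D"
    and skew_G: "skew (G x)" and GJ: "G x * J = J * G x"
    and G_add [simp]: "G (x + y) = G x + G y" and G_scale [simp]: "G (c *\<^sub>R x) = c *\<^sub>R G x"
    and G_P [simp]: "G (P \<cdot> x) = G x"
    and GD: "D * G x - G x * D = G (D \<cdot> x)"
    and G_div: "(\<Sum>e\<in>E. G e \<cdot> e) = 0"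
begin

text \<open>The transversal bracket, recovered from the connection by vanishing torsion.\<close>

definition tau :: "'a \<Rightarrow> 'a \<Rightarrow> 'a" where "tau x y = G x \<cdot> y - G y \<cdot> x"
definition w :: "'a \<Rightarrow> 'a \<Rightarrow> real" where "w x y = ip (J \<cdot> x) y"
definition R :: "'a \<Rightarrow> 'a \<Rightarrow> 'a lin" where
  "R x y = G x * G y - G y * G x - G (tau x y) - w x y *\<^sub>R D"

lemma G_linear: "linear G"
  by (simp add: linear_iff)

lemma G_simps [simp]: "G (x - y) = G x - G y" "G (- x) = - G x" "G 0 = 0"
  using G_linear by (simp_all add: linear_diff linear_neg linear_0)

lemma PG [simp]: "P \<cdot> (G y \<cdot> x) = G y \<cdot> x" "G y \<cdot> (P \<cdot> x) = G y \<cdot> x"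
  using skew_P[OF skew_G] by auto

lemma PD [simp]: "D \<cdot> (P \<cdot> x) = D \<cdot> x"
  using skew_P[OF skew_D] by auto

lemma GJ_app: "G y \<cdot> (J \<cdot> x) = J \<cdot> (G y \<cdot> x)"
  using arg_cong[OF GJ, of "\<lambda>F. F \<cdot> x"] by simp

lemma DJ_app: "D \<cdot> (J \<cdot> x) = J \<cdot> (D \<cdot> x)"
  using arg_cong[OF DJ, of "\<lambda>F. F \<cdot> x"] by simp

lemma ipG: "ip (G z \<cdot> x) y = - ip x (G z \<cdot> y)"
  using skewD[OF skew_G] by auto

lemma w_simps [simp]: "w (x + y) z = w x z + w y z" "w z (x + y) = w z x + w z y"
  "w (c *\<^sub>R x) z = c * w x z" "w z (c *\<^sub>R x) = c * w z x"
  "w (x - y) z = w x z - w y z" "w z (x - y) = w z x - w z y"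
  "w 0 z = 0" "w z 0 = 0"
  "w (- x) z = - w x z" "w z (- x) = - w z x" "w (P \<cdot> x) y = w x y" "w x (P \<cdot> y) = w x y"
  by (simp_all add: w_def)

lemma w_anti: "w x y = - w y x"
  using ipJ[of x y] ip_sym[of x "J \<cdot> y"] by (simp add: w_def)

lemma w_J: "w (J \<cdot> x) (J \<cdot> y) = w x y"
  by (simp add: w_def ipJ)

lemma tau_simps [simp]: "tau (x + y) z = tau x z + tau y z" "tau z (x + y) = tau z x + tau z y"
  "tau (c *\<^sub>R x) z = c *\<^sub>R tau x z" "tau z (c *\<^sub>R x) = c *\<^sub>R tau z x"
  "tau (x - y) z = tau x z - tau y z" "tau z (x - y) = tau z x - tau z y" "tau 0 z = 0" "tau z 0 = 0"
  "tau (- x) z = - tau x z" "tau z (- x) = - tau z x"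
  "tau (P \<cdot> x) y = tau x y" "tau x (P \<cdot> y) = tau x y" "P \<cdot> tau x y = tau x y"
  by (simp_all add: tau_def algebra_simps)

lemma tau_anti: "tau x y = - tau y x"
  by (simp add: tau_def)

lemma R_simps [simp]: "R (x + y) z = R x z + R y z" "R z (x + y) = R z x + R z y"
  "R (c *\<^sub>R x) z = c *\<^sub>R R x z" "R z (c *\<^sub>R x) = c *\<^sub>R R z x"
  "R (- x) z = - R x z" "R z (- x) = - R z x"
  "R (x - y) z = R x z - R y z" "R z (x - y) = R z x - R z y" "R 0 z = 0" "R z 0 = 0"
  "R (P \<cdot> x) y = R x y" "R x (P \<cdot> y) = R x y"
  by (simp_all add: R_def algebra_simps)

lemma R_anti: "R x y = - R y x"
  unfolding R_def using w_anti[of x y] tau_anti[of x y] by simp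

lemma skew_R [simp, intro]: "skew (R x y)"
  unfolding R_def by (intro skew_intros skew_commutator skew_G skew_D)

lemma ipR: "ip (R a b \<cdot> x) y = - ip x (R a b \<cdot> y)"
  by (rule skewD) simp

lemma RJ_app: "R a b \<cdot> (J \<cdot> x) = J \<cdot> (R a b \<cdot> x)"
  by (simp add: R_def GJ_app DJ_app)

text \<open>The contraction of the bracket with the Kaehler form. In the rigidity argument
  unimodularity enters only in this shape.\<close>

lemma tau_trace: "(\<Sum>e\<in>E. tau e (J \<cdot> e)) = 0"
proof -
  have "bilinear (\<lambda>x y. G x \<cdot> y)" by (rule bilinI) simp_all
  from J_shift[OF this] have "(\<Sum>e\<in>E. tau e (J \<cdot> e)) = 2 *\<^sub>R (\<Sum>e\<in>E. G e \<cdot> (J \<cdot> e))"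
    by (simp add: tau_def sum_subtractf scaleR_2)
  also have "(\<Sum>e\<in>E. G e \<cdot> (J \<cdot> e)) = J \<cdot> (\<Sum>e\<in>E. G e \<cdot> e)"
    by (simp add: GJ_app)
  finally show ?thesis by (simp add: G_div)
qed

lemma w_trace: "(\<Sum>e\<in>E. w e (J \<cdot> e)) = card E"
proof -
  have "w e (J \<cdot> e) = 1" if "e \<in> E" for e
    using that by (simp add: w_def ipJJ ip_E)
  then show ?thesis by simp
qed

end

text \<open>The right side is the Jacobi defect: \<open>tau y z\<close> has lost the \<xi> component
  \<open>w y z\<close> of the full bracket, and \<xi> acts by \<open>D\<close>.\<close>

locale transversal_geometry = transversal_data +
  assumes tau_jacobi: "tau x (tau y z) + tau y (tau z x) + tau z (tau x y)
    = w y z *\<^sub>R D \<cdot> x + w z x *\<^sub>R D \<cdot> y + w x y *\<^sub>R D \<cdot> z"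
begin

text \<open>Expansion leaves the Jacobi sum of \<open>tau\<close>, and the \<open>D\<close> terms of
  \<open>R\<close> cancel its defect.\<close>

lemma bianchi: "R x y \<cdot> z + R y z \<cdot> x + R z x \<cdot> y = 0"
proof -
  have "tau x (tau y z) + tau y (tau z x) + tau z (tau x y)
    - (w y z *\<^sub>R D \<cdot> x + w z x *\<^sub>R D \<cdot> y + w x y *\<^sub>R D \<cdot> z)
    = R x y \<cdot> z + R y z \<cdot> x + R z x \<cdot> y"
    unfolding R_def tau_def by (simp add: algebra_simps)
  then show ?thesis using tau_jacobi[of x y z] by simp
qed

text \<open>The octahedron argument: four instances of the Bianchi identity combined with
  antisymmetry in the first and in the last two arguments.\<close>

lemma R_pair: "ip (R x y \<cdot> z) t = ip (R z t \<cdot> x) y"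
proof -
  define r where "r a b c d = ip (R a b \<cdot> c) d" for a b c d
  have b: "r a b c d + r b c a d + r c a b d = 0" for a b c d
    using arg_cong[OF bianchi[of a b c], of "\<lambda>v. ip v d"] by (simp add: r_def)
  have s: "r a b c d = - r a b d c" for a b c d
    unfolding r_def by (subst ipR) (simp add: ip_sym[of c])
  have a: "r a b c d = - r b a c d" for a b c d
    unfolding r_def by (subst R_anti) simp
  have "r x y z t = r z t x y"
    using b[of x y z t] b[of y z t x] b[of z t x y] b[of t x y z]
      s[of y z t x] s[of z t y x] s[of t y z x] a[of t y x z] s[of t x z y]
      s[of x z t y] a[of x z y t] s[of x y t z] by linarith
  then show ?thesis by (simp add: r_def)
qed

text \<open>The operators \<open>R x y\<close> commute with \<open>J\<close>; pair symmetry
  transfers this to the arguments, so the curvature is of type (1,1).\<close>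

lemma R_JJ: "R (J \<cdot> x) (J \<cdot> y) = R x y"
proof (rule lin_eqI)
  fix z
  have "ip (R (J \<cdot> x) (J \<cdot> y) \<cdot> z) t = ip (R x y \<cdot> z) t" for t
    unfolding R_pair[of "J \<cdot> x" "J \<cdot> y" z t] R_pair[of x y z t] by (simp add: RJ_app ipJJ)
  then show "R (J \<cdot> x) (J \<cdot> y) \<cdot> z = R x y \<cdot> z"
    by - (rule ip_eqI; simp add: skew_P)
qed

lemma R_J1: "R x (J \<cdot> y) = - R (J \<cdot> x) y"
  using R_JJ[of x "J \<cdot> y"] by simp

section \<open>Ricci form and Einstein condition\<close>

definition a :: real where "a = tr (J * D)"
text \<open>Up to a factor, the connection form that \<open>G\<close> induces on the canonical
  bundle.\<close>

definition kap :: "'a \<Rightarrow> real" where "kap x = tr (J * G x)"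
text \<open>The first summand is the Ricci form up to a factor. The shift by \<open>a\<close>
  removes the contribution of the \<open>D\<close> term of \<open>R\<close>, so that
  \<open>rho\<close> becomes the differential of \<open>kap\<close>.\<close>

definition rho :: "'a \<Rightarrow> 'a \<Rightarrow> real" where "rho x y = tr (J * R x y) + w x y * a"

lemma kap_simps [simp]: "kap (x + y) = kap x + kap y" "kap (c *\<^sub>R x) = c * kap x"
  "kap (x - y) = kap x - kap y" "kap (- x) = - kap x" "kap 0 = 0"
  by (simp_all add: kap_def algebra_simps)

lemma rho_simps [simp]: "rho (x + y) z = rho x z + rho y z" "rho z (x + y) = rho z x + rho z y"
  "rho (c *\<^sub>R x) z = c * rho x z" "rho z (c *\<^sub>R x) = c * rho z x"
  "rho (- x) z = - rho x z" "rho z (- x) = - rho z x"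
  "rho (x - y) z = rho x z - rho y z" "rho z (x - y) = rho z x - rho z y"
  "rho 0 z = 0" "rho z 0 = 0"
  "rho (P \<cdot> x) y = rho x y" "rho x (P \<cdot> y) = rho x y"
  by (simp_all add: rho_def algebra_simps)

lemma tr_J_commutator: "tr (J * (G x * G y - G y * G x)) = 0"
proof -
  have "tr (J * G x * G y) = tr (G x * (J * G y))"
    by (simp only: GJ[of x, symmetric] mult.assoc[symmetric])
  also have "\<dots> = tr (J * G y * G x)"
    by (rule tr_commute) (auto simp: skew_G skew_J)
  finally show ?thesis by (simp add: algebra_simps)
qed

lemma rho_kap: "rho x y = - kap (tau x y)"
  unfolding rho_def R_def kap_def a_def
  using tr_J_commutator[of x y] by (simp add: algebra_simps)

lemma rho_anti: "rho x y = - rho y x"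
  using tau_anti[of x y] by (simp add: rho_kap)

lemma rho_JJ: "rho (J \<cdot> x) (J \<cdot> y) = rho x y"
  by (simp add: rho_def R_JJ w_J)

lemma rho_J1: "rho x (J \<cdot> y) = - rho (J \<cdot> x) y"
  using rho_JJ[of x "J \<cdot> y"] by simp

text \<open>By \<open>GD\<close> the operator \<open>G (D x)\<close> is a commutator with
  \<open>D\<close>, and \<open>D\<close> commutes with \<open>J\<close>.\<close>

lemma kap_D: "kap (D \<cdot> x) = 0"
proof -
  have "tr (J * D * G x) = tr (D * (J * G x))" by (simp only: DJ mult.assoc[symmetric])
  also have "\<dots> = tr (J * G x * D)"
    by (rule tr_commute) (auto simp: skew_G skew_J skew_D)
  finally show ?thesis by (simp add: kap_def algebra_simps flip: GD)
qed

text \<open>Exactness does not give closedness for free, because \<open>tau\<close> violates the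
  Jacobi identity. The defect lies in the image of \<open>D\<close>, where \<open>kap\<close>
  vanishes.\<close>

lemma rho_closed: "rho x (tau y z) + rho y (tau z x) + rho z (tau x y) = 0"
  using arg_cong[OF tau_jacobi[of x y z], of kap] by (simp add: rho_kap kap_D)

text \<open>As \<open>rho\<close> is closed and of type (1,1), contracting \<open>d rho = 0\<close> with \<open>J\<close> shows that it is
  coclosed; being exact as well, it vanishes.\<close>

lemma rho_coclosed_J: "(\<Sum>e\<in>E. rho e (G (J \<cdot> e) \<cdot> z)) = 0"
proof -
  have b1: "bilinear (\<lambda>x y. rho x (tau y z))" by (rule bilinI) simp_all
  have b3: "bilinear (\<lambda>x y. rho x (J \<cdot> y))" by (rule bilinI) simp_all
  have "0 = (\<Sum>e\<in>E. rho e (tau (J \<cdot> e) z) + rho (J \<cdot> e) (tau z e) + rho z (tau e (J \<cdot> e)))"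
    by (simp add: rho_closed)
  also have "\<dots> = (\<Sum>e\<in>E. rho e (tau (J \<cdot> e) z)) + (\<Sum>e\<in>E. rho (J \<cdot> e) (tau z e)) + rho z (\<Sum>e\<in>E. tau e (J \<cdot> e))"
  proof -
    have "linear (rho z)" by (simp add: linear_iff)
    then show ?thesis by (simp add: sum.distrib linear_sum)
  qed
  also have "(\<Sum>e\<in>E. rho (J \<cdot> e) (tau z e)) = (\<Sum>e\<in>E. rho e (tau (J \<cdot> e) z))"
    using J_shift[OF b1] by (simp add: tau_anti[of z] sum_negf)
  finally have "(\<Sum>e\<in>E. rho e (tau (J \<cdot> e) z)) = 0" by (simp add: tau_trace)
  \<comment> \<open>Type (1,1) makes \<open>rho x (J y)\<close> symmetric in \<open>x\<close> and
    \<open>y\<close>, so it contracts to zero with the skew operator \<open>G z\<close>.\<close>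
  moreover have "(\<Sum>e\<in>E. rho e (G z \<cdot> (J \<cdot> e))) = 0"
  proof -
    have "(\<Sum>e\<in>E. (\<lambda>x y. rho x (J \<cdot> y)) e (G z \<cdot> e)) = 0"
      by (rule skew_sym_zero[OF b3 skew_G]) (metis rho_J1 rho_anti)
    then show ?thesis by (simp add: GJ_app)
  qed
  ultimately show ?thesis
    by (simp add: tau_def sum_subtractf)
qed

lemma rho_coclosed: "(\<Sum>e\<in>E. rho (G e \<cdot> z) e) = 0"
proof -
  have b4: "bilinear (\<lambda>x y. rho x (G y \<cdot> z))" for z by (rule bilinI) simp_all
  have "(\<Sum>e\<in>E. rho (J \<cdot> e) (G e \<cdot> z)) = 0" for z
    using J_shift[OF b4] rho_coclosed_J by simp
  then have "(\<Sum>e\<in>E. rho (J \<cdot> e) (G e \<cdot> (J \<cdot> z))) = 0" .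
  moreover have "rho (J \<cdot> e) (G e \<cdot> (J \<cdot> z)) = - rho (G e \<cdot> z) e" for e
    using rho_JJ[of e "G e \<cdot> z"] rho_anti[of e "G e \<cdot> z"] by (simp add: GJ_app)
  ultimately show ?thesis by (simp add: sum_negf)
qed

lemma rho_0: "rho x y = 0"
proof -
  have k: "kap x = (\<Sum>f\<in>E. ip x f * kap f)" for x
  proof -
    have "linear kap" by (simp add: linear_iff)
    from sum_E_expand[OF this, of x] show ?thesis by (simp add: kap_def)
  qed
  have l: "linear (rho z)" for z by (simp add: linear_iff)
  define v where "v = (\<Sum>f\<in>E. kap f *\<^sub>R f)"
  have kap_v: "kap x = ip x v" for x
    by (subst k) (simp add: v_def ip_sum mult.commute)
  \<comment> \<open>Moving the skew \<open>G e\<close> off \<open>f\<close> turns the inner sum into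
    \<open>rho e (G e v)\<close> up to sign, and coclosedness kills the outer sum.\<close>
  have "(\<Sum>e\<in>E. \<Sum>f\<in>E. rho e f * kap (G e \<cdot> f)) = 0"
  proof -
    have "(\<Sum>f\<in>E. rho e f * kap (G e \<cdot> f)) = - rho e (G e \<cdot> v)" for e
    proof -
      have "(\<Sum>f\<in>E. rho e f * kap (G e \<cdot> f)) = - (\<Sum>f\<in>E. ip (G e \<cdot> v) f *\<^sub>R rho e f)"
        by (simp add: kap_v ipG sum_negf[symmetric] ip_sym[of _ "G e \<cdot> v"] mult.commute)
      also have "\<dots> = - rho e (G e \<cdot> v)" by (subst sum_E_expand[OF l]) simp
      finally show ?thesis .
    qed
    then show ?thesis using rho_coclosed[of v] rho_anti[of _ "G _ \<cdot> v"] by (simp add: sum_negf)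
  qed
  moreover have "(\<Sum>e\<in>E. \<Sum>f\<in>E. rho e f * kap (G f \<cdot> e)) = - (\<Sum>e\<in>E. \<Sum>f\<in>E. rho e f * kap (G e \<cdot> f))"
    by (subst sum.swap, subst rho_anti) (simp add: sum_negf)
  \<comment> \<open>One factor is written as the differential of \<open>kap\<close>, so that the
    squared norm of \<open>rho\<close> becomes a pairing of \<open>kap\<close> with the
    codifferential of \<open>rho\<close>.\<close>
  moreover have "rho e f * rho e f = rho e f * kap (G f \<cdot> e) - rho e f * kap (G e \<cdot> f)" for e f
    by (subst (2) rho_kap) (simp add: tau_def algebra_simps)
  ultimately have "(\<Sum>e\<in>E. \<Sum>f\<in>E. rho e f * rho e f) = 0"
    by (simp add: sum_subtractf)
  then have "\<forall>e\<in>E. \<forall>f\<in>E. rho e f = 0"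
    by (simp add: sum_nonneg_eq_0_iff sum_nonneg)
  then have "rho e y = 0" if "e \<in> E" for e y
    using that sum_E_expand[OF l, of y e] by simp
  moreover have "linear (\<lambda>z. rho z y)" by (simp add: linear_iff)
  ultimately show ?thesis
    using sum_E_expand[of "\<lambda>z. rho z y" x] by simp
qed

lemma tr_JR: "tr (J * R x y) = - w x y * a"
  using rho_0[of x y] by (simp add: rho_def)

definition S :: "'a lin" where "S = (\<Sum>e\<in>E. R e (J \<cdot> e))"

text \<open>By pair symmetry the matrix of \<open>S\<close> consists of the traces of
  \<open>J * R x y\<close>, which the vanishing of \<open>rho\<close> makes multiples of
  \<open>w\<close>. This is the Einstein condition.\<close>

lemma S_eq: "S = a *\<^sub>R J"
proof (rule lin_eqI)
  fix x
  have "ip (S \<cdot> x) y = a * w x y" for y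
  proof -
    have "ip (S \<cdot> x) y = (\<Sum>e\<in>E. ip (R x y \<cdot> e) (J \<cdot> e))"
      by (simp add: S_def app_sum ip_sum R_pair[of _ _ x y])
    also have "\<dots> = - tr (J * R x y)"
      by (simp add: tr_def ipJ sum_negf)
    finally show ?thesis by (simp add: tr_JR)
  qed
  moreover have "im_in S" unfolding S_def by (rule im_in_sum) auto
  ultimately show "S \<cdot> x = (a *\<^sub>R J) \<cdot> x"
    by - (rule ip_eqI; simp add: im_inD w_def)
qed

section \<open>Second Bianchi identity and divergence of the curvature\<close>

lemma w_G: "w x (G y \<cdot> z) = w z (G y \<cdot> x)"
  using ipG[of y "J \<cdot> x" z] w_anti[of z "G y \<cdot> x"] by (simp add: w_def GJ_app)

lemma w_tau: "w x (tau y z) + w y (tau z x) + w z (tau x y) = 0"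
  using w_G[of x y z] w_G[of y z x] w_G[of z x y] by (simp add: tau_def)

text \<open>The left side is one of the three cyclic terms in the exterior covariant derivative of
  \<open>R\<close>. Through \<open>GD\<close> the commutator of \<open>G x\<close> with
  \<open>D\<close> becomes a value of \<open>G\<close>, so each kind of term can be summed
  cyclically by itself.\<close>

lemma G_comm_R: "G x * R y z - R y z * G x + R x (tau y z)
  = (G x * (G y * G z - G z * G y) - (G y * G z - G z * G y) * G x)
    - G (tau x (tau y z) - w y z *\<^sub>R D \<cdot> x) - w x (tau y z) *\<^sub>R D"
  by (simp add: R_def algebra_simps flip: GD)

text \<open>In the cyclic sum the nested commutators cancel by the Jacobi identity for operators,
  the values of \<open>G\<close> by \<open>tau_jacobi\<close>, and the multiples of \<open>D\<close>
  because \<open>w\<close> is closed.\<close>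

lemma second_bianchi:
  "(G x * R y z - R y z * G x + R x (tau y z)) + (G y * R z x - R z x * G y + R y (tau z x))
    + (G z * R x y - R x y * G z + R z (tau x y)) = 0"
proof -
  have "(G x * R y z - R y z * G x + R x (tau y z)) + (G y * R z x - R z x * G y + R y (tau z x))
      + (G z * R x y - R x y * G z + R z (tau x y))
    = - G (tau x (tau y z) + tau y (tau z x) + tau z (tau x y)
          - (w y z *\<^sub>R D \<cdot> x + w z x *\<^sub>R D \<cdot> y + w x y *\<^sub>R D \<cdot> z))
      - (w x (tau y z) + w y (tau z x) + w z (tau x y)) *\<^sub>R D"
    unfolding G_comm_R by (simp add: algebra_simps)
  then show ?thesis by (simp add: tau_jacobi w_tau)
qed

text \<open>Two arguments are contracted with \<open>J\<close>. The Einstein condition enters here: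
  \<open>S\<close> is a multiple of \<open>J\<close> and commutes with \<open>G z\<close>. Of the
  other terms one vanishes by unimodularity and the rest agree in pairs.\<close>

lemma second_bianchi_trace_J:
  "(\<Sum>e\<in>E. G e * R (J \<cdot> e) z - R (J \<cdot> e) z * G e) + (\<Sum>e\<in>E. R e (G (J \<cdot> e) \<cdot> z)) = 0"
proof -
  have b1: "bilinear (\<lambda>x y. G x * R z y - R z y * G x)" by (rule bilinI) (simp_all add: algebra_simps)
  have b2: "bilinear (\<lambda>x y. R x (tau y z))" by (rule bilinI) simp_all
  have b3: "bilinear (\<lambda>x y. R x (J \<cdot> y))" by (rule bilinI) simp_all
  let ?A = "\<Sum>e\<in>E. G e * R (J \<cdot> e) z - R (J \<cdot> e) z * G e"
  let ?B = "\<Sum>e\<in>E. R e (tau (J \<cdot> e) z)"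
  have "(\<Sum>e\<in>E. (G e * R (J \<cdot> e) z - R (J \<cdot> e) z * G e + R e (tau (J \<cdot> e) z))
      + (G (J \<cdot> e) * R z e - R z e * G (J \<cdot> e) + R (J \<cdot> e) (tau z e))
      + (G z * R e (J \<cdot> e) - R e (J \<cdot> e) * G z + R z (tau e (J \<cdot> e)))) = 0"
    by (simp only: second_bianchi sum.neutral_const)
  note this[unfolded sum.distrib]
  moreover have "(\<Sum>e\<in>E. G (J \<cdot> e) * R z e - R z e * G (J \<cdot> e)) = ?A"
    unfolding J_shift[OF b1] by (simp add: sum_negf[symmetric] R_anti[of z])
  moreover have "(\<Sum>e\<in>E. R (J \<cdot> e) (tau z e)) = ?B"
    using J_shift[OF b2] by (simp add: tau_anti[of z] sum_negf)
  moreover have "(\<Sum>e\<in>E. G z * R e (J \<cdot> e) - R e (J \<cdot> e) * G z) = 0"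
  proof -
    have "(\<Sum>e\<in>E. G z * R e (J \<cdot> e) - R e (J \<cdot> e) * G z) = G z * S - S * G z"
      by (simp add: S_def sum_subtractf sum_distrib_left sum_distrib_right)
    then show ?thesis by (simp add: S_eq GJ)
  qed
  moreover have "(\<Sum>e\<in>E. R z (tau e (J \<cdot> e))) = 0"
  proof -
    have "linear (R z)" by (simp add: linear_iff)
    from linear_sum[OF this, of "\<lambda>e. tau e (J \<cdot> e)" E] show ?thesis by (simp add: tau_trace)
  qed
  ultimately have "2 *\<^sub>R (?A + ?B) = 0"
    by (simp only: scaleR_2 add_0_right)
  then have "?A + ?B = 0" by simp
  moreover have "(\<Sum>e\<in>E. R e (G z \<cdot> (J \<cdot> e))) = 0"
  proof -
    have "(\<Sum>e\<in>E. (\<lambda>x y. R x (J \<cdot> y)) e (G z \<cdot> e)) = 0"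
      by (rule skew_sym_zero[OF b3 skew_G]) (metis R_J1 R_anti)
    then show ?thesis by (simp add: GJ_app)
  qed
  ultimately show ?thesis by (simp add: tau_def sum_subtractf)
qed

text \<open>The curvature is divergence-free, as for an Einstein metric. Type (1,1) carries
  \<open>J\<close> from the contraction over to \<open>z\<close>, where the substitution of
  \<open>- (J z)\<close> absorbs it.\<close>

lemma second_bianchi_trace:
  "(\<Sum>e\<in>E. G e * R e z - R e z * G e) = (\<Sum>e\<in>E. R e (G e \<cdot> z))"
proof -
  have b: "bilinear (\<lambda>x y. R x (G y \<cdot> z))" for z by (rule bilinI) simp_all
  have "(\<Sum>e\<in>E. R e (G (J \<cdot> e) \<cdot> z)) = (\<Sum>e\<in>E. R e (G e \<cdot> (J \<cdot> z)))" for z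
    using J_shift[OF b, of z] by (simp add: GJ_app R_J1 sum_negf)
  then have "- (\<Sum>e\<in>E. G e * R e (J \<cdot> z) - R e (J \<cdot> z) * G e) + (\<Sum>e\<in>E. R e (G e \<cdot> (J \<cdot> z))) = 0" for z
    using second_bianchi_trace_J[of z] by (simp add: R_J1 sum_negf[symmetric])
  from this[of "- (J \<cdot> z)"] show ?thesis by simp
qed

section \<open>Contracted Chern-Simons identity\<close>

definition C :: "'a \<Rightarrow> 'a \<Rightarrow> 'a lin" where "C x y = G x * G y - G y * G x"

lemma C_simps [simp]: "C (x + y) z = C x z + C y z" "C z (x + y) = C z x + C z y"
  "C (c *\<^sub>R x) z = c *\<^sub>R C x z" "C z (c *\<^sub>R x) = c *\<^sub>R C z x"
  "C (- x) z = - C x z" "C z (- x) = - C z x" "C (P \<cdot> x) y = C x y" "C x (P \<cdot> y) = C x y"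
  by (simp_all add: C_def algebra_simps)

lemma C_anti: "C x y = - C y x"
  by (simp add: C_def)

lemma im_in_ops [simp, intro]: "im_in (G x)" "im_in (C x y)" "im_in (R x y)" "im_in D" "im_in J"
  by (auto simp: C_def skew_G skew_D skew_J)

lemma R_eq_C: "R x y = C x y - G (tau x y) - w x y *\<^sub>R D"
  by (simp add: R_def C_def)

lemma w_expand:
  assumes "linear \<phi>"
  shows "(\<Sum>f\<in>E. w e f *\<^sub>R \<phi> f) = \<phi> (J \<cdot> e)"
  using sum_E_expand[OF assms, of "J \<cdot> e"] by (simp add: w_def)

definition T :: real where "T = (\<Sum>e\<in>E. \<Sum>f\<in>E. tr (C e f * R e f))"

text \<open>The pairing of \<open>G f\<close> with the commutator of \<open>G e\<close> and
  \<open>R e f\<close> is computed twice: cyclicity of the trace produces \<open>C e f\<close>,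
  whereas the divergence identity followed by a shift of the skew \<open>G e\<close> produces
  \<open>G (G e f)\<close>.\<close>

lemma T_alt: "(\<Sum>e\<in>E. \<Sum>f\<in>E. tr (G (G e \<cdot> f) * R e f)) = T"
proof -
  have "(\<Sum>e\<in>E. \<Sum>f\<in>E. tr (G f * (G e * R e f - R e f * G e)))
      = (\<Sum>f\<in>E. tr (G f * (\<Sum>e\<in>E. G e * R e f - R e f * G e)))"
    by (subst sum.swap) (simp add: sum_distrib_left tr_sum)
  also have "\<dots> = (\<Sum>e\<in>E. \<Sum>f\<in>E. tr (G f * R e (G e \<cdot> f)))"
    unfolding second_bianchi_trace by (simp add: sum_distrib_left tr_sum) (rule sum.swap)
  also have "\<dots> = - (\<Sum>e\<in>E. \<Sum>f\<in>E. tr (G (G e \<cdot> f) * R e f))"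
  proof -
    have "bilinear (\<lambda>x y. tr (G x * R e y))" for e by (rule bilinI) (simp_all add: algebra_simps)
    from skew_shift[OF this skew_G] show ?thesis by (simp add: sum_negf)
  qed
  finally have *: "(\<Sum>e\<in>E. \<Sum>f\<in>E. tr (G (G e \<cdot> f) * R e f))
      = - (\<Sum>e\<in>E. \<Sum>f\<in>E. tr (G f * (G e * R e f - R e f * G e)))" by simp
  have "tr (G f * (G e * R e f - R e f * G e)) = - tr (C e f * R e f)" for e f
  proof -
    have "tr (G f * R e f * G e) = tr (G e * (G f * R e f))" by (rule tr_commute) auto
    then show ?thesis by (simp add: C_def algebra_simps)
  qed
  then show ?thesis unfolding * by (simp add: sum_negf T_def)
qed

text \<open>Only one factor is expanded. Its commutator part contributes \<open>T\<close>, its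
  bracket part twice \<open>- T\<close>, and its \<open>D\<close> part contracts the other factor to
  \<open>S\<close>.\<close>

lemma sum_tr_RR: "(\<Sum>e\<in>E. \<Sum>f\<in>E. tr (R e f * R e f)) = - T - tr (D * S)"
proof -
  have 1: "(\<Sum>e\<in>E. \<Sum>f\<in>E. tr (G (G f \<cdot> e) * R e f)) = - T"
    by (subst sum.swap, subst R_anti) (simp add: sum_negf T_alt)
  have 2: "(\<Sum>f\<in>E. w e f * tr (D * R e f)) = tr (D * R e (J \<cdot> e))" for e
  proof -
    have "linear (\<lambda>f. tr (D * R e f))" by (simp add: linear_iff algebra_simps)
    from w_expand[OF this, of e] show ?thesis by simp
  qed
  have "tr (R e f * R e f) = tr (C e f * R e f) - tr (G (G e \<cdot> f) * R e f) + tr (G (G f \<cdot> e) * R e f)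
      - w e f * tr (D * R e f)" for e f
    by (subst (1) R_eq_C) (simp add: tau_def algebra_simps)
  then show ?thesis
    by (simp add: sum.distrib sum_subtractf 1 2 T_alt S_def sum_distrib_left tr_sum flip: T_def)
qed

definition N :: "'a lin" where "N = (\<Sum>e\<in>E. C e (J \<cdot> e))"

text \<open>The bracket part of \<open>C\<close> contracts to zero by unimodularity, and the
  contraction of \<open>w\<close> counts the dimension.\<close>

lemma N_eq: "N = S + real (card E) *\<^sub>R D"
proof -
  have "(\<Sum>e\<in>E. G (tau e (J \<cdot> e))) = 0"
    using linear_sum[OF G_linear, of "\<lambda>e. tau e (J \<cdot> e)" E] by (simp add: tau_trace)
  moreover have "C x y = R x y + G (tau x y) + w x y *\<^sub>R D" for x y
    by (simp add: R_eq_C)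
  ultimately show ?thesis
    by (simp add: N_def S_def sum.distrib w_trace flip: scaleR_left.sum)
qed

text \<open>Invariance of the trace form. A product of two commutators takes nested shape, to which
  the Jacobi identity applies.\<close>

lemma tr_commutators:
  assumes "im_in X" "im_in Y" "im_in Z" "im_in W"
  shows "tr ((X * Y - Y * X) * (Z * W - W * Z)) = tr (((X * Y - Y * X) * Z - Z * (X * Y - Y * X)) * W)"
proof -
  have "tr ((X * Y - Y * X) * W * Z) = tr (Z * ((X * Y - Y * X) * W))"
    by (rule tr_commute) (use assms in auto)
  then show ?thesis by (simp add: algebra_simps)
qed

lemma tr_CC_jacobi: "tr (C x y * C z t) + tr (C y z * C x t) + tr (C z x * C y t) = 0"
  unfolding C_def by (simp only: tr_commutators im_in_ops) (simp add: algebra_simps)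

text \<open>The quartic term of the Chern--Simons identity, evaluated by the Jacobi identity.\<close>

lemma sum_tr_CC: "2 * (\<Sum>e\<in>E. \<Sum>f\<in>E. tr (C e f * C (J \<cdot> e) (J \<cdot> f))) = tr (N * N)"
proof -
  have 1: "(\<Sum>e\<in>E. \<Sum>f\<in>E. tr (C f (J \<cdot> e) * C e (J \<cdot> f)))
      = (\<Sum>e\<in>E. \<Sum>f\<in>E. tr (C e f * C (J \<cdot> e) (J \<cdot> f)))"
  proof (rule sum.cong[OF refl])
    fix e
    have "bilinear (\<lambda>x y. tr (C x (J \<cdot> e) * C e y))" by (rule bilinI) (simp_all add: algebra_simps)
    from J_shift[OF this]
    have "(\<Sum>f\<in>E. tr (C f (J \<cdot> e) * C e (J \<cdot> f))) = (\<Sum>f\<in>E. tr (C (J \<cdot> e) (J \<cdot> f) * C e f))"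
      by (simp add: C_anti[of "J \<cdot> e" "J \<cdot> _"] sum_negf)
    also have "\<dots> = (\<Sum>f\<in>E. tr (C e f * C (J \<cdot> e) (J \<cdot> f)))"
      by (intro sum.cong refl tr_commute) auto
    finally show "(\<Sum>f\<in>E. tr (C f (J \<cdot> e) * C e (J \<cdot> f))) = (\<Sum>f\<in>E. tr (C e f * C (J \<cdot> e) (J \<cdot> f)))" .
  qed
  have 2: "(\<Sum>e\<in>E. \<Sum>f\<in>E. tr (C (J \<cdot> e) e * C f (J \<cdot> f))) = - tr (N * N)"
    by (subst C_anti) (simp add: N_def sum_product tr_sum sum_negf)
  have "(\<Sum>e\<in>E. \<Sum>f\<in>E. tr (C e f * C (J \<cdot> e) (J \<cdot> f)) + tr (C f (J \<cdot> e) * C e (J \<cdot> f))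
      + tr (C (J \<cdot> e) e * C f (J \<cdot> f))) = 0"
    by (simp only: tr_CC_jacobi sum.neutral_const)
  then show ?thesis by (simp add: sum.distrib 1 2)
qed

text \<open>A skew \<open>K\<close> commuting with \<open>J\<close> makes \<open>J K\<close>
  symmetric, whereas \<open>C\<close> is alternating.\<close>

lemma sum_C_skew:
  assumes K: "skew K" and KJ: "\<And>x. K \<cdot> (J \<cdot> x) = J \<cdot> (K \<cdot> x)"
  shows "(\<Sum>f\<in>E. C f (J \<cdot> (K \<cdot> f))) = 0"
proof -
  have b1: "bilinear (\<lambda>x y. C x (J \<cdot> y))" by (rule bilinI) simp_all
  have b2: "bilinear (\<lambda>x y. C (K \<cdot> x) y)" by (rule bilinI) simp_all
  have "(\<Sum>f\<in>E. C f (J \<cdot> (K \<cdot> f))) = - (\<Sum>f\<in>E. C (K \<cdot> f) (J \<cdot> f))"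
    using skew_shift[OF b1 K] by simp
  also have "\<dots> = (\<Sum>f\<in>E. C (K \<cdot> (J \<cdot> f)) f)"
    using J_shift[OF b2] by simp
  also have "\<dots> = - (\<Sum>f\<in>E. C f (J \<cdot> (K \<cdot> f)))"
    by (simp add: KJ C_anti[of "J \<cdot> _"] sum_negf)
  finally have "2 *\<^sub>R (\<Sum>f\<in>E. C f (J \<cdot> (K \<cdot> f))) = 0"
    by (metis add.right_inverse scaleR_2)
  then show ?thesis by simp
qed

text \<open>\<open>R e f\<close> is replaced by \<open>R (J e) (J f)\<close> before it is expanded.
  The bracket terms then vanish instead of reproducing \<open>T\<close>, and the quartic term is the
  one that the Jacobi identity evaluates.\<close>

lemma T_eq: "T = tr (N * N) / 2 - tr (N * D)"
proof -
  have 1: "(\<Sum>e\<in>E. \<Sum>f\<in>E. tr (C e f * G (G (J \<cdot> e) \<cdot> (J \<cdot> f)))) = 0"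
  proof (rule sum.neutral, rule ballI)
    fix e
    \<comment> \<open>Cyclicity isolates \<open>G e\<close>; what remains is summed over
      \<open>f\<close> and is the vanishing contraction of \<open>C\<close> with the skew operator
      \<open>G (J e)\<close>.\<close>
    have "tr (C e f * G (G (J \<cdot> e) \<cdot> (J \<cdot> f))) = tr (G e * C f (J \<cdot> (G (J \<cdot> e) \<cdot> f)))" for f
    proof -
      let ?X = "G (J \<cdot> (G (J \<cdot> e) \<cdot> f))"
      have "tr (G f * G e * ?X) = tr (G e * ?X * G f)"
        using tr_commute[of "G f" "G e * ?X"] by (simp add: mult.assoc)
      then show ?thesis by (simp add: C_def GJ_app algebra_simps)
    qed
    then have "(\<Sum>f\<in>E. tr (C e f * G (G (J \<cdot> e) \<cdot> (J \<cdot> f))))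
        = tr (G e * (\<Sum>f\<in>E. C f (J \<cdot> (G (J \<cdot> e) \<cdot> f))))"
      by (simp add: sum_distrib_left tr_sum)
    then show "(\<Sum>f\<in>E. tr (C e f * G (G (J \<cdot> e) \<cdot> (J \<cdot> f)))) = 0"
      by (simp add: sum_C_skew skew_G GJ_app)
  qed
  have 2: "(\<Sum>e\<in>E. \<Sum>f\<in>E. tr (C e f * G (G (J \<cdot> f) \<cdot> (J \<cdot> e)))) = 0"
    using 1 by (subst sum.swap, subst C_anti) (simp add: sum_negf)
  have 3: "(\<Sum>f\<in>E. w e f * tr (C e f * D)) = tr (C e (J \<cdot> e) * D)" for e
  proof -
    have "linear (\<lambda>f. tr (C e f * D))" by (simp add: linear_iff algebra_simps)
    from w_expand[OF this, of e] show ?thesis by simp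
  qed
  have "tr (C e f * R e f) = tr (C e f * C (J \<cdot> e) (J \<cdot> f)) - tr (C e f * G (G (J \<cdot> e) \<cdot> (J \<cdot> f)))
      + tr (C e f * G (G (J \<cdot> f) \<cdot> (J \<cdot> e))) - w e f * tr (C e f * D)" for e f
    unfolding R_JJ[of e f, symmetric] R_eq_C[of "J \<cdot> e"] tau_def by (simp add: w_J algebra_simps)
  moreover have "(\<Sum>e\<in>E. tr (C e (J \<cdot> e) * D)) = tr (N * D)"
    by (simp add: N_def sum_distrib_right tr_sum)
  ultimately show ?thesis
    using sum_tr_CC by (simp add: T_def sum.distrib sum_subtractf 1 2 3)
qed

section \<open>Trace-free parts and the sign argument\<close>

lemma w_sq: "(\<Sum>e\<in>E. \<Sum>f\<in>E. w e f * w e f) = card E"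
proof -
  have "(\<Sum>f\<in>E. w e f * w e f) = (if e \<in> E then 1 else 0)" if "e \<in> E" for e
    using parseval[of "J \<cdot> e" "J \<cdot> e"] that by (simp add: w_def ipJJ ip_E)
  then show ?thesis by simp
qed

lemma tr_JJ: "tr (J * J) = - real (card E)"
  by (simp add: JJ tr_def P_E ip_E)

text \<open>As \<open>tr (J * J)\<close> is minus the dimension, this is the coefficient that makes
  \<open>D - mu J\<close> orthogonal to \<open>J\<close> in the trace form.\<close>

definition mu :: real where "mu = - a / card E"

text \<open>With \<open>S = a J\<close> and a = - mu n the contraction \<open>N\<close> collapses to
  \<open>n D0\<close>, so \<open>T\<close> becomes a multiple of \<open>tr (D0 * D0)\<close>. The
  remaining terms in mu disappear on completing the square.\<close>

lemma sum_tr_R0: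
  assumes "E \<noteq> {}"
  defines "D0 \<equiv> D - mu *\<^sub>R J"
  shows "(\<Sum>e\<in>E. \<Sum>f\<in>E. tr ((R e f + (mu * w e f) *\<^sub>R J) * (R e f + (mu * w e f) *\<^sub>R J)))
    = (real (card E) - (real (card E))\<^sup>2 / 2) * tr (D0 * D0)" (is "?lhs = _")
proof -
  define n where "n = real (card E)"
  have n: "n \<noteq> 0" using assms by (simp add: n_def)
  have a: "a = - mu * n" using n by (simp add: mu_def n_def)
  have D: "D = D0 + mu *\<^sub>R J" by (simp add: D0_def)
  have N: "N = n *\<^sub>R D0"
    unfolding N_eq S_eq n_def[symmetric] a by (simp add: D0_def scaleR_diff_right mult.commute)
  have JD0: "tr (J * D0) = 0"
    using a unfolding a_def D0_def by (simp add: right_diff_distrib tr_JJ n_def)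
  have D0J: "tr (D0 * J) = 0"
    using JD0 tr_commute[of D0 J] by (simp add: D0_def)
  have DJt: "tr (D * J) = a" using tr_commute[of D J] by (simp add: a_def)
  have Q: "(\<Sum>e\<in>E. \<Sum>f\<in>E. tr (R e f * R e f)) = (n - n\<^sup>2 / 2) * tr (D0 * D0) - mu\<^sup>2 * n\<^sup>2"
  proof -
    have "tr (N * N) = n\<^sup>2 * tr (D0 * D0)" by (simp add: N power2_eq_square)
    moreover have "tr (N * D) = n * tr (D0 * D0)" unfolding N by (subst D) (simp add: distrib_left D0J)
    moreover have "tr (D * S) = mu\<^sup>2 * n\<^sup>2" unfolding S_eq by (simp add: DJt) (simp add: a power2_eq_square)
    ultimately show ?thesis by (simp add: sum_tr_RR T_eq algebra_simps)
  qed
  \<comment> \<open>Coefficient produced by completing the square. It equals mu^2 n, so after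
    multiplication by the norm n of \<open>w\<close> it cancels the last term of
    \<open>Q\<close>.\<close>
  define K where "K = - 2 * mu * a - mu\<^sup>2 * n"
  have "tr ((R e f + (mu * w e f) *\<^sub>R J) * (R e f + (mu * w e f) *\<^sub>R J))
      = tr (R e f * R e f) + K * (w e f * w e f)" for e f
  proof -
    have RJt: "tr (R e f * J) = - w e f * a" using tr_JR[of e f] tr_commute[of "R e f" J] by simp
    have "tr ((R e f + c *\<^sub>R J) * (R e f + c *\<^sub>R J))
        = tr (R e f * R e f) + c * tr (R e f * J) + c * tr (J * R e f) + c * c * tr (J * J)" for c
      by (simp add: distrib_left distrib_right)
    then show ?thesis
      by (simp only: RJt tr_JR tr_JJ n_def[symmetric] K_def) (simp add: algebra_simps power2_eq_square)
  qed
  then have "?lhs = (\<Sum>e\<in>E. \<Sum>f\<in>E. tr (R e f * R e f)) + K * (\<Sum>e\<in>E. \<Sum>f\<in>E. w e f * w e f)"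
    by (simp only: sum.distrib sum_distrib_left)
  also have "\<dots> = (n - n\<^sup>2 / 2) * tr (D0 * D0)"
    unfolding Q w_sq K_def a n_def[symmetric] by (simp add: power2_eq_square algebra_simps)
  finally show ?thesis by (simp add: n_def)
qed

text \<open>For n = 2 the coefficient in the trace identity is zero, so \<open>D\<close> has to be
  read off from the line of skew operators.\<close>

lemma D_eq_2:
  assumes "card E = 2"
  shows "D = mu *\<^sub>R J"
proof -
  obtain c where c: "D = c *\<^sub>R J" using skew_dim_2[OF assms skew_D] by blast
  have "mu = c" unfolding mu_def a_def by (simp add: c tr_JJ assms)
  then show ?thesis by (simp add: c)
qed

text \<open>Traces of squares of skew operators are nonpositive, and so is the coefficient of
  \<open>tr (D0 * D0)\<close> for n at least 2. The two sides of the trace identity have opposite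
  signs, so each term vanishes.\<close>

lemma rigidity:
  assumes "card E \<ge> 2"
  shows "R x y = - (mu * w x y) *\<^sub>R J" and "D = mu *\<^sub>R J"
proof -
  define n where "n = real (card E)"
  define D0 where "D0 = D - mu *\<^sub>R J"
  define R0 where "R0 x y = R x y + (mu * w x y) *\<^sub>R J" for x y
  have n: "n \<ge> 2" and E: "E \<noteq> {}" using assms by (auto simp: n_def)
  have sk: "skew D0" "skew (R0 x y)" for x y
    by (simp_all add: D0_def R0_def skew_D skew_J)
  have main: "(\<Sum>e\<in>E. \<Sum>f\<in>E. tr (R0 e f * R0 e f)) = (n - n\<^sup>2 / 2) * tr (D0 * D0)"
    using sum_tr_R0[OF E] by (simp add: R0_def D0_def n_def)
  have c: "n - n\<^sup>2 / 2 \<le> 0"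
    using mult_right_mono[OF n, of n] n by (simp add: power2_eq_square)
  then have pos: "(n - n\<^sup>2 / 2) * tr (D0 * D0) \<ge> 0"
    using tr_skew_sq_nonpos[OF sk(1)] by (simp add: mult_nonpos_nonpos)
  have np: "(\<Sum>f\<in>E. - tr (R0 e f * R0 e f)) \<ge> 0" for e
    using tr_skew_sq_nonpos[OF sk(2)] by (intro sum_nonneg) simp
  then have "(\<Sum>e\<in>E. \<Sum>f\<in>E. - tr (R0 e f * R0 e f)) \<ge> 0"
    by (rule sum_nonneg)
  then have z: "(\<Sum>e\<in>E. \<Sum>f\<in>E. - tr (R0 e f * R0 e f)) = 0" and z': "(n - n\<^sup>2 / 2) * tr (D0 * D0) = 0"
    using main pos by (auto simp: sum_negf)
  have *: "R0 e f = 0" if ef: "e \<in> E" "f \<in> E" for e f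
  proof -
    have z0: "(\<Sum>f\<in>E. - tr (R0 e f * R0 e f)) = 0"
      by (rule sum_nonneg_0[OF finE _ z ef(1)]) (rule np)
    have "- tr (R0 e f * R0 e f) = 0"
      by (rule sum_nonneg_0[OF finE _ z0 ef(2)]) (use tr_skew_sq_nonpos[OF sk(2)] in simp)
    then show ?thesis using tr_skew_sq_0[OF sk(2)] by simp
  qed
  have "R0 e y = 0" if "e \<in> E" for e y
  proof -
    have "linear (R0 e)" by (simp add: linear_iff R0_def algebra_simps)
    from sum_E_expand[OF this, of y] show ?thesis using * that by (simp add: R0_def)
  qed
  moreover have "linear (\<lambda>x. R0 x y)" by (simp add: linear_iff R0_def algebra_simps)
  ultimately have "R0 x y = 0"
    using sum_E_expand[of "\<lambda>x. R0 x y" x] by (simp add: R0_def)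
  then show "R x y = - (mu * w x y) *\<^sub>R J" by (simp add: R0_def eq_neg_iff_add_eq_0)
  show "D = mu *\<^sub>R J"
  proof (cases "card E = 2")
    case False
    then have "n > 2" using n by (simp add: n_def)
    then have "n * (2 - n) \<noteq> 0" by simp
    then have "n - n\<^sup>2 / 2 \<noteq> 0" by (simp add: power2_eq_square field_simps)
    with z' have "D0 = 0" using tr_skew_sq_0[OF sk(1)] by simp
    then show ?thesis by (simp add: D0_def)
  qed (rule D_eq_2)
qed

text \<open>The Bianchi identity for \<open>R = - mu w J\<close> on e, J e, z, paired with J z, says
  that mu times the squared norm of the part of z orthogonal to e and J e is zero. Summation over z
  leaves the factor n - 2.\<close>

lemma mu_0_or_2:
  assumes "card E \<ge> 2"
  shows "mu = 0 \<or> card E = 2"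
proof (rule disjCI)
  assume "card E \<noteq> 2"
  have "E \<noteq> {}" using assms by auto
  then obtain e where e: "e \<in> E" by blast
  have one: "w e (J \<cdot> e) = 1" using e by (simp add: w_def ipJJ ip_E)
  have *: "mu * (ip z z - ip e z * ip e z - ip (J \<cdot> e) z * ip (J \<cdot> e) z) = 0" for z
  proof -
    have "ip (R e (J \<cdot> e) \<cdot> z + R (J \<cdot> e) z \<cdot> e + R z e \<cdot> (J \<cdot> e)) (J \<cdot> z) = 0"
      by (simp add: bianchi)
    then have "mu * ip e z * ip e z - mu * ip z z + mu * ip (J \<cdot> z) e * ip e (J \<cdot> z) = 0"
      using one unfolding rigidity(1)[OF assms] by (simp add: w_def ipJJ)
    moreover have "ip (J \<cdot> z) e = - ip (J \<cdot> e) z" "ip e (J \<cdot> z) = - ip (J \<cdot> e) z"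
      using ipJ[of z e] ipJ[of e z] by (simp_all add: ip_sym[of e] ip_sym[of z])
    ultimately show ?thesis by (simp add: algebra_simps)
  qed
  have "(\<Sum>z\<in>E. ip z z) = card E"
    by (simp add: ip_E)
  moreover have "(\<Sum>z\<in>E. ip e z * ip e z) = 1" "(\<Sum>z\<in>E. ip (J \<cdot> e) z * ip (J \<cdot> e) z) = 1"
    unfolding parseval[symmetric] using e by (simp_all add: ipJJ ip_E)
  moreover have "mu * (\<Sum>z\<in>E. ip z z - ip e z * ip e z - ip (J \<cdot> e) z * ip (J \<cdot> e) z) = 0"
    unfolding sum_distrib_left by (simp only: * sum.neutral_const)
  ultimately have "mu * (real (card E) - 1 - 1) = 0"
    by (simp add: sum_subtractf)
  then show "mu = 0" using \<open>card E \<noteq> 2\<close> by auto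
qed

end

section \<open>Flat left-invariant metrics\<close>

locale flat_frame = frame ip E for ip :: "'a::real_vector \<Rightarrow> 'a \<Rightarrow> real" and E +
  fixes G :: "'a \<Rightarrow> 'a lin"
  assumes skew_G: "skew (G x)"
    and G_add [simp]: "G (x + y) = G x + G y" and G_scale [simp]: "G (c *\<^sub>R x) = c *\<^sub>R G x"
    and G_P [simp]: "G (P \<cdot> x) = G x"
    and flat: "G x * G y - G y * G x = G (G x \<cdot> y - G y \<cdot> x)"
begin

lemma G_linear: "linear G"
  by (simp add: linear_iff)

lemma G_simps [simp]: "G (x - y) = G x - G y" "G (- x) = - G x" "G 0 = 0"
  using G_linear by (simp_all add: linear_diff linear_neg linear_0)

text \<open>On the orthogonal complement \<open>B\<close> of the kernel \<open>U\<close> of \<open>G\<close>, the form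
  \<open>\<beta> x y = - tr (G x * G y)\<close> is an invariant scalar product. For the vector \<open>v = (\<Sum>f. G f \<cdot> f)\<close> over a
  \<open>\<beta>\<close>-orthonormal basis, \<open>G x \<cdot> v\<close> is the Casimir operator applied to \<open>x\<close>, while invariance also
  gives \<open>v = 0\<close>; hence \<open>G\<close> annihilates \<open>B\<close>.\<close>

lemma flat_image_zero: "G (G y \<cdot> z) = 0"
proof -
  define U where "U = {x. P \<cdot> x = x \<and> G x = 0}"
  define B where "B = {x. P \<cdot> x = x \<and> (\<forall>u\<in>U. ip x u = 0)}"
  define \<beta> where "\<beta> x y = - tr (G x * G y)" for x y
  have spanE: "P \<cdot> x = x \<Longrightarrow> x \<in> span E" for x
    using P_app[of x] by (metis (no_types, lifting) span_base span_scale span_sum)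
  have ippos: "ip x x > 0" if "P \<cdot> x = x" "x \<noteq> 0" for x
    using ip_self_nonneg[of x] ip_self_0[of x] that by (metis order_le_less)
  have subU: "subspace U" and subB: "subspace B"
    by (auto simp: subspace_def U_def B_def)
  have UE: "U \<subseteq> span E" and BE: "B \<subseteq> span E" by (auto simp: U_def B_def spanE)
  obtain K where K: "finite K" "K \<subseteq> U" "\<And>f g. f \<in> K \<Longrightarrow> g \<in> K \<Longrightarrow> ip f g = (if f = g then 1 else 0)"
    "\<And>x. x \<in> U \<Longrightarrow> (\<Sum>f\<in>K. ip x f *\<^sub>R f) = x"
    using gram_schmidt[OF finE subU UE ip_bil ip_sym] ippos unfolding U_def by auto
  have dec: "\<exists>u b. u \<in> U \<and> b \<in> B \<and> x = u + b" if x: "P \<cdot> x = x" for x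
  proof -
    define u where "u = (\<Sum>f\<in>K. ip x f *\<^sub>R f)"
    have u: "u \<in> U" unfolding u_def using K(2) subU by (intro subspace_sum subspace_scale) auto
    have uf: "ip u f = ip x f" if "f \<in> K" for f
    proof -
      have "ip u f = (\<Sum>g\<in>K. if g = f then ip x g else 0)"
        unfolding u_def ip_sum by (rule sum.cong) (use that K(3) in auto)
      then show ?thesis using that K(1) by simp
    qed
    have "ip (x - u) v = 0" if "v \<in> U" for v
    proof -
      have "ip (x - u) v = ip (x - u) (\<Sum>f\<in>K. ip v f *\<^sub>R f)" using K(4)[OF that] by simp
      also have "\<dots> = 0" using uf by (simp add: ip_sum)
      finally show ?thesis .
    qed
    then have "x - u \<in> B" using x u by (simp add: B_def U_def)
    then show ?thesis using u by (intro exI[of _ u] exI[of _ "x - u"]) simp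
  qed
  \<comment> \<open>Flatness with \<open>G u = 0\<close> reads \<open>G (G y u) = 0\<close>. The
    kernel is thus invariant, and by skewness so is its complement.\<close>
  have GU: "G y \<cdot> u \<in> U" if "u \<in> U" for y u
    using flat[of y u] that by (simp add: U_def skew_P skew_G)
  have GB: "G y \<cdot> b \<in> B" if "b \<in> B" for y b
    using GU[of _ y] that by (simp add: B_def skew_P skew_G skewD)
  have bil: "bilinear \<beta>" unfolding \<beta>_def by (rule bilinI) (simp_all add: algebra_simps)
  have imG: "im_in (G x)" for x using skew_G by blast
  have \<beta>sym: "\<beta> x y = \<beta> y x" for x y
    unfolding \<beta>_def using tr_commute[OF imG imG] by simp
  have \<beta>pos: "\<beta> x x > 0" if "x \<in> B" "x \<noteq> 0" for x
  proof -
    have "\<beta> x x \<ge> 0" unfolding \<beta>_def using tr_skew_sq_nonpos[OF skew_G] by simp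
    moreover have "\<beta> x x \<noteq> 0"
    proof
      assume "\<beta> x x = 0"
      then have "G x = 0" using tr_skew_sq_0[OF skew_G] by (simp add: \<beta>_def)
      then have "x \<in> U" using that by (simp add: U_def B_def)
      then show False using that ippos[of x] by (simp add: B_def)
    qed
    ultimately show ?thesis by simp
  qed
  obtain F where F: "finite F" "F \<subseteq> B" "\<And>f g. f \<in> F \<Longrightarrow> g \<in> F \<Longrightarrow> \<beta> f g = (if f = g then 1 else 0)"
    "\<And>x. x \<in> B \<Longrightarrow> (\<Sum>f\<in>F. \<beta> x f *\<^sub>R f) = x"
    using gram_schmidt[OF finE subB BE bil \<beta>sym \<beta>pos] by blast
  define \<tau> where "\<tau> x y = G x \<cdot> y - G y \<cdot> x" for x y
  have \<tau>B: "\<tau> x y \<in> B" if "x \<in> B" "y \<in> B" for x y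
    unfolding \<tau>_def using GB that subB by (simp add: subspace_diff)
  \<comment> \<open>Flatness turns \<open>G\<close> of a bracket into a commutator, so this is the
    invariance of the trace form.\<close>
  have inv: "\<beta> (\<tau> x f) g = - \<beta> (\<tau> x g) f" for x f g
  proof -
    have "tr (G f * G x * G g) = tr (G x * G g * G f)"
      using tr_commute[OF imG im_in_intros(6)[OF imG], of f x "G g"] by (simp add: mult.assoc)
    moreover have "tr (G g * G x * G f) = tr (G x * G f * G g)"
      using tr_commute[OF imG im_in_intros(6)[OF imG], of g x "G f"] by (simp add: mult.assoc)
    ultimately show ?thesis
      unfolding \<beta>_def \<tau>_def flat[symmetric] by (simp add: algebra_simps)
  qed
  define v where "v = (\<Sum>f\<in>F. G f \<cdot> f)"
  \<comment> \<open>Bracketing with \<open>x\<close> is skew for \<beta>, so it annihilates the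
    tensor summing \<open>f\<close> with \<open>f\<close> over a \<beta>-orthonormal basis.\<close>
  have cas: "(\<Sum>f\<in>F. h (\<tau> x f) f + h f (\<tau> x f)) = 0" if "x \<in> B" "bilinear h" for x and h :: "'a \<Rightarrow> 'a \<Rightarrow> 'c::real_vector"
  proof -
    have l: "linear (\<lambda>x. h x f)" "linear (h f)" for f
      using that(2) by (auto simp: bilinear_def)
    have \<tau>: "(\<Sum>g\<in>F. \<beta> (\<tau> x f) g *\<^sub>R g) = \<tau> x f" if "f \<in> F" for f
      using F(4)[OF \<tau>B] F(2) that \<open>x \<in> B\<close> by blast
    have "h (\<tau> x f) f = (\<Sum>g\<in>F. \<beta> (\<tau> x f) g *\<^sub>R h g f)" "h f (\<tau> x f) = (\<Sum>g\<in>F. \<beta> (\<tau> x f) g *\<^sub>R h f g)"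
      if "f \<in> F" for f
      by (subst \<tau>[OF that, symmetric], simp add: linear_sum[OF l(1)] linear_sum[OF l(2)] linear_cmul[OF l(1)] linear_cmul[OF l(2)])+
    then have "(\<Sum>f\<in>F. h (\<tau> x f) f + h f (\<tau> x f))
        = (\<Sum>f\<in>F. \<Sum>g\<in>F. \<beta> (\<tau> x f) g *\<^sub>R h g f) + (\<Sum>f\<in>F. \<Sum>g\<in>F. \<beta> (\<tau> x f) g *\<^sub>R h f g)"
      by (simp add: sum.distrib)
    also have "(\<Sum>f\<in>F. \<Sum>g\<in>F. \<beta> (\<tau> x f) g *\<^sub>R h g f) = (\<Sum>f\<in>F. \<Sum>g\<in>F. \<beta> (\<tau> x g) f *\<^sub>R h f g)"
      by (rule sum.swap)
    also have "\<dots> = - (\<Sum>f\<in>F. \<Sum>g\<in>F. \<beta> (\<tau> x f) g *\<^sub>R h f g)"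
      unfolding sum_negf[symmetric]
    proof (intro sum.cong refl)
      show "\<beta> (\<tau> x g) f *\<^sub>R h f g = - (\<beta> (\<tau> x f) g *\<^sub>R h f g)" for f g
        using inv[of x g f] by simp
    qed
    finally show ?thesis by simp
  qed
  have Gv: "G x \<cdot> v = (\<Sum>f\<in>F. G f \<cdot> (G f \<cdot> x))" if "x \<in> B" for x
  proof -
    have "bilinear (\<lambda>x y. G x \<cdot> y)" by (rule bilinI) simp_all
    from cas[OF that this] have z: "(\<Sum>f\<in>F. G (\<tau> x f) \<cdot> f + G f \<cdot> \<tau> x f) = 0" .
    have "G x \<cdot> (G f \<cdot> f) = G f \<cdot> (G f \<cdot> x) + (G (\<tau> x f) \<cdot> f + G f \<cdot> \<tau> x f)" for f
      using arg_cong[OF flat[of x f], of "\<lambda>F. F \<cdot> f"] by (simp add: \<tau>_def algebra_simps)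
    then show ?thesis using z by (simp add: v_def sum.distrib)
  qed
  have vB: "v \<in> B" unfolding v_def using GB F(2) subB by (intro subspace_sum) auto
  have "ip v x = 0" if "x \<in> B" for x
  proof -
    have "2 *\<^sub>R (\<Sum>f\<in>F. ip f (\<tau> x f)) = 0"
      using cas[OF that ip_bil] by (simp add: ip_sym[of "\<tau> x _"] flip: sum_distrib_left mult_2)
    moreover have "ip (G f \<cdot> f) x = ip f (\<tau> x f)" for f
      using skew_self[OF skew_G, of x f] skewD[OF skew_G, of f f x] by (simp add: \<tau>_def ip_sym[of f])
    ultimately show ?thesis by (simp add: v_def ip_sum)
  qed
  then have v0: "v = 0" using ip_self_0[of v] vB by (simp add: B_def)
  \<comment> \<open>The Casimir operator is a sum of squares of skew operators; paired with
    \<open>x\<close>, its vanishing kills every summand.\<close>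
  have GFB: "G f \<cdot> x = 0" if "x \<in> B" "f \<in> F" for x f
  proof -
    have "(\<Sum>f\<in>F. ip (G f \<cdot> x) (G f \<cdot> x)) = - ip (\<Sum>f\<in>F. G f \<cdot> (G f \<cdot> x)) x"
      by (simp add: ip_sum sum_negf[symmetric] skewD[OF skew_G, of _ "G _ \<cdot> x"])
    also have "\<dots> = 0" using Gv[OF that(1)] v0 by simp
    finally have "ip (G f \<cdot> x) (G f \<cdot> x) = 0"
      using sum_nonneg_0[OF F(1) _ _ that(2), of "\<lambda>f. ip (G f \<cdot> x) (G f \<cdot> x)"] ip_self_nonneg by blast
    then show ?thesis using ip_self_0 by (simp add: skew_P skew_G)
  qed
  have GB0: "G y \<cdot> b = 0" if b: "b \<in> B" for y b
  proof -
    obtain u c where uc: "u \<in> U" "c \<in> B" "P \<cdot> y = u + c"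
      using dec[of "P \<cdot> y"] im_inD[OF im_in_intros(7)] by blast
    have "G c = (\<Sum>f\<in>F. \<beta> c f *\<^sub>R G f)"
      by (subst F(4)[OF uc(2), symmetric]) (simp add: linear_sum[OF G_linear])
    then have "G c \<cdot> b = 0" by (simp add: app_sum GFB[OF b])
    moreover have "G y = G u + G c" by (metis G_P G_add uc(3))
    ultimately show ?thesis using uc(1) by (simp add: U_def)
  qed
  \<comment> \<open>As \<open>G y\<close> vanishes on \<open>B\<close>, skewness makes its image
    orthogonal to \<open>B\<close>; the image therefore lies in the kernel \<open>U\<close>.\<close>
  obtain u b where ub: "u \<in> U" "b \<in> B" "G y \<cdot> z = u + b"
    using dec[of "G y \<cdot> z"] by (auto simp: skew_P skew_G)
  have "ip (G y \<cdot> z) b = 0" using GB0[OF ub(2)] by (simp add: skewD skew_G)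
  moreover have "ip u b = 0" using ub by (simp add: B_def ip_sym[of u])
  ultimately have "b = 0" using ip_self_0[of b] ub by (simp add: B_def)
  then show ?thesis using ub by (simp add: U_def)
qed

end

section \<open>Vaisman structures\<close>

locale vaisman = hermitian_frame ip B J for ip :: "'a::real_vector \<Rightarrow> 'a \<Rightarrow> real" and B and J +
  fixes br :: "'a \<Rightarrow> 'a \<Rightarrow> 'a" and nabla :: "'a \<Rightarrow> 'a lin" and \<theta> :: "'a \<Rightarrow> real"
  assumes br_bil: "bilinear br" and br_P [simp]: "br (P \<cdot> x) y = br x y" "P \<cdot> br x y = br x y"
    and br_self [simp]: "br x x = 0"
    and jacobi: "br x (br y z) + br y (br z x) + br z (br x y) = 0"
    and nij: "br (J \<cdot> x) (J \<cdot> y) - br x y - J \<cdot> br x (J \<cdot> y) - J \<cdot> br (J \<cdot> x) y = 0"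
    and nabla_add: "nabla (x + y) = nabla x + nabla y" and nabla_scale: "nabla (c *\<^sub>R x) = c *\<^sub>R nabla x"
    and nabla_P [simp]: "nabla (P \<cdot> x) = nabla x"
    and skew_nabla: "skew (nabla x)"
    and torsion: "nabla x \<cdot> y - nabla y \<cdot> x = br x y"
    and theta_add: "\<theta> (x + y) = \<theta> x + \<theta> y" and theta_scale: "\<theta> (c *\<^sub>R x) = c * \<theta> x"
    and theta_P [simp]: "\<theta> (P \<cdot> x) = \<theta> x"
    and theta_nabla [simp]: "\<theta> (nabla x \<cdot> y) = 0"
    and d_omega: "- ip (br x y) (J \<cdot> z) + ip (br x z) (J \<cdot> y) - ip (br y z) (J \<cdot> x)
      = ip x (J \<cdot> y) * \<theta> z - ip x (J \<cdot> z) * \<theta> y + ip y (J \<cdot> z) * \<theta> x"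
    and theta_nz: "\<exists>x. \<theta> x \<noteq> 0"
    and unimod: "(\<Sum>b\<in>B. ip (br x b) b) = 0"
begin

lemma nabla_lin: "linear nabla" and theta_lin: "linear \<theta>"
  by (simp_all add: linear_iff nabla_add nabla_scale theta_add theta_scale)

lemma br_simps [simp]: "br (x + y) z = br x z + br y z" "br z (x + y) = br z x + br z y"
  "br (x - y) z = br x z - br y z" "br z (x - y) = br z x - br z y"
  "br (- x) z = - br x z" "br z (- x) = - br z x" "br 0 z = 0" "br z 0 = 0"
  "br (c *\<^sub>R x) z = c *\<^sub>R br x z" "br z (c *\<^sub>R x) = c *\<^sub>R br z x"
  using br_bil by (simp_all add: bilinear_ladd bilinear_radd bilinear_lsub bilinear_rsub
      bilinear_lneg bilinear_rneg bilinear_lmul bilinear_rmul bilinear_lzero bilinear_rzero)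

lemma br_anti: "br x y = - br y x"
proof -
  have "br (x + y) (x + y) = 0" by (rule br_self)
  then have "br y x + br x y = 0" unfolding br_simps(1,2) by simp
  then show ?thesis by (simp add: eq_neg_iff_add_eq_0 add.commute)
qed

lemma br_P2 [simp]: "br x (P \<cdot> y) = br x y"
  using br_anti[of x "P \<cdot> y"] br_anti[of x y] by simp

lemma nabla_simps [simp]: "nabla (x + y) = nabla x + nabla y" "nabla (x - y) = nabla x - nabla y"
  "nabla (- x) = - nabla x" "nabla 0 = 0" "nabla (c *\<^sub>R x) = c *\<^sub>R nabla x"
  using nabla_lin by (simp_all add: linear_add linear_diff linear_neg linear_0 linear_cmul)

lemma theta_simps [simp]: "\<theta> (x + y) = \<theta> x + \<theta> y" "\<theta> (x - y) = \<theta> x - \<theta> y" "\<theta> (- x) = - \<theta> x"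
  "\<theta> 0 = 0" "\<theta> (c *\<^sub>R x) = c * \<theta> x"
  using theta_lin by (simp_all add: linear_add linear_diff linear_neg linear_0 linear_cmul)

lemma theta_br [simp]: "\<theta> (br x y) = 0"
  unfolding torsion[symmetric] by simp

lemma Pn [simp]: "P \<cdot> (nabla x \<cdot> y) = nabla x \<cdot> y" "nabla x \<cdot> (P \<cdot> y) = nabla x \<cdot> y"
  using skew_P[OF skew_nabla] by auto

lemma ipn: "ip (nabla x \<cdot> y) z = - ip y (nabla x \<cdot> z)"
  using skewD[OF skew_nabla] .

text \<open>The Lee vector is not normalised: with this scaling of \<xi> = J A, the \<xi>
  coefficient of the bracket of horizontal vectors is exactly \<open>ip (J x) y\<close>, and the
  squared norm \<open>l\<close> shows up in projections instead.\<close>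

definition A :: 'a where "A = (\<Sum>b\<in>B. \<theta> b *\<^sub>R b)"
definition \<xi> :: 'a where "\<xi> = J \<cdot> A"
definition l :: real where "l = ip A A"

lemma ipA [simp]: "ip A x = \<theta> x" "ip x A = \<theta> x"
proof -
  have "ip x A = \<theta> (P \<cdot> x)"
    by (simp add: A_def ip_sum P_app linear_sum[OF theta_lin] mult.commute)
  then show "ip x A = \<theta> x" by simp
  then show "ip A x = \<theta> x" by (simp add: ip_sym)
qed

lemma PA [simp]: "P \<cdot> A = A" "P \<cdot> \<xi> = \<xi>"
  by (simp_all add: A_def P_E \<xi>_def)

lemma l_pos: "l > 0"
proof -
  have "l \<noteq> 0"
  proof
    assume "l = 0"
    then have "A = 0" using ip_self_0[of A] by (simp add: l_def)
    then have "\<theta> x = 0" for x using ipA(1)[of x] by (simp del: ipA)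
    then show False using theta_nz by simp
  qed
  moreover have "l \<ge> 0" unfolding l_def by (rule ip_self_nonneg)
  ultimately show ?thesis by simp
qed

lemma theta_A [simp]: "\<theta> A = l" by (simp add: l_def)

lemma theta_J: "\<theta> (J \<cdot> x) = - ip \<xi> x"
  using ipJ[of A x] by (simp add: \<xi>_def)

lemma theta_xi [simp]: "\<theta> \<xi> = 0"
  using theta_J[of A] skew_self[OF skew_J, of A] by (simp add: \<xi>_def)

lemma ip_xi_xi [simp]: "ip \<xi> \<xi> = l"
  by (simp add: \<xi>_def ipJJ)

lemma J_xi: "J \<cdot> \<xi> = - A"
  by (simp add: \<xi>_def)

lemma ip_xi_J: "ip \<xi> (J \<cdot> x) = \<theta> x"
  by (simp add: \<xi>_def ipJJ)

lemma nabla_A [simp]: "nabla x \<cdot> A = 0"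
proof (rule ip_eqI)
  show "ip (nabla x \<cdot> A) t = ip 0 t" for t using ipn[of x A t] by simp
qed simp_all

text \<open>The covariant derivative of \<open>J\<close>, with its vector value paired with
  \<open>z\<close>.\<close>

definition F :: "'a \<Rightarrow> 'a \<Rightarrow> 'a \<Rightarrow> real" where
  "F x y z = ip (nabla x \<cdot> (J \<cdot> y) - J \<cdot> (nabla x \<cdot> y)) z"

lemma F_alt: "F x y z = ip (nabla x \<cdot> y) (J \<cdot> z) - ip (nabla x \<cdot> z) (J \<cdot> y)"
  using ipn[of x "J \<cdot> y" z] ip_sym[of "J \<cdot> y" "nabla x \<cdot> z"] by (simp add: F_def ipJ)

lemma F_anti: "F x y z = - F x z y"
  by (simp add: F_alt)

lemma F_J: "F x (J \<cdot> y) z = F x y (J \<cdot> z)"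
  by (simp add: F_def ipJ ipJJ)

text \<open>For a torsion-free connection the exterior derivative of the fundamental form is the
  alternation of its covariant derivative; the lcK condition supplies the right side.\<close>

lemma F_sum: "F x y z + F y z x + F z x y
    = - (ip x (J \<cdot> y) * \<theta> z - ip x (J \<cdot> z) * \<theta> y + ip y (J \<cdot> z) * \<theta> x)"
  unfolding d_omega[symmetric] torsion[symmetric] F_alt by simp

lemma F_nij: "F (J \<cdot> y) z x - F (J \<cdot> z) y x + F y z (J \<cdot> x) - F z y (J \<cdot> x) = 0"
proof -
  have "ip (br (J \<cdot> y) (J \<cdot> z) - br y z - J \<cdot> br y (J \<cdot> z) - J \<cdot> br (J \<cdot> y) z) x = 0"
    unfolding nij by simp
  then show ?thesis unfolding torsion[symmetric] F_def by (simp add: ipJ ipJJ)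
qed

text \<open>The polarised formula expressing the covariant derivative of \<open>J\<close> on a Hermitian manifold
  through the exterior derivative of the fundamental form.\<close>

lemma F_eq: "2 * F x y z = - (ip x (J \<cdot> y) * \<theta> z - ip x (J \<cdot> z) * \<theta> y + ip y (J \<cdot> z) * \<theta> x)
    - ip x y * \<theta> (J \<cdot> z) + ip x z * \<theta> (J \<cdot> y) + ip y (J \<cdot> z) * \<theta> x"
proof -
  have "F x (J \<cdot> y) (J \<cdot> z) = - F x y z" by (simp add: F_J) (simp add: F_def)
  moreover have "F (J \<cdot> y) (J \<cdot> z) x = F (J \<cdot> y) z (J \<cdot> x)" by (simp add: F_J)
  moreover have "F (J \<cdot> z) x (J \<cdot> y) = - F (J \<cdot> z) y (J \<cdot> x)"
    by (simp add: F_anti[of _ x]) (simp add: F_J)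
  moreover have "F z x y = - F z y x" by (rule F_anti)
  moreover have F_nij': "F (J \<cdot> y) z (J \<cdot> x) - F (J \<cdot> z) y (J \<cdot> x) - F y z x + F z y x = 0"
    using F_nij[of y z "J \<cdot> x"] by (simp add: F_def)
  ultimately show ?thesis
    using F_sum[of x y z] F_sum[of x "J \<cdot> y" "J \<cdot> z"] F_nij'
    by (simp add: ipJ[of y])
qed

text \<open>\<open>A\<close> is parallel, so only the derivative of \<open>J\<close> contributes to
  that of \<open>J A\<close>.\<close>

lemma nabla_xi: "nabla x \<cdot> \<xi> = (1/2) *\<^sub>R (\<theta> x *\<^sub>R \<xi> - ip \<xi> x *\<^sub>R A - l *\<^sub>R (J \<cdot> x))"
proof (rule ip_eqI)
  fix t
  have "ip (nabla x \<cdot> \<xi>) t = F x A t" by (simp add: F_def \<xi>_def)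
  then show "ip (nabla x \<cdot> \<xi>) t = ip ((1/2) *\<^sub>R (\<theta> x *\<^sub>R \<xi> - ip \<xi> x *\<^sub>R A - l *\<^sub>R (J \<cdot> x))) t"
    using F_eq[of x A t]
    by (simp add: theta_J ip_xi_J ipJ[of x] ip_sym[of x \<xi>] mult.commute flip: \<xi>_def)
qed simp_all

lemma ip_nabla_xi: "ip (nabla x \<cdot> \<xi>) y = (\<theta> x * ip \<xi> y - ip \<xi> x * \<theta> y - l * ip (J \<cdot> x) y) / 2"
  unfolding nabla_xi by simp

lemma br_A: "br A x = nabla A \<cdot> x"
  using torsion[of A x] by simp

lemma nabla_A_J: "nabla A \<cdot> (J \<cdot> x) = J \<cdot> (nabla A \<cdot> x)"
proof (rule ip_eqI)
  fix t
  have "F A x t = 0" using F_eq[of A x t] by (simp add: theta_J)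
  then show "ip (nabla A \<cdot> (J \<cdot> x)) t = ip (J \<cdot> (nabla A \<cdot> x)) t" by (simp add: F_def)
qed simp_all

lemma br_A_xi [simp]: "br A \<xi> = 0" "br \<xi> A = 0"
  using nabla_xi[of A] br_A[of \<xi>] br_anti[of \<xi> A] by (simp_all add: \<xi>_def[symmetric])

text \<open>In the Nijenhuis tensor at \<open>A\<close> and \<open>x\<close> the two brackets with
  \<open>A\<close> cancel because they commute with \<open>J\<close>; the other two give the
  claim.\<close>

lemma br_xi_J: "br \<xi> (J \<cdot> x) = J \<cdot> br \<xi> x"
  using nij[of A x] nabla_A_J[of x] by (simp add: br_A flip: \<xi>_def)

text \<open>\<xi> is Killing: by \<open>ip_nabla_xi\<close> its covariant derivative is skew, and
  the bracket is a difference of two skew operators.\<close>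

lemma br_xi_skew: "ip (br \<xi> x) y = - ip x (br \<xi> y)"
proof -
  have "ip (nabla \<xi> \<cdot> x) y = - ip x (nabla \<xi> \<cdot> y)" by (rule ipn)
  moreover have "ip x (nabla y \<cdot> \<xi>) = - ip (nabla x \<cdot> \<xi>) y"
    unfolding ip_sym[of x "nabla y \<cdot> \<xi>"] ip_nabla_xi
    using ipJ[of y x] ip_sym[of y "J \<cdot> x"] by (simp add: field_simps)
  ultimately show ?thesis unfolding torsion[symmetric] by simp
qed

lemma ip_xi_br: "\<theta> x = 0 \<Longrightarrow> \<theta> y = 0 \<Longrightarrow> ip \<xi> x = 0 \<Longrightarrow> ip \<xi> y = 0 \<Longrightarrow> ip \<xi> (br x y) = l * ip (J \<cdot> x) y"
proof -
  assume a: "\<theta> x = 0" "\<theta> y = 0" "ip \<xi> x = 0" "ip \<xi> y = 0"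
  have "ip \<xi> (br x y) = - ip (nabla x \<cdot> \<xi>) y + ip (nabla y \<cdot> \<xi>) x"
    unfolding torsion[symmetric] by (simp add: ipn)
  also have "\<dots> = l * ip (J \<cdot> x) y"
    unfolding ip_nabla_xi using a ipJ[of y x] ip_sym[of y "J \<cdot> x"] by simp
  finally show ?thesis .
qed

section \<open>Reduction to the horizontal complement\<close>

definition Q :: "'a lin" where "Q = Lin (\<lambda>x. P \<cdot> x - (\<theta> x / l) *\<^sub>R A - (ip \<xi> x / l) *\<^sub>R \<xi>)"

lemma Q_app: "Q \<cdot> x = P \<cdot> x - (\<theta> x / l) *\<^sub>R A - (ip \<xi> x / l) *\<^sub>R \<xi>"
  unfolding Q_def by (rule app_Lin) (simp add: linear_iff algebra_simps add_divide_distrib)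

definition iph :: "'a \<Rightarrow> 'a \<Rightarrow> real" where "iph x y = ip (Q \<cdot> x) y"

lemma l_nz [simp]: "l \<noteq> 0"
  using l_pos by simp

lemma Q_simps [simp]: "\<theta> (Q \<cdot> x) = 0" "ip \<xi> (Q \<cdot> x) = 0" "ip (Q \<cdot> x) \<xi> = 0" "P \<cdot> (Q \<cdot> x) = Q \<cdot> x" "Q \<cdot> (P \<cdot> x) = Q \<cdot> x"
  "Q \<cdot> A = 0" "Q \<cdot> \<xi> = 0" "P \<cdot> (P \<cdot> x) = P \<cdot> x"
  using ip_sym[of "Q \<cdot> x" \<xi>] by (simp_all add: Q_app)

lemma Q_id: "P \<cdot> x = x \<Longrightarrow> \<theta> x = 0 \<Longrightarrow> ip \<xi> x = 0 \<Longrightarrow> Q \<cdot> x = x"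
  by (simp add: Q_app)

lemma QQ [simp]: "Q \<cdot> (Q \<cdot> x) = Q \<cdot> x"
  by (rule Q_id) simp_all

lemma ip_Q: "ip x (Q \<cdot> y) = iph x y"
  by (simp add: iph_def Q_app ip_sym[of x \<xi>] mult.commute)

lemma iph_eq: "\<theta> x = 0 \<Longrightarrow> ip \<xi> x = 0 \<Longrightarrow> iph x y = ip x y" "\<theta> y = 0 \<Longrightarrow> ip \<xi> y = 0 \<Longrightarrow> iph x y = ip x y"
  by (simp_all add: iph_def Q_app) 

lemma iph_Q [simp]: "iph (Q \<cdot> x) y = iph x y" "iph x (Q \<cdot> y) = iph x y"
  using ip_Q[of "Q \<cdot> x" y] by (simp_all add: iph_def)

lemma QJ: "Q \<cdot> (J \<cdot> x) = J \<cdot> (Q \<cdot> x)"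
  by (simp add: Q_app theta_J ip_xi_J J_xi flip: \<xi>_def)

lemma iph_sym: "iph x y = iph y x"
  using ip_sym[of "Q \<cdot> x" y] by (simp add: ip_Q) (simp add: iph_def)

lemma decomp: "P \<cdot> x = (\<theta> x / l) *\<^sub>R A + (ip \<xi> x / l) *\<^sub>R \<xi> + Q \<cdot> x"
  by (simp add: Q_app)

lemma transversal_basis:
  obtains E where "finite E" "\<And>e. e \<in> E \<Longrightarrow> Q \<cdot> e = e"
    "\<And>e f. e \<in> E \<Longrightarrow> f \<in> E \<Longrightarrow> ip e f = (if e = f then 1 else 0)" "\<And>x. Q \<cdot> x = (\<Sum>e\<in>E. ip x e *\<^sub>R e)"
proof -
  define V where "V = {x. Q \<cdot> x = x}"
  have PV: "P \<cdot> x = x" if "x \<in> V" for x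
    using that Q_simps(4)[of x] by (simp add: V_def)
  have sV: "subspace V" by (auto simp: V_def subspace_def)
  have VB: "V \<subseteq> span B" using PV in_span by blast
  have pos: "ip x x > 0" if "x \<in> V" "x \<noteq> 0" for x
  proof -
    have "ip x x \<noteq> 0" using ip_self_0[OF PV[OF that(1)]] that(2) by blast
    then show ?thesis using ip_self_nonneg[of x] by simp
  qed
  obtain E where E: "finite E" "E \<subseteq> V" "\<And>e f. e \<in> E \<Longrightarrow> f \<in> E \<Longrightarrow> ip e f = (if e = f then 1 else 0)"
    "\<And>x. x \<in> V \<Longrightarrow> (\<Sum>e\<in>E. ip x e *\<^sub>R e) = x"
    using gram_schmidt[OF finE sV VB ip_bil ip_sym pos] by blast
  have "Q \<cdot> x = (\<Sum>e\<in>E. ip x e *\<^sub>R e)" for x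
  proof -
    have "Q \<cdot> x \<in> V" by (simp add: V_def)
    then have "Q \<cdot> x = (\<Sum>e\<in>E. ip (Q \<cdot> x) e *\<^sub>R e)" by (rule E(4)[symmetric])
    also have "\<dots> = (\<Sum>e\<in>E. ip x e *\<^sub>R e)"
    proof (intro sum.cong refl)
      fix e assume "e \<in> E"
      then have "Q \<cdot> e = e" using E(2) by (auto simp: V_def)
      then show "ip (Q \<cdot> x) e *\<^sub>R e = ip x e *\<^sub>R e" using ip_Q[of x e] by (simp add: iph_def)
    qed
    finally show ?thesis .
  qed
  moreover have "Q \<cdot> e = e" if "e \<in> E" for e using E(2) that by (auto simp: V_def)
  ultimately show ?thesis using that[OF E(1) _ E(3)] by blast
qed

text \<open>The compression of the Levi-Civita connection to the horizontal space. \<open>Dh\<close>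
  is left uncompressed: it is skew and kills \<open>A\<close> and \<xi>, so it is horizontal
  already.\<close>

definition Gh :: "'a \<Rightarrow> 'a lin" where "Gh x = Q * nabla (Q \<cdot> x) * Q"
definition Dh :: "'a lin" where "Dh = Lin (br \<xi>)"

lemma Dh_app [simp]: "Dh \<cdot> x = br \<xi> x"
  unfolding Dh_def by (rule app_Lin) (simp add: linear_iff)

lemma ip_Q1: "ip (Q \<cdot> x) y = ip x (Q \<cdot> y)"
  by (simp add: ip_Q iph_def)

lemma skew_JQ: "skew (J * Q)"
  unfolding skew_def by (auto intro!: lin_eqI simp: ipJ ip_Q1 QJ)

lemma skew_Gh: "skew (Gh x)"
  unfolding skew_def by (auto intro!: lin_eqI simp: Gh_def ipn ip_Q1)

lemma skew_Dh: "skew Dh"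
  unfolding skew_def by (auto intro!: lin_eqI simp: br_xi_skew)

lemma br_Q: "br (Q \<cdot> x) (Q \<cdot> y) = Q \<cdot> br (Q \<cdot> x) (Q \<cdot> y) + ip (J \<cdot> (Q \<cdot> x)) (Q \<cdot> y) *\<^sub>R \<xi>"
  using ip_xi_br[of "Q \<cdot> x" "Q \<cdot> y"] by (simp add: Q_app[of "br _ _"])

end

locale vaisman_frame = vaisman +
  fixes E :: "'a set"
  assumes finE' [simp]: "finite E" and QE: "e \<in> E \<Longrightarrow> Q \<cdot> e = e"
    and onE: "e \<in> E \<Longrightarrow> f \<in> E \<Longrightarrow> ip e f = (if e = f then 1 else 0)"
    and Q_sum: "Q \<cdot> x = (\<Sum>e\<in>E. ip x e *\<^sub>R e)"
begin

lemma iph_E: "e \<in> E \<Longrightarrow> iph x e = ip x e"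
  using ip_Q[of x e] by (simp add: QE)

sublocale h: frame iph E
proof
  show "bilinear iph" unfolding iph_def by (rule bilinI) simp_all
  show "iph e f = (if e = f then 1 else 0)" if "e \<in> E" "f \<in> E" for e f
    using that by (simp add: iph_E onE)
  show "iph x y = (\<Sum>e\<in>E. iph x e * iph y e)" for x y
    by (simp add: iph_E cong: sum.cong) (simp add: iph_def Q_sum ip_sum ip_sym[of _ y])
qed (auto simp: iph_sym)

lemma hP: "h.P = Q"
  by (rule lin_eqI) (simp add: h.P_app Q_sum iph_E)

lemma h_skewI:
  assumes S: "skew S" and "S \<cdot> A = 0" "S \<cdot> \<xi> = 0"
  shows "h.skew S"
proof -
  have "\<theta> (S \<cdot> x) = 0" "ip \<xi> (S \<cdot> x) = 0" for x
    using skewD[OF S, of A x] skewD[OF S, of \<xi> x] assms by simp_all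
  then have z: "\<theta> (S \<cdot> x) = 0" "ip \<xi> (S \<cdot> x) = 0" for x by auto
  have "S \<cdot> (Q \<cdot> x) = S \<cdot> x" for x
    using assms by (simp add: Q_app skew_P S)
  moreover have "Q \<cdot> (S \<cdot> x) = S \<cdot> x" for x
    by (rule Q_id) (simp_all add: z skew_P S)
  moreover have "iph (S \<cdot> x) y = - iph x (S \<cdot> y)" for x y
    using skewD[OF S] by (simp add: iph_eq z)
  ultimately show ?thesis
    unfolding h.skew_def hP by (auto intro!: lin_eqI)
qed

lemma h_skew_Gh: "h.skew (Gh x)"
  by (rule h_skewI[OF skew_Gh]) (simp_all add: Gh_def)

lemma h_skew_A: "h.skew (nabla A)"
  using br_A[of \<xi>] by (intro h_skewI skew_nabla) simp_all

lemma h_skew_Dh: "h.skew Dh"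
  by (rule h_skewI[OF skew_Dh]) simp_all

sublocale h: hermitian_frame iph E "J * Q"
proof
  show "h.skew (J * Q)" by (rule h_skewI[OF skew_JQ]) simp_all
  show "J * Q * (J * Q) = - h.P" by (rule lin_eqI) (simp add: hP QJ)
qed

lemma Gh_tau: "Gh x \<cdot> y - Gh y \<cdot> x = Q \<cdot> br (Q \<cdot> x) (Q \<cdot> y)"
  by (simp add: Gh_def flip: torsion)

lemma Gh_simps [simp]: "Gh (x + y) = Gh x + Gh y" "Gh (x - y) = Gh x - Gh y" "Gh (c *\<^sub>R x) = c *\<^sub>R Gh x"
  "Gh (Q \<cdot> x) = Gh x"
  by (simp_all add: Gh_def algebra_simps)

text \<open>A skew derivation preserves the connection determined by bracket and metric. The defect
  \<open>K\<close> is symmetric in two arguments and skew in two others, so it vanishes, as in the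
  uniqueness proof for the Levi-Civita connection.\<close>

lemma Gh_commute_derivation:
  assumes S: "h.skew S"
    and der: "\<And>x y. S \<cdot> (Q \<cdot> br (Q \<cdot> x) (Q \<cdot> y)) = Q \<cdot> br (S \<cdot> x) (Q \<cdot> y) + Q \<cdot> br (Q \<cdot> x) (S \<cdot> y)"
  shows "S * Gh x - Gh x * S = Gh (S \<cdot> x)"
proof -
  define K where "K x y = S \<cdot> (Gh x \<cdot> y) - Gh (S \<cdot> x) \<cdot> y - Gh x \<cdot> (S \<cdot> y)" for x y
  have QS: "Q \<cdot> (S \<cdot> x) = S \<cdot> x" for x using h.skew_P(1)[OF S] by (simp add: hP)
  have sym: "K x y = K y x" for x y
  proof -
    have "S \<cdot> (Gh x \<cdot> y - Gh y \<cdot> x) = (Gh (S \<cdot> x) \<cdot> y - Gh y \<cdot> (S \<cdot> x)) + (Gh x \<cdot> (S \<cdot> y) - Gh (S \<cdot> y) \<cdot> x)"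
      unfolding Gh_tau der QS ..
    then show ?thesis unfolding K_def by (simp add: algebra_simps)
  qed
  have skw: "iph (K x y) z = - iph (K x z) y" for x y z
    unfolding K_def using h.skewD[OF S] h.skewD[OF h_skew_Gh]
    by (simp add: iph_sym[of _ y])
  have k0: "iph (K x y) z = 0" for x y z
    using skw[of x y z] skw[of z x y] skw[of y z x] sym[of x z] sym[of z y] sym[of y x] by simp
  have "K x y = 0" for x y
  proof (rule h.ip_eqI)
    show "h.P \<cdot> K x y = K x y"
      unfolding K_def using h.skew_P(1)[OF S] h.skew_P(1)[OF h_skew_Gh] by simp
  qed (simp_all add: k0)
  then show ?thesis
    by (intro lin_eqI) (simp add: K_def algebra_simps)
qed

lemma Q_br [simp]: "Q \<cdot> br \<xi> x = br \<xi> x" "Q \<cdot> br A x = br A x" "br \<xi> (Q \<cdot> x) = br \<xi> x" "br A (Q \<cdot> x) = br A x"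
  using h.skew_P[OF h_skew_Dh] h.skew_P[OF h_skew_A] by (simp_all add: hP br_A)

text \<open>Both vectors commute with \<xi>, so discarding the \<xi> component of a bracket does not
  disturb the derivation property.\<close>

lemma derivation_A_xi:
  assumes "v = A \<or> v = \<xi>"
  shows "br v (Q \<cdot> br (Q \<cdot> x) (Q \<cdot> y)) = Q \<cdot> br (br v x) (Q \<cdot> y) + Q \<cdot> br (Q \<cdot> x) (br v y)"
proof -
  have v: "br v \<xi> = 0" "br v (Q \<cdot> z) = br v z" "Q \<cdot> br v z = br v z" for z using assms by auto
  have "br v (Q \<cdot> br (Q \<cdot> x) (Q \<cdot> y)) = br v (br (Q \<cdot> x) (Q \<cdot> y))"
    by (subst (2) br_Q) (simp add: v)
  also have "\<dots> = br (br v (Q \<cdot> x)) (Q \<cdot> y) + br (Q \<cdot> x) (br v (Q \<cdot> y))"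
  proof -
    have "br (Q \<cdot> y) v = - br v (Q \<cdot> y)" "br (Q \<cdot> y) (br v (Q \<cdot> x)) = - br (br v (Q \<cdot> x)) (Q \<cdot> y)"
      by (rule br_anti)+
    then have "br v (br (Q \<cdot> x) (Q \<cdot> y)) - (br (br v (Q \<cdot> x)) (Q \<cdot> y) + br (Q \<cdot> x) (br v (Q \<cdot> y))) = 0"
      using jacobi[of v "Q \<cdot> x" "Q \<cdot> y"] by (simp del: v add: algebra_simps)
    then show ?thesis by (simp only: right_minus_eq)
  qed
  finally have "br v (Q \<cdot> br (Q \<cdot> x) (Q \<cdot> y)) = br (br v x) (Q \<cdot> y) + br (Q \<cdot> x) (br v y)"
    by (simp add: v)
  from arg_cong[OF this, of "\<lambda>z. Q \<cdot> z"] show ?thesis by (simp add: v(3))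
qed

lemma A_Gh: "nabla A * Gh x - Gh x * nabla A = Gh (nabla A \<cdot> x)"
  by (rule Gh_commute_derivation[OF h_skew_A]) (use derivation_A_xi[of A] in \<open>simp add: br_A\<close>)

lemma trace_decomp:
  "(\<Sum>b\<in>B. ip (T \<cdot> b) b) = (\<Sum>e\<in>E. ip (T \<cdot> e) e) + ip (T \<cdot> A) A / l + ip (T \<cdot> \<xi>) \<xi> / l"
proof -
  have ex: "(\<Sum>b\<in>B. ip (T \<cdot> b) y * ip b z) = ip (T \<cdot> (P \<cdot> z)) y" for y z
    by (simp add: P_app ip_sum ip_sym[of z] mult.commute)
  have "ip (T \<cdot> b) b = (\<Sum>e\<in>E. ip (T \<cdot> b) e * ip b e) + ip (T \<cdot> b) A * ip b A / l + ip (T \<cdot> b) \<xi> * ip b \<xi> / l" for b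
  proof -
    have "ip (T \<cdot> b) b = ip (T \<cdot> b) (P \<cdot> b)" by simp
    also have "\<dots> = (\<Sum>e\<in>E. ip (T \<cdot> b) e * ip b e) + ip (T \<cdot> b) A * ip b A / l + ip (T \<cdot> b) \<xi> * ip b \<xi> / l"
      unfolding decomp Q_sum by (simp add: ip_sum ip_sym[of b \<xi>] mult.commute del: ip_P)
    finally show ?thesis .
  qed
  then have "(\<Sum>b\<in>B. ip (T \<cdot> b) b) = (\<Sum>b\<in>B. \<Sum>e\<in>E. ip (T \<cdot> b) e * ip b e)
      + (\<Sum>b\<in>B. ip (T \<cdot> b) A * ip b A) / l + (\<Sum>b\<in>B. ip (T \<cdot> b) \<xi> * ip b \<xi>) / l"
    by (simp only: sum.distrib sum_divide_distrib)
  also have "(\<Sum>b\<in>B. \<Sum>e\<in>E. ip (T \<cdot> b) e * ip b e) = (\<Sum>e\<in>E. ip (T \<cdot> e) e)"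
  proof -
    have "P \<cdot> e = e" if "e \<in> E" for e using Q_simps(4)[of e] QE[OF that] by simp
    then show ?thesis by (subst sum.swap) (simp only: ex cong: sum.cong)
  qed
  finally show ?thesis unfolding ex by simp
qed

sublocale h: transversal_geometry iph E "J * Q" Dh Gh
proof -
  have J: "Gh x * (J * Q) = J * Q * Gh x" for x
  proof (rule lin_eqI)
    fix y
    \<comment> \<open>On horizontal arguments every term of \<open>F_eq\<close> carries a vanishing
      value of \<theta>, so the derivative of \<open>J\<close> has components only along
      \<open>A\<close> and \<xi>, which \<open>Q\<close> removes.\<close>
    have "nabla (Q \<cdot> x) \<cdot> (J \<cdot> (Q \<cdot> y)) - J \<cdot> (nabla (Q \<cdot> x) \<cdot> (Q \<cdot> y))
      = (ip (nabla (Q \<cdot> x) \<cdot> (J \<cdot> (Q \<cdot> y)) - J \<cdot> (nabla (Q \<cdot> x) \<cdot> (Q \<cdot> y))) A / l) *\<^sub>R A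
      + (ip (nabla (Q \<cdot> x) \<cdot> (J \<cdot> (Q \<cdot> y)) - J \<cdot> (nabla (Q \<cdot> x) \<cdot> (Q \<cdot> y))) \<xi> / l) *\<^sub>R \<xi>" (is "?v = _")
    proof -
      have "iph ?v t = 0" for t
        using F_eq[of "Q \<cdot> x" "Q \<cdot> y" "Q \<cdot> t"]
        by (simp add: F_def theta_J del: ip_lin flip: ip_Q)
      then have "Q \<cdot> ?v = 0"
        by - (rule h.ip_eqI, simp_all only: hP QQ iph_Q, simp_all)
      then show ?thesis using decomp[of ?v] by (simp only: ip_sym[of ?v \<xi>] ipA) simp
    qed
    from arg_cong[OF this, of "\<lambda>v. Q \<cdot> v"]
    show "(Gh x * (J * Q)) \<cdot> y = (J * Q * Gh x) \<cdot> y"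
      by (simp add: Gh_def QJ)
  qed
  have DG: "Dh * Gh x - Gh x * Dh = Gh (Dh \<cdot> x)" for x
    by (rule Gh_commute_derivation[OF h_skew_Dh]) (use derivation_A_xi[of \<xi>] in simp)
  \<comment> \<open>Paired with \<open>x\<close>, this is the trace of the bracket with
    \<open>x\<close> over the horizontal frame. The \<open>A\<close> direction contributes nothing
    since \<theta> kills brackets, nor does \<xi> since its bracket operator is skew.\<close>
  have div: "(\<Sum>e\<in>E. Gh e \<cdot> e) = 0"
  proof (rule h.ip_eqI)
    fix x
    have "iph (Gh e \<cdot> e) x = ip (br (Q \<cdot> x) e) e" if "e \<in> E" for e
    proof -
      have "iph (Gh e \<cdot> e) x = - iph e (Gh e \<cdot> x)" by (rule h.skewD[OF h_skew_Gh])
      also have "\<dots> = iph e (Gh x \<cdot> e - Gh e \<cdot> x)"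
        using h.skew_self[OF h_skew_Gh, of x e] by (simp add: iph_sym[of e])
      also have "\<dots> = ip e (br (Q \<cdot> x) e)" using that by (simp add: Gh_tau QE) (simp add: iph_sym[of e] iph_E ip_sym)
      finally show ?thesis by (simp add: ip_sym)
    qed
    then have "iph (\<Sum>e\<in>E. Gh e \<cdot> e) x = (\<Sum>e\<in>E. ip (br (Q \<cdot> x) e) e)"
      by (simp add: h.ip_sum)
    also have "\<dots> = 0"
    proof -
      define T where "T = Lin (br (Q \<cdot> x))"
      have T: "T \<cdot> y = br (Q \<cdot> x) y" for y
        unfolding T_def by (rule app_Lin) (simp add: linear_iff)
      have "ip (br (Q \<cdot> x) \<xi>) \<xi> = 0"
        using br_xi_skew[of "Q \<cdot> x" \<xi>] br_anti[of "Q \<cdot> x" \<xi>] by simp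
      then show ?thesis using trace_decomp[of T] unimod[of "Q \<cdot> x"] by (simp add: T)
    qed
    finally show "iph (\<Sum>e\<in>E. Gh e \<cdot> e) x = iph 0 x" by simp
  qed (simp_all add: h.skew_P[OF h_skew_Gh])
  interpret td: transversal_data iph E "J * Q" Dh Gh
    by unfold_locales
      (auto simp: h_skew_Dh h_skew_Gh J DG div hP intro!: lin_eqI simp: QJ br_xi_J)
  have tau: "td.tau x y = Q \<cdot> br (Q \<cdot> x) (Q \<cdot> y)" for x y
    by (simp add: td.tau_def Gh_tau)
  have w: "td.w x y = ip (J \<cdot> (Q \<cdot> x)) (Q \<cdot> y)" for x y
    by (simp add: td.w_def ip_Q)
  \<comment> \<open>The \<xi> component is put back into the inner bracket; what it adds is the
    Jacobi defect.\<close>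
  have tt: "td.tau x (td.tau y z) = Q \<cdot> br (Q \<cdot> x) (br (Q \<cdot> y) (Q \<cdot> z)) + td.w y z *\<^sub>R br \<xi> x" for x y z
    unfolding tau w by (subst (2) br_Q) (simp add: br_anti[of _ \<xi>])
  show "transversal_geometry iph E (J * Q) Dh Gh"
  proof
    fix x y z
    have "Q \<cdot> (br (Q \<cdot> x) (br (Q \<cdot> y) (Q \<cdot> z)) + br (Q \<cdot> y) (br (Q \<cdot> z) (Q \<cdot> x)) + br (Q \<cdot> z) (br (Q \<cdot> x) (Q \<cdot> y))) = 0"
      by (simp only: jacobi app_vec)
    then show "td.tau x (td.tau y z) + td.tau y (td.tau z x) + td.tau z (td.tau x y)
      = td.w y z *\<^sub>R Dh \<cdot> x + td.w z x *\<^sub>R Dh \<cdot> y + td.w x y *\<^sub>R Dh \<cdot> z"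
      unfolding tt by (simp add: algebra_simps)
  qed
qed

end

section \<open>Traces and the model algebras\<close>

text \<open>The trace uses a basis picked by choice. Expanding each basis in the other gives the
  same double sum of products of coefficients from either side.\<close>

lemma trace_on_basis:
  fixes L :: "'a::real_vector set"
  assumes B: "independent B" "span B = L" "finite B" and f: "linear_on L f" "\<And>x. x \<in> L \<Longrightarrow> f x \<in> L"
  shows "trace_on L f = (\<Sum>b\<in>B. representation B (f b) b)"
proof -
  define C where "C = (SOME C. independent C \<and> span C = L)"
  have C: "independent C" "span C = L"
    using someI[of "\<lambda>C. independent C \<and> span C = L" B] B by (auto simp: C_def)
  have finC: "finite C"
    using independent_span_bound[OF B(3) C(1)] C(2) B(2) span_superset[of C] by auto
  have cL: "c \<in> L" if "c \<in> C" for c using that C(2) span_base by auto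
  have bL: "b \<in> L" if "b \<in> B" for b using that B(2) span_base by auto
  have f_sum: "f (\<Sum>i\<in>I. k i *\<^sub>R v i) = (\<Sum>i\<in>I. k i *\<^sub>R f (v i))" if "finite I" "\<And>i. i \<in> I \<Longrightarrow> v i \<in> L" for k v and I :: "'i set"
    using that
  proof (induction I rule: finite_induct)
    case empty
    have "(0::'a) \<in> L" using B(2) span_zero by auto
    then have "f (0 *\<^sub>R 0) = 0 *\<^sub>R f 0" using f(1) unfolding linear_on_def by blast
    then show ?case by simp
  next
    case (insert x F)
    have "(\<Sum>i\<in>F. k i *\<^sub>R v i) \<in> L" "k x *\<^sub>R v x \<in> L"
      using insert.prems unfolding B(2)[symmetric] by (simp_all add: span_sum span_scale)
    then show ?case using insert f(1) by (simp add: linear_on_def)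
  qed
  have repB: "(\<Sum>b\<in>B. representation B v b *\<^sub>R b) = v" if "v \<in> L" for v
    using sum_representation_eq[OF B(1), of v B] that B by simp
  have repC: "(\<Sum>c\<in>C. representation C v c *\<^sub>R c) = v" if "v \<in> L" for v
    using sum_representation_eq[OF C(1), of v C] that C finC by simp
  have "(\<Sum>b\<in>B. representation B (f b) b) = (\<Sum>b\<in>B. \<Sum>c\<in>C. representation C (f b) c * representation B c b)"
  proof (rule sum.cong[OF refl])
    fix b assume b: "b \<in> B"
    have "representation B (f b) = representation B (\<Sum>c\<in>C. representation C (f b) c *\<^sub>R c)"
      using repC[OF f(2)[OF bL[OF b]]] by simp
    also have "\<dots> = (\<lambda>v. \<Sum>c\<in>C. representation B (representation C (f b) c *\<^sub>R c) v)"
      by (rule representation_sum[OF B(1)]) (use cL B(2) in \<open>auto intro: span_scale\<close>)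
    finally show "representation B (f b) b = (\<Sum>c\<in>C. representation C (f b) c * representation B c b)"
      using cL B by (simp add: representation_scale)
  qed
  also have "\<dots> = (\<Sum>c\<in>C. \<Sum>b\<in>B. representation B c b * representation C (f b) c)"
    by (subst sum.swap) (simp add: mult.commute)
  also have "\<dots> = (\<Sum>c\<in>C. representation C (f c) c)"
  proof (rule sum.cong[OF refl])
    fix c assume c: "c \<in> C"
    have "representation C (f c) = representation C (f (\<Sum>b\<in>B. representation B c b *\<^sub>R b))"
      using repB[OF cL[OF c]] by simp
    also have "\<dots> = representation C (\<Sum>b\<in>B. representation B c b *\<^sub>R f b)"
      using f_sum[of B "\<lambda>b. b" "representation B c"] bL B(3) by simp
    also have "\<dots> = (\<lambda>v. \<Sum>b\<in>B. representation C (representation B c b *\<^sub>R f b) v)"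
      by (rule representation_sum[OF C(1)]) (use f(2) bL C(2) in \<open>auto intro: span_scale\<close>)
    finally show "(\<Sum>b\<in>B. representation B c b * representation C (f b) c) = representation C (f c) c"
      using f(2) bL C by (simp add: representation_scale)
  qed
  finally show ?thesis by (simp add: trace_on_def C_def Let_def)
qed

text \<open>\<phi> is linear only on \<open>L\<close>, so it is first replaced by a total linear map
  agreeing with it there; that map carries a basis to a basis and preserves coefficients.\<close>

lemma trace_on_iso:
  fixes \<phi> :: "'a::real_vector \<Rightarrow> 'b::real_vector"
  assumes L: "L = span B0" "finite B0" and \<phi>: "linear_on L \<phi>" "bij_betw \<phi> L L'"
    and f: "linear_on L f" "\<And>x. x \<in> L \<Longrightarrow> f x \<in> L"
    and g: "linear_on L' g" "\<And>x. x \<in> L' \<Longrightarrow> g x \<in> L'" and gf: "\<And>x. x \<in> L \<Longrightarrow> g (\<phi> x) = \<phi> (f x)"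
  shows "trace_on L' g = trace_on L f"
proof -
  obtain B where B: "B \<subseteq> L" "independent B" "L \<subseteq> span B" using maximal_independent_subset by blast
  have finB: "finite B" using independent_span_bound[OF L(2) B(2)] B(1) L(1) by blast
  have spB: "span B = L" using B L by (metis span_minimal subset_antisym subspace_span)
  obtain h where h: "linear h" "\<And>x. x \<in> B \<Longrightarrow> h x = \<phi> x"
    using linear_independent_extend[OF B(2), of \<phi>] by blast
  have h\<phi>: "h x = \<phi> x" if "x \<in> L" for x
  proof -
    have "x \<in> span B" using that spB by simp
    then have "x \<in> L \<and> h x = \<phi> x"
    proof (induction rule: span_induct_alt)
      case base
      have "(0::'a) \<in> L" using L span_zero by auto
      then have "\<phi> (0 *\<^sub>R 0) = 0 *\<^sub>R \<phi> 0" using \<phi>(1) unfolding linear_on_def by blast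
      then show ?case using h(1) \<open>0 \<in> L\<close> by (simp add: linear_0)
    next
      case (step c x y)
      then have "x \<in> L" "y \<in> L" "c *\<^sub>R x \<in> L" "c *\<^sub>R x + y \<in> L"
        using B(1) spB by (auto intro: span_scale span_base span_add)
      then show ?case using step h \<phi>(1) by (simp add: linear_on_def linear_add linear_cmul)
    qed
    then show ?thesis ..
  qed
  have inj: "inj_on h (span B)"
    using \<phi>(2) h\<phi> spB by (simp add: bij_betw_def inj_on_def)
  have im: "h ` L = L'" using \<phi>(2) h\<phi> by (simp add: bij_betw_def)
  define C where "C = h ` B"
  have C: "independent C" "span C = L'" "finite C"
    using linear_independent_injective_image[OF h(1) B(2) inj] im finB spB
    by (simp_all add: C_def linear_span_image[OF h(1)])
  have injB: "inj_on h B" using inj by (rule inj_on_subset) (rule span_superset)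
  have rep: "representation C (h v) (h b) = representation B v b" if v: "v \<in> L" and b: "b \<in> B" for v b
  proof -
    have "h v = h (\<Sum>b\<in>B. representation B v b *\<^sub>R b)"
      using sum_representation_eq[OF B(2), of v B] v spB finB by simp
    also have "\<dots> = (\<Sum>b\<in>B. representation B v b *\<^sub>R h b)"
      by (simp add: linear_sum[OF h(1)] linear_cmul[OF h(1)])
    also have "representation C \<dots> = (\<lambda>c. \<Sum>b\<in>B. representation C (representation B v b *\<^sub>R h b) c)"
      by (rule representation_sum[OF C(1)]) (auto simp: C_def intro: span_scale span_base)
    also have "\<dots> = (\<lambda>c. \<Sum>b\<in>B. representation B v b * (if c = h b then 1 else 0))"
    proof
      fix c
      show "(\<Sum>b\<in>B. representation C (representation B v b *\<^sub>R h b) c)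
        = (\<Sum>b\<in>B. representation B v b * (if c = h b then 1 else 0))"
      proof (rule sum.cong[OF refl])
        fix b assume "b \<in> B"
        then have hb: "h b \<in> C" by (simp add: C_def)
        show "representation C (representation B v b *\<^sub>R h b) c = representation B v b * (if c = h b then 1 else 0)"
          unfolding representation_scale[OF C(1) span_base[OF hb]] representation_basis[OF C(1) hb] by simp
      qed
    qed
    finally have "representation C (h v) (h b) = (\<Sum>b'\<in>B. representation B v b' * (if h b = h b' then 1 else 0))"
      by simp
    also have "\<dots> = (\<Sum>b'\<in>B. if b' = b then representation B v b' else 0)"
      by (rule sum.cong) (use injB b in \<open>auto simp: inj_on_def\<close>)
    finally show ?thesis using finB b by simp
  qed
  have "trace_on L' g = (\<Sum>c\<in>C. representation C (g c) c)"
    by (rule trace_on_basis[OF C g])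
  also have "\<dots> = (\<Sum>b\<in>B. representation C (g (h b)) (h b))"
    unfolding C_def by (rule sum.reindex[OF injB, unfolded comp_def])
  also have "\<dots> = (\<Sum>b\<in>B. representation B (f b) b)"
  proof (rule sum.cong[OF refl])
    fix b assume b: "b \<in> B"
    then have bL: "b \<in> L" using B(1) by blast
    have "g (h b) = h (f b)" using gf[OF bL] h\<phi> bL f(2)[OF bL] by simp
    then show "representation C (g (h b)) (h b) = representation B (f b) b"
      using rep[OF f(2)[OF bL] b] by simp
  qed
  also have "\<dots> = trace_on L f"
    using trace_on_basis[OF B(2) spB finB f] by simp
  finally show ?thesis .
qed

text \<open>Transports unimodularity of the given algebra to the model, instead of computing traces
  in the model.\<close>

lemma unimodular_iso:
  assumes L: "lie_algebra L br" "unimodular L br"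
    and \<phi>: "linear_on L \<phi>" "bij_betw \<phi> L L'" "\<And>x y. x \<in> L \<Longrightarrow> y \<in> L \<Longrightarrow> \<phi> (br x y) = br' (\<phi> x) (\<phi> y)"
    and lin: "\<And>x. x \<in> L' \<Longrightarrow> linear_on L' (br' x)"
  shows "unimodular L' br'"
  unfolding unimodular_def
proof
  fix y assume y: "y \<in> L'"
  obtain x where x: "x \<in> L" "y = \<phi> x" using \<phi>(2) y by (auto simp: bij_betw_def)
  obtain B0 where B0: "finite B0" "L = span B0" using L(1) by (auto simp: lie_algebra_def)
  have closed: "br x z \<in> L" if "z \<in> L" for z using L(1) x that by (simp add: lie_algebra_def)
  have "trace_on L' (br' y) = trace_on L (br x)"
  proof (rule trace_on_iso[OF B0(2,1) \<phi>(1,2)])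
    show "linear_on L (br x)" using L(1) x by (simp add: lie_algebra_def bilinear_on_def)
    show "br' y (\<phi> z) = \<phi> (br x z)" if "z \<in> L" for z using \<phi>(3) x that by simp
    show "br' y z \<in> L'" if zL: "z \<in> L'" for z
    proof -
      obtain z' where z': "z' \<in> L" "z = \<phi> z'" using \<phi>(2) zL by (auto simp: bij_betw_def)
      then have "br' y z = \<phi> (br x z')" using \<phi>(3) x by simp
      then show ?thesis using closed[OF z'(1)] \<phi>(2) by (auto simp: bij_betw_def)
    qed
  qed (use closed lin y in auto)
  then show "trace_on L' (br' y) = 0" using L(2) x by (simp add: unimodular_def)
qed

section \<open>Coordinates and solvability of the models\<close>

abbreviation lk :: "cvec \<Rightarrow> nat \<Rightarrow> complex" where "lk \<equiv> Poly_Mapping.lookup"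

definition cvec_of :: "nat \<Rightarrow> (nat \<Rightarrow> complex) \<Rightarrow> cvec" where
  "cvec_of n f = Abs_poly_mapping (\<lambda>k. if k < n then f k else 0)"

lemma lk_cvec_of [simp]: "lk (cvec_of n f) k = (if k < n then f k else 0)"
  by (simp add: cvec_of_def)

lemma cvec_of_cspace [simp]: "cvec_of n f \<in> cspace n"
  by (auto simp: cspace_def in_keys_iff split: if_splits)

lemma cspace_iff: "z \<in> cspace n \<longleftrightarrow> (\<forall>k\<ge>n. lk z k = 0)"
  by (auto simp: cspace_def in_keys_iff subset_iff not_less[symmetric])

lemma lk_scaleR [simp]: "lk (c *\<^sub>R z) k = c *\<^sub>R lk z k"
proof -
  have "finite {k. c *\<^sub>R lk z k \<noteq> 0}"
    by (rule finite_subset[OF _ finite_keys[of z]]) (auto simp: in_keys_iff)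
  then show ?thesis by (simp add: scaleR_poly_mapping_def)
qed

lemma lk_diag_act [simp]: "lk (diag_act d w) k = lk d k * lk w k"
  by (auto simp: diag_act_def lookup_mapp in_keys_iff when_def)

lemma diag_act_simps: "diag_act 0 w = 0" "diag_act d 0 = 0"
  "diag_act d (w + w') = diag_act d w + diag_act d w'" "diag_act d (c *\<^sub>R w) = c *\<^sub>R diag_act d w"
  "diag_act (d + d') w = diag_act d w + diag_act d' w" "diag_act (c *\<^sub>R d) w = c *\<^sub>R diag_act d w"
  by (rule poly_mapping_eqI; simp add: lookup_add algebra_simps)+

lemma std_simps: "std_symplectic n (z + z') w = std_symplectic n z w + std_symplectic n z' w"
  "std_symplectic n z (w + w') = std_symplectic n z w + std_symplectic n z w'"
  "std_symplectic n (c *\<^sub>R z) w = c * std_symplectic n z w" "std_symplectic n z (c *\<^sub>R w) = c * std_symplectic n z w"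
  "std_symplectic n 0 w = 0" "std_symplectic n z 0 = 0"
  by (simp_all add: std_symplectic_def lookup_add sum.distrib sum_distrib_left algebra_simps sum_subtractf)

lemma diag_act_cspace: "w \<in> cspace q \<Longrightarrow> diag_act d w \<in> cspace q"
  by (simp add: cspace_iff)

lemma subspace_cspace: "subspace (cspace q)"
  by (auto simp: subspace_def cspace_iff lookup_add)

lemma gh_bracket_linear:
  "linear_on (gh p q) (gh_bracket p q \<psi> x)"
  if "linear_on (odd_space p) \<psi>" "x \<in> gh p q"
  using that
  by (auto simp: linear_on_def gh_def odd_space_def gh_bracket_def m_bracket_def omega_m_def
      diag_act_simps std_simps algebra_simps)

text \<open>The successive derived algebras lie in R Z1 + C^q, in R Z1 and in 0.\<close>

lemma gh_solvable:
  assumes \<psi>: "linear_on (odd_space p) \<psi>"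
  shows "solvable (gh p q) (gh_bracket p q \<psi>)"
proof -
  let ?D = "derived_series (gh p q) (gh_bracket p q \<psi>)"
  define S1 where "S1 = {(t::real, (0::real, 0::cvec), w) | t w. w \<in> cspace q}"
  define S2 where "S2 = {(t::real, (0::real, 0::cvec), 0::cvec) | t. True}"
  have sub1: "subspace S1" using subspace_cspace[of q]
    by (auto simp: S1_def subspace_def zero_prod_def)
  have sub2: "subspace S2" by (auto simp: S2_def subspace_def zero_prod_def)
  have \<psi>0: "\<psi> (0, 0) = 0"
  proof -
    have "(0::real, 0::cvec) \<in> odd_space p" by (simp add: odd_space_def cspace_iff)
    then have "\<psi> (0 *\<^sub>R (0, 0)) = 0 *\<^sub>R \<psi> (0, 0)" using \<psi> unfolding linear_on_def by blast
    then show ?thesis by (simp add: zero_prod_def)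
  qed
  have "?D (Suc 0) \<subseteq> S1"
    unfolding derived_series.simps
  proof (rule span_minimal[OF _ sub1], rule subsetI)
    fix v assume "v \<in> {gh_bracket p q \<psi> x y |x y. x \<in> gh p q \<and> y \<in> gh p q}"
    then obtain x y where "v = gh_bracket p q \<psi> x y" "x \<in> gh p q" "y \<in> gh p q" by auto
    then show "v \<in> S1"
      using subspace_cspace[of q] diag_act_cspace[of _ q]
      by (auto simp: S1_def gh_bracket_def m_bracket_def gh_def subspace_diff zero_prod_def)
  qed
  moreover have "gh_bracket p q \<psi> x y \<in> S2" if "x \<in> S1" "y \<in> S1" for x y
    using that by (auto simp: S1_def S2_def gh_bracket_def m_bracket_def \<psi>0 diag_act_simps zero_prod_def)
  ultimately have "?D (Suc (Suc 0)) \<subseteq> S2"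
    unfolding derived_series.simps(2)[of _ _ "Suc 0"] by (intro span_minimal[OF _ sub2]) blast
  moreover have "gh_bracket p q \<psi> x y = 0" if "x \<in> S2" "y \<in> S2" for x y
    using that by (auto simp: S2_def gh_bracket_def m_bracket_def omega_m_def \<psi>0 diag_act_simps std_simps zero_prod_def)
  ultimately have "?D (Suc (Suc (Suc 0))) \<subseteq> {0}"
    unfolding derived_series.simps(2)[of _ _ "Suc (Suc 0)"] by (intro span_minimal subspace_single_0) blast
  moreover have "0 \<in> ?D (Suc (Suc (Suc 0)))" by (simp add: span_zero)
  ultimately have "?D (Suc (Suc (Suc 0))) = {0}" by blast
  then show ?thesis unfolding solvable_def by blast
qed

section \<open>The flat case\<close>

context vaisman_frame
begin

lemma br_formula: "br x y = ip (J \<cdot> (Q \<cdot> x)) (Q \<cdot> y) *\<^sub>R \<xi>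
    + ((\<theta> x / l) *\<^sub>R nabla A \<cdot> y - (\<theta> y / l) *\<^sub>R nabla A \<cdot> x)
    + ((ip \<xi> x / l) *\<^sub>R Dh \<cdot> y - (ip \<xi> y / l) *\<^sub>R Dh \<cdot> x) + (Gh x \<cdot> y - Gh y \<cdot> x)"
proof -
  have a: "br (Q \<cdot> z) A = - br A z" "br (Q \<cdot> z) \<xi> = - br \<xi> z" for z
    using br_anti[of "Q \<cdot> z" A] br_anti[of "Q \<cdot> z" \<xi>] by simp_all
  have "br x y = br (P \<cdot> x) (P \<cdot> y)" by simp
  also have "\<dots> = br ((\<theta> x / l) *\<^sub>R A + (ip \<xi> x / l) *\<^sub>R \<xi> + Q \<cdot> x) ((\<theta> y / l) *\<^sub>R A + (ip \<xi> y / l) *\<^sub>R \<xi> + Q \<cdot> y)"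
    unfolding decomp ..
  also have "\<dots> = br (Q \<cdot> x) (Q \<cdot> y) + ((\<theta> x / l) *\<^sub>R br A y - (\<theta> y / l) *\<^sub>R br A x)
    + ((ip \<xi> x / l) *\<^sub>R br \<xi> y - (ip \<xi> y / l) *\<^sub>R br \<xi> x)"
    by (simp add: a)
  finally show ?thesis by (subst (asm) br_Q) (simp add: Gh_tau br_A)
qed

text \<open>The flat metric Lie algebra \<open>g / R \<xi>\<close>, realised on the orthogonal complement of \<open>\<xi>\<close>.\<close>

definition ipf :: "'a \<Rightarrow> 'a \<Rightarrow> real" where "ipf x y = iph x y + \<theta> x * \<theta> y / l"
definition Ef :: "'a set" where "Ef = insert ((1 / sqrt l) *\<^sub>R A) E"
definition Gf :: "'a \<Rightarrow> 'a lin" where "Gf x = Gh x + (\<theta> x / l) *\<^sub>R nabla A"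

lemma h_skew_Gf: "h.skew (Gf x)"
  unfolding Gf_def by (intro h.skew_intros h_skew_Gh h_skew_A)

lemma Gf_simps [simp]: "Gf (x + y) = Gf x + Gf y" "Gf (c *\<^sub>R x) = c *\<^sub>R Gf x" "Gf \<xi> = 0"
  using Gh_simps(4)[of \<xi>] Gh_simps(3)[of 0 0]
  by (simp_all add: Gf_def algebra_simps add_divide_distrib)

lemma Gf_J: "Gf x \<cdot> (J \<cdot> (Q \<cdot> y)) = J \<cdot> (Q \<cdot> (Gf x \<cdot> y))"
  using h.GJ_app[of x y] h.skew_P[OF h_skew_A] by (simp add: Gf_def hP nabla_A_J QJ)

lemma theta_E: "e \<in> E \<Longrightarrow> \<theta> e = 0"
  using Q_simps(1)[of e] by (simp add: QE)

sublocale k: frame ipf Ef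
proof
  show "bilinear ipf" unfolding ipf_def iph_def by (rule bilinI) (simp_all add: algebra_simps add_divide_distrib)
  show "ipf x y = ipf y x" for x y by (simp add: ipf_def iph_sym mult.commute)
  define a where "a = (1 / sqrt l) *\<^sub>R A"
  have "a \<notin> E"
  proof
    assume "a \<in> E"
    then have "\<theta> a = 0" by (rule theta_E)
    then show False using l_pos by (simp add: a_def)
  qed
  have ss: "sqrt l * sqrt l = l" using l_pos by simp
  have xa: "ipf x a = \<theta> x / sqrt l" for x
    by (simp add: ipf_def iph_sym[of x] a_def iph_def)
  have xe: "ipf x e = ip x e" if "e \<in> E" for x e
    using that by (simp add: ipf_def theta_E iph_E)
  show "ipf e f = (if e = f then 1 else 0)" if "e \<in> Ef" "f \<in> Ef" for e f
  proof -
    have "ipf a a = 1" using l_pos by (simp add: xa) (simp add: a_def real_div_sqrt)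
    moreover have "ipf a e = 0" "ipf e a = 0" if "e \<in> E" for e
      using that \<open>\<And>x y. ipf x y = ipf y x\<close>[of a e] by (simp_all add: xa theta_E)
    ultimately show ?thesis
      using that \<open>a \<notin> E\<close> onE xe by (auto simp: Ef_def simp flip: a_def)
  qed
  show "ipf x y = (\<Sum>e\<in>Ef. ipf x e * ipf y e)" for x y
  proof -
    have "(\<Sum>e\<in>Ef. ipf x e * ipf y e) = \<theta> x * \<theta> y / l + (\<Sum>e\<in>E. ipf x e * ipf y e)"
      unfolding Ef_def a_def[symmetric] using \<open>a \<notin> E\<close> l_pos by (simp add: xa)
    also have "(\<Sum>e\<in>E. ipf x e * ipf y e) = (\<Sum>e\<in>E. iph x e * iph y e)"
      by (intro sum.cong refl) (simp add: xe iph_E)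
    also have "\<dots> = iph x y" by (rule h.parseval[symmetric])
    finally show ?thesis by (simp add: ipf_def)
  qed
qed (simp add: Ef_def)

lemma kP: "k.P \<cdot> x = (\<theta> x / l) *\<^sub>R A + Q \<cdot> x"
proof (rule k.ip_eqI)
  show "k.P \<cdot> (k.P \<cdot> x) = k.P \<cdot> x" using arg_cong[OF k.PP, of "\<lambda>F. F \<cdot> x"] by simp
  have A: "k.P \<cdot> A = A"
  proof -
    define a where "a = (1 / sqrt l) *\<^sub>R A"
    have "k.P \<cdot> a = a" by (rule k.P_E) (simp add: Ef_def a_def)
    moreover have "A = sqrt l *\<^sub>R a" using l_pos by (simp add: a_def)
    ultimately show ?thesis by simp
  qed
  have "k.P \<cdot> (Q \<cdot> x) = Q \<cdot> x"
  proof -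
    have "k.P \<cdot> e = e" if "e \<in> E" for e by (rule k.P_E) (simp add: Ef_def that)
    then show ?thesis unfolding Q_sum by (simp cong: sum.cong)
  qed
  then show "k.P \<cdot> ((\<theta> x / l) *\<^sub>R A + Q \<cdot> x) = (\<theta> x / l) *\<^sub>R A + Q \<cdot> x"
    by (simp add: A)
  have "ipf x t = ipf ((\<theta> x / l) *\<^sub>R A + Q \<cdot> x) t" for t
    by (simp add: ipf_def iph_def)
  then show "ipf (k.P \<cdot> x) t = ipf ((\<theta> x / l) *\<^sub>R A + Q \<cdot> x) t" for t by simp
qed

lemma k_skew:
  assumes S: "h.skew S"
  shows "k.skew S"
proof -
  have Q: "Q \<cdot> (S \<cdot> x) = S \<cdot> x" "S \<cdot> (Q \<cdot> x) = S \<cdot> x" for x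
    using h.skew_P[OF S] by (simp_all add: hP)
  have \<theta>: "\<theta> (S \<cdot> x) = 0" for x using Q_simps(1)[of "S \<cdot> x"] by (simp add: Q)
  have A: "S \<cdot> A = 0" using Q(2)[of A] by simp
  show ?thesis
    unfolding k.skew_def
    by (auto intro!: lin_eqI simp: kP Q \<theta> A ipf_def h.skewD[OF S])
qed

end

locale flat_vaisman = vaisman_frame +
  assumes flat: "h.R x y = 0" and Dh_0: "Dh = 0"
begin

sublocale k: flat_frame ipf Ef Gf
proof
  show "k.skew (Gf x)" for x by (rule k_skew[OF h_skew_Gf])
  show "Gf (k.P \<cdot> x) = Gf x" for x
    using Gh_simps(4)[of A] Gh_simps(3)[of 0 0] by (simp add: kP Gf_def)
  fix x y
  have c: "Gh x * Gh y - Gh y * Gh x = Gh (Gh x \<cdot> y - Gh y \<cdot> x)"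
    using flat[of x y] unfolding h.R_def h.tau_def by (simp add: Dh_0)
  have \<theta>: "\<theta> (Gf x \<cdot> y) = 0" for x y
  proof -
    have "Q \<cdot> (Gf x \<cdot> y) = Gf x \<cdot> y" using h.skew_P(1)[OF h_skew_Gf] by (simp add: hP)
    then show ?thesis by (metis Q_simps(1))
  qed
  \<comment> \<open>The squares of \<open>nabla A\<close> cancel, and \<open>A_Gh\<close> rewrites
    the mixed commutators as values of \<open>Gh\<close>.\<close>
  have "Gf x * Gf y - Gf y * Gf x = (Gh x * Gh y - Gh y * Gh x)
      + (\<theta> x / l) *\<^sub>R (nabla A * Gh y - Gh y * nabla A) - (\<theta> y / l) *\<^sub>R (nabla A * Gh x - Gh x * nabla A)"
    by (simp add: Gf_def algebra_simps)
  also have "\<dots> = Gh (Gf x \<cdot> y - Gf y \<cdot> x)"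
    unfolding c A_Gh by (simp add: Gf_def algebra_simps)
  also have "\<dots> = Gf (Gf x \<cdot> y - Gf y \<cdot> x)"
    by (subst (3) Gf_def) (simp add: \<theta>)
  finally show "Gf x * Gf y - Gf y * Gf x = Gf (Gf x \<cdot> y - Gf y \<cdot> x)" .
qed simp_all

lemma Gf_commute: "Gf x * Gf y = Gf y * Gf x"
  using k.flat[of x y] by (simp add: k.flat_image_zero)

lemma eigenbasis:
  obtains F d where "finite F" "\<And>f. f \<in> F \<Longrightarrow> Q \<cdot> f = f"
    "\<And>f g. f \<in> F \<Longrightarrow> g \<in> F \<Longrightarrow> ip f g = (if f = g then 1 else 0)"
    "\<And>f g. f \<in> F \<Longrightarrow> g \<in> F \<Longrightarrow> ip f (J \<cdot> g) = 0"
    "\<And>x f. f \<in> F \<Longrightarrow> Gf x \<cdot> f = d x f *\<^sub>R (J \<cdot> f)"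
    "\<And>x. Q \<cdot> x = (\<Sum>f\<in>F. ip x f *\<^sub>R f + ip x (J \<cdot> f) *\<^sub>R (J \<cdot> f))"
proof -
  obtain F where F: "h.unitary F" "\<And>T f. T \<in> range Gf \<Longrightarrow> f \<in> F \<Longrightarrow> \<exists>d. T \<cdot> f = d *\<^sub>R ((J * Q) \<cdot> f)"
    "\<And>x. h.P \<cdot> x = (\<Sum>f\<in>F. iph x f *\<^sub>R f + iph x ((J * Q) \<cdot> f) *\<^sub>R ((J * Q) \<cdot> f))"
  proof (rule h.unitary_eigenbasis[of "range Gf"])
    show "h.skew T" if "T \<in> range Gf" for T using that h_skew_Gf by auto
    show "T \<cdot> ((J * Q) \<cdot> x) = (J * Q) \<cdot> (T \<cdot> x)" if "T \<in> range Gf" for T x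
      using that Gf_J by auto
    show "T \<cdot> (S \<cdot> x) = S \<cdot> (T \<cdot> x)" if T: "T \<in> range Gf" "S \<in> range Gf" for T S x
    proof -
      obtain a b where "T = Gf a" "S = Gf b" using T by auto
      then show ?thesis using arg_cong[OF Gf_commute[of a b], of "\<lambda>F. F \<cdot> x"] by simp
    qed
  qed blast
  have QF: "Q \<cdot> f = f" if "f \<in> F" for f using F(1) that by (simp add: h.unitary_def hP)
  have i: "iph x f = ip x f" "iph x (J \<cdot> f) = ip x (J \<cdot> f)" if "f \<in> F" for x f
    using ip_Q[of x f] ip_Q[of x "J \<cdot> f"] by (simp_all add: QF that QJ)
  define d where "d x f = (SOME d. Gf x \<cdot> f = d *\<^sub>R ((J * Q) \<cdot> f))" for x f
  have d: "Gf x \<cdot> f = d x f *\<^sub>R (J \<cdot> f)" if "f \<in> F" for x f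
    using someI_ex[OF F(2)[OF rangeI that, of x]] by (simp add: d_def QF that)
  show ?thesis
  proof (rule that[of F d])
    show "Q \<cdot> x = (\<Sum>f\<in>F. ip x f *\<^sub>R f + ip x (J \<cdot> f) *\<^sub>R (J \<cdot> f))" for x
      using F(3)[of x] by (simp add: hP QF i cong: sum.cong)
  qed (use F(1) QF i d in \<open>auto simp: h.unitary_def\<close>)
qed

lemma br_flat: "br x y = ip (J \<cdot> (Q \<cdot> x)) (Q \<cdot> y) *\<^sub>R \<xi> + (Gf x \<cdot> y - Gf y \<cdot> x)"
  using br_formula[of x y] by (simp add: Dh_0 Gf_def del: Dh_app)

text \<open>\<open>A\<close> becomes Z0 and \<xi> becomes Z1. Joint eigenvectors of weight zero span
  C^p, the others span C^q, and the weights of the latter are the entries of \<psi>.\<close>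

lemma flat_iso:
  shows "\<exists>p q \<psi>. linear_on (odd_space p) \<psi> \<and> \<psi> ` odd_space p \<subseteq> torus q \<and>
    (\<exists>\<phi>. linear_on (range (app P)) \<phi> \<and> bij_betw \<phi> (range (app P)) (gh p q) \<and>
      (\<forall>x\<in>range (app P). \<forall>y\<in>range (app P). \<phi> (br x y) = gh_bracket p q \<psi> (\<phi> x) (\<phi> y)))"
proof -
  obtain F d where F: "finite F" "\<And>f. f \<in> F \<Longrightarrow> Q \<cdot> f = f"
    "\<And>f g. f \<in> F \<Longrightarrow> g \<in> F \<Longrightarrow> ip f g = (if f = g then 1 else 0)"
    "\<And>f g. f \<in> F \<Longrightarrow> g \<in> F \<Longrightarrow> ip f (J \<cdot> g) = 0"
    and d: "\<And>x f. f \<in> F \<Longrightarrow> Gf x \<cdot> f = d x f *\<^sub>R (J \<cdot> f)"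
    and QF: "\<And>x. Q \<cdot> x = (\<Sum>f\<in>F. ip x f *\<^sub>R f + ip x (J \<cdot> f) *\<^sub>R (J \<cdot> f))"
    using eigenbasis by blast
  define F0 where "F0 = {f \<in> F. \<forall>x. d x f = 0}"
  define F1 where "F1 = {f \<in> F. \<not> (\<forall>x. d x f = 0)}"
  have F01: "F = F0 \<union> F1" "F0 \<inter> F1 = {}" "finite F0" "finite F1" "F0 \<subseteq> F" "F1 \<subseteq> F"
    using F(1) by (auto simp: F0_def F1_def)
  define p where "p = card F0"
  define q where "q = card F1"
  obtain z where z: "bij_betw z {..<p} F0"
    using ex_bij_betw_nat_finite[OF F01(3)] unfolding p_def atLeast0LessThan by blast
  obtain u where u: "bij_betw u {..<q} F1"
    using ex_bij_betw_nat_finite[OF F01(4)] unfolding q_def atLeast0LessThan by blast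
  have zF: "z k \<in> F0" "z k \<in> F" if "k < p" for k
    using bij_betwE[OF z] that F01 by auto
  have uF: "u k \<in> F1" "u k \<in> F" if "k < q" for k
    using bij_betwE[OF u] that F01 by auto
  have sum_F: "(\<Sum>f\<in>F. h f) = (\<Sum>k<p. h (z k)) + (\<Sum>k<q. h (u k))" for h :: "'a \<Rightarrow> 'b::comm_monoid_add"
    unfolding F01(1) using F01
    by (simp add: sum.union_disjoint sum.reindex_bij_betw[OF z] sum.reindex_bij_betw[OF u])
  \<comment> \<open>A nonzero weight puts \<open>f\<close> and \<open>J f\<close> into the image of
    some \<open>Gf x\<close>, and vectors in such an image are annihilated by \<open>Gf\<close>.
    Hence C^q acts trivially and is an abelian ideal modulo \<xi>.\<close>
  have Gf_F1: "Gf f = 0" "Gf (J \<cdot> f) = 0" if f: "f \<in> F1" for f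
  proof -
    obtain x where x: "d x f \<noteq> 0" using f by (auto simp: F1_def)
    have fF: "f \<in> F" using f F01 by auto
    have J: "Gf x \<cdot> f = d x f *\<^sub>R (J \<cdot> f)" using d[OF fF] .
    have "Gf x \<cdot> (J \<cdot> f) = J \<cdot> (Gf x \<cdot> f)"
      using Gf_J[of x f] F(2)[OF fF] J by (simp add: QJ)
    also have "\<dots> = - d x f *\<^sub>R f"
    proof -
      have "P \<cdot> f = f" using Q_simps(4)[of f] F(2)[OF fF] by simp
      then show ?thesis by (simp add: J)
    qed
    finally have "Gf (- d x f *\<^sub>R f) = 0" using k.flat_image_zero[of x "J \<cdot> f"] by simp
    then show "Gf f = 0" using x by simp
    have "Gf (d x f *\<^sub>R (J \<cdot> f)) = 0" using k.flat_image_zero[of x f] J by simp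
    then show "Gf (J \<cdot> f) = 0" using x by simp
  qed
  define co where "co x f = Complex (ip x f) (ip x (J \<cdot> f))" for x f
  define V where "V s = fst s *\<^sub>R A + (\<Sum>k<p. Re (lk (snd s) k) *\<^sub>R z k + Im (lk (snd s) k) *\<^sub>R (J \<cdot> z k))" for s :: "real \<times> cvec"
  define W where "W v = (\<Sum>k<q. Re (lk v k) *\<^sub>R u k + Im (lk v k) *\<^sub>R (J \<cdot> u k))" for v :: cvec
  define \<psi> where "\<psi> s = cvec_of q (\<lambda>k. \<i> * of_real (d (V s) (u k)))" for s
  define \<phi> where "\<phi> x = (ip \<xi> x / l, (\<theta> x / l, cvec_of p (\<lambda>k. co x (z k))), cvec_of q (\<lambda>k. co x (u k)))" for x
  define \<eta> where "\<eta> y = fst y *\<^sub>R \<xi> + V (fst (snd y)) + W (snd (snd y))" for y :: "real \<times> (real \<times> cvec) \<times> cvec"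
  let ?L = "range (app P)"
  have J_nz: "J \<cdot> f \<noteq> 0" if "f \<in> F" for f
  proof
    assume "J \<cdot> f = 0"
    then have "ip f f = 0" using ipJJ[of f f] by simp
    then show False using F(3)[OF that that] by simp
  qed
  have d_lin: "d (x + y) f = d x f + d y f" "d (c *\<^sub>R x) f = c * d x f" if "f \<in> F" for x y f c
  proof -
    have "(d (x + y) f - (d x f + d y f)) *\<^sub>R (J \<cdot> f) = 0" "(d (c *\<^sub>R x) f - c * d x f) *\<^sub>R (J \<cdot> f) = 0"
      using d[OF that, of "x + y"] d[OF that, of "c *\<^sub>R x"] d[OF that, of x] d[OF that, of y]
      by (simp_all add: algebra_simps) auto
    then show "d (x + y) f = d x f + d y f" "d (c *\<^sub>R x) f = c * d x f" using J_nz[OF that] by auto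
  qed
  have d_eq: "d x f = d y f" if "f \<in> F" "Gf x = Gf y" for x y f
  proof -
    show ?thesis using d[OF that(1), of x] d[OF that(1), of y] that(2) J_nz[OF that(1)] by simp
  qed
  \<comment> \<open>The components along \<open>F1\<close> and \<xi> do not act, so the weights
    depend only on the \<open>odd_space\<close> coordinates and \<psi> is defined there.\<close>
  have Gf_V: "Gf x = Gf (V (fst (snd (\<phi> x))))" for x
  proof -
    have lin: "linear Gf" by (simp add: linear_iff)
    have "Gf x = Gf (k.P \<cdot> x)" by simp
    also have "k.P \<cdot> x = (\<theta> x / l) *\<^sub>R A + (\<Sum>k<p. ip x (z k) *\<^sub>R z k + ip x (J \<cdot> z k) *\<^sub>R (J \<cdot> z k))
       + (\<Sum>k<q. ip x (u k) *\<^sub>R u k + ip x (J \<cdot> u k) *\<^sub>R (J \<cdot> u k))"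
      unfolding kP QF sum_F by simp
    also have "Gf \<dots> = Gf ((\<theta> x / l) *\<^sub>R A + (\<Sum>k<p. ip x (z k) *\<^sub>R z k + ip x (J \<cdot> z k) *\<^sub>R (J \<cdot> z k)))
       + (\<Sum>k<q. ip x (u k) *\<^sub>R Gf (u k) + ip x (J \<cdot> u k) *\<^sub>R Gf (J \<cdot> u k))"
      by (simp only: Gf_simps linear_sum[OF lin])
    also have "(\<Sum>k<q. ip x (u k) *\<^sub>R Gf (u k) + ip x (J \<cdot> u k) *\<^sub>R Gf (J \<cdot> u k)) = 0"
      by (rule sum.neutral) (simp add: Gf_F1 uF)
    also have "(\<theta> x / l) *\<^sub>R A + (\<Sum>k<p. ip x (z k) *\<^sub>R z k + ip x (J \<cdot> z k) *\<^sub>R (J \<cdot> z k)) = V (fst (snd (\<phi> x)))"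
      by (simp add: V_def \<phi>_def co_def)
    finally show ?thesis by simp
  qed
  have V_add: "V (s + t) = V s + V t" and V_scale: "V (c *\<^sub>R s) = c *\<^sub>R V s" for s t c
    by (simp_all add: V_def lookup_add sum.distrib algebra_simps scaleR_sum_right)
  have \<psi>_lin: "linear_on (odd_space p) \<psi>"
    unfolding linear_on_def \<psi>_def
    by (auto intro!: poly_mapping_eqI simp: V_add V_scale d_lin uF lookup_add algebra_simps complex_eq_iff)
  have \<psi>_torus: "\<psi> ` odd_space p \<subseteq> torus q"
    by (auto simp: \<psi>_def torus_def)
  have co_lin: "co (x + y) f = co x f + co y f" "co (c *\<^sub>R x) f = c *\<^sub>R co x f" for x y f c
    by (simp_all add: co_def complex_eq_iff)
  have \<phi>_lin: "linear_on ?L \<phi>"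
    unfolding linear_on_def \<phi>_def
    by (auto intro!: poly_mapping_eqI simp: co_lin lookup_add add_divide_distrib)
  have \<phi>_gh: "\<phi> x \<in> gh p q" for x
    by (simp add: \<phi>_def gh_def odd_space_def)
  have \<eta>\<phi>: "\<eta> (\<phi> x) = P \<cdot> x" for x
    unfolding decomp[of x] QF sum_F by (simp add: \<eta>_def V_def W_def \<phi>_def co_def)
  have \<eta>L: "\<eta> y \<in> ?L" for y
  proof -
    have P: "P \<cdot> f = f" if "f \<in> F" for f using Q_simps(4)[of f] F(2)[OF that] by simp
    have "P \<cdot> \<eta> y = \<eta> y"
      by (simp add: \<eta>_def V_def W_def P zF uF)
    then show ?thesis by (metis rangeI)
  qed
  have tF: "\<theta> f = 0" "ip \<xi> f = 0" "\<theta> (J \<cdot> f) = 0" "ip \<xi> (J \<cdot> f) = 0" if "f \<in> F" for f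
    using Q_simps(1,2)[of f] F(2)[OF that] by (simp_all add: theta_J ip_xi_J)
  have co_F: "co (\<Sum>k\<in>I. a k *\<^sub>R v k + b k *\<^sub>R (J \<cdot> v k)) f = (\<Sum>k\<in>I. if v k = f then Complex (a k) (b k) else 0)"
    if "f \<in> F" "\<And>k. k \<in> I \<Longrightarrow> v k \<in> F" for f I and a b :: "nat \<Rightarrow> real" and v
  proof -
    have "ip (J \<cdot> g) f = 0" if "g \<in> F" for g
      using F(4)[OF \<open>f \<in> F\<close> that] ip_sym[of f] by simp
    then show ?thesis
      unfolding co_def complex_eq_iff using that
      by (auto simp: ip_sum F(3,4) ipJJ intro!: sum.cong)
  qed
  have co0: "co A f = 0" "co \<xi> f = 0" if "f \<in> F" for f
    using tF[OF that] by (simp_all add: co_def complex_eq_iff)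
  have co_add: "co (x + y) f = co x f + co y f" for x y f by (rule co_lin)
  have zu: "z i \<noteq> u j" if "i < p" "j < q" for i j using zF uF that F01 by fastforce
  have inj: "z i = z k \<longleftrightarrow> i = k" if "i < p" "k < p" for i k
    using z that by (auto simp: bij_betw_def inj_on_def)
  have inju: "u i = u k \<longleftrightarrow> i = k" if "i < q" "k < q" for i k
    using u that by (auto simp: bij_betw_def inj_on_def)
  have co_sum: "co (\<Sum>i<n. Re (lk x i) *\<^sub>R v i + Im (lk x i) *\<^sub>R (J \<cdot> v i)) (v k) = lk x k"
    if "\<And>i. i < n \<Longrightarrow> v i \<in> F" "k < n" "\<And>i. i < n \<Longrightarrow> v i = v k \<longleftrightarrow> i = k" for n v k x
  proof -
    have "co (\<Sum>i<n. Re (lk x i) *\<^sub>R v i + Im (lk x i) *\<^sub>R (J \<cdot> v i)) (v k)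
      = (\<Sum>i<n. if v i = v k then Complex (Re (lk x i)) (Im (lk x i)) else 0)"
      by (rule co_F) (use that in auto)
    also have "\<dots> = (\<Sum>i<n. if i = k then lk x i else 0)"
      by (rule sum.cong) (use that(3) in \<open>auto simp: complex_eq_iff\<close>)
    finally show ?thesis using that(2) by simp
  qed
  have co_sum0: "co (\<Sum>i<n. Re (lk x i) *\<^sub>R v i + Im (lk x i) *\<^sub>R (J \<cdot> v i)) f = 0"
    if "\<And>i. i < n \<Longrightarrow> v i \<in> F" "f \<in> F" "\<And>i. i < n \<Longrightarrow> v i \<noteq> f" for n v f x
  proof -
    have "co (\<Sum>i<n. Re (lk x i) *\<^sub>R v i + Im (lk x i) *\<^sub>R (J \<cdot> v i)) f
      = (\<Sum>i<n. if v i = f then Complex (Re (lk x i)) (Im (lk x i)) else 0)"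
      by (rule co_F) (use that in auto)
    also have "\<dots> = 0" by (rule sum.neutral) (use that(3) in auto)
    finally show ?thesis .
  qed
  have \<phi>\<eta>: "\<phi> (\<eta> y) = y" if y: "y \<in> gh p q" for y
  proof -
    obtain t r v w where yy: "y = (t, (r, v), w)" by (cases y) auto
    have vw: "v \<in> cspace p" "w \<in> cspace q" using y by (auto simp: yy gh_def odd_space_def)
    have "ip \<xi> (\<eta> y) = t * l" "\<theta> (\<eta> y) = r * l"
      by (simp_all add: \<eta>_def yy V_def W_def ip_sum linear_sum[OF theta_lin] tF zF uF)
    moreover have "cvec_of p (\<lambda>k. co (\<eta> y) (z k)) = v"
    proof (rule poly_mapping_eqI)
      fix k
      have "co (\<eta> y) (z k) = lk v k" if k: "k < p"
        using co_sum[of p z, OF zF(2) k inj[OF _ k], of v] co_sum0[of q u, OF uF(2) zF(2)[OF k] zu[OF k, symmetric], of w] k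
        by (simp add: \<eta>_def yy V_def W_def co_add co_lin(2) co0 zF)
      then show "lk (cvec_of p (\<lambda>k. co (\<eta> y) (z k))) k = lk v k"
        using vw by (auto simp: cspace_iff)
    qed
    moreover have "cvec_of q (\<lambda>k. co (\<eta> y) (u k)) = w"
    proof (rule poly_mapping_eqI)
      fix k
      have "co (\<eta> y) (u k) = lk w k" if k: "k < q"
        using co_sum[of q u, OF uF(2) k inju[OF _ k], of w] co_sum0[of p z, OF zF(2) uF(2)[OF k] zu[OF _ k], of v] k
        by (simp add: \<eta>_def yy V_def W_def co_add co_lin(2) co0 uF)
      then show "lk (cvec_of q (\<lambda>k. co (\<eta> y) (u k))) k = lk w k"
        using vw by (auto simp: cspace_iff)
    qed
    ultimately show ?thesis by (simp add: \<phi>_def yy)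
  qed
  have bij: "bij_betw \<phi> ?L (gh p q)"
  proof (rule bij_betw_byWitness[of _ \<eta>])
    show "\<forall>x\<in>?L. \<eta> (\<phi> x) = x" by (auto simp: \<eta>\<phi>)
  qed (use \<phi>\<eta> \<phi>_gh \<eta>L in auto)
  have br_co: "co (Gf x \<cdot> y) f = \<i> * of_real (d x f) * co y f" if f: "f \<in> F" for x y f
  proof -
    have s: "ip (Gf x \<cdot> y) g = - ip y (Gf x \<cdot> g)" if "Q \<cdot> g = g" for g
    proof -
      have "Q \<cdot> (Gf x \<cdot> y) = Gf x \<cdot> y" using h.skew_P(1)[OF h_skew_Gf] by (simp add: hP)
      then have "ip (Gf x \<cdot> y) g = iph (Gf x \<cdot> y) g" by (metis iph_def)
      also have "\<dots> = - iph y (Gf x \<cdot> g)" by (rule h.skewD[OF h_skew_Gf])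
      also have "iph y (Gf x \<cdot> g) = ip y (Gf x \<cdot> g)"
        using h.skew_P(1)[OF h_skew_Gf, of x g] ip_Q[of y "Gf x \<cdot> g"] by (simp add: hP)
      finally show ?thesis .
    qed
    have Pf: "P \<cdot> f = f" using Q_simps(4)[of f] F(2)[OF f] by simp
    have "Gf x \<cdot> (J \<cdot> f) = - d x f *\<^sub>R f"
      using Gf_J[of x f] F(2)[OF f] d[OF f, of x] Pf by (simp add: QJ)
    then show ?thesis
      using s[of f] s[of "J \<cdot> f"] d[OF f, of x] F(2)[OF f] by (simp add: co_def complex_eq_iff QJ)
  qed
  have hom: "\<phi> (br x y) = gh_bracket p q \<psi> (\<phi> x) (\<phi> y)" for x y
  proof -
    have brco: "co (br x y) f = \<i> * of_real (d x f) * co y f - \<i> * of_real (d y f) * co x f" if "f \<in> F" for f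
    proof -
      have "co (Gf x \<cdot> y - Gf y \<cdot> x) f = co (Gf x \<cdot> y) f - co (Gf y \<cdot> x) f"
        by (simp add: co_def complex_eq_iff)
      then show ?thesis
        unfolding br_flat[of x y] by (simp add: co_lin co0 br_co that)
    qed
    have xi: "ip \<xi> (br x y) / l = std_symplectic p (cvec_of p (\<lambda>k. co x (z k))) (cvec_of p (\<lambda>k. co y (z k)))
      + std_symplectic q (cvec_of q (\<lambda>k. co x (u k))) (cvec_of q (\<lambda>k. co y (u k)))"
    proof -
      have "ip \<xi> (Gf x \<cdot> y) = 0" for x y
      proof -
        have "Q \<cdot> (Gf x \<cdot> y) = Gf x \<cdot> y" using h.skew_P(1)[OF h_skew_Gf] by (simp add: hP)
        then show ?thesis by (metis Q_simps(2))
      qed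
      then have "ip \<xi> (br x y) / l = ip (J \<cdot> (Q \<cdot> x)) (Q \<cdot> y)"
        unfolding br_flat[of x y] by simp
      also have "\<dots> = ip (J \<cdot> (Q \<cdot> x)) y" by (simp add: ip_Q) (simp add: iph_def QJ)
      also have "\<dots> = (\<Sum>f\<in>F. ip x f * ip y (J \<cdot> f) - ip x (J \<cdot> f) * ip y f)"
      proof -
        have "P \<cdot> f = f" if "f \<in> F" for f using Q_simps(4)[of f] F(2)[OF that] by simp
        then show ?thesis unfolding QF by (simp add: ip_sum ip_sym[of _ y] cong: sum.cong)
      qed
      also have "\<dots> = std_symplectic p (cvec_of p (\<lambda>k. co x (z k))) (cvec_of p (\<lambda>k. co y (z k)))
          + std_symplectic q (cvec_of q (\<lambda>k. co x (u k))) (cvec_of q (\<lambda>k. co y (u k)))"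
        unfolding sum_F by (simp add: std_symplectic_def co_def)
      finally show ?thesis .
    qed
    have d0: "d v (z k) = 0" if "k < p" for v k using zF(1)[OF that] by (auto simp: F0_def)
    have dV: "d v (u k) = d (V (fst (snd (\<phi> v)))) (u k)" if "k < q" for v k
      by (rule d_eq[OF uF(2)[OF that] Gf_V])
    have 1: "cvec_of p (\<lambda>k. co (br x y) (z k)) = 0"
      by (rule poly_mapping_eqI) (simp add: brco zF d0)
    have 2: "cvec_of q (\<lambda>k. co (br x y) (u k)) = diag_act (\<psi> (fst (snd (\<phi> x)))) (cvec_of q (\<lambda>k. co y (u k)))
      - diag_act (\<psi> (fst (snd (\<phi> y)))) (cvec_of q (\<lambda>k. co x (u k)))"
      by (rule poly_mapping_eqI) (simp add: brco uF \<psi>_def lookup_minus flip: dV)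
    show ?thesis
      using xi 1 2 by (simp add: \<phi>_def gh_bracket_def m_bracket_def omega_m_def zero_prod_def)
  qed
  show ?thesis
    using \<psi>_lin \<psi>_torus \<phi>_lin bij hom by blast
qed

end

section \<open>The four-dimensional case\<close>

lemma lie_isomorphicI:
  assumes "linear_on L f" "\<And>x y. x \<in> L \<Longrightarrow> y \<in> L \<Longrightarrow> f x = f y \<Longrightarrow> x = y" "f ` L = L'"
    and "\<And>x y. x \<in> L \<Longrightarrow> y \<in> L \<Longrightarrow> f (br x y) = br' (f x) (f y)"
  shows "lie_isomorphic L br L' br'"
  unfolding lie_isomorphic_def
  using assms by (intro exI[of _ f]) (auto simp: bij_betw_def inj_on_def)

text \<open>The bracket is that of a central line and a three-dimensional simple algebra with
  parameter \<open>m\<close>. The sign of \<open>m\<close> selects the real form, and its size is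
  absorbed by rescaling \<open>c\<close> and \<open>d\<close> with the square root of |m|.\<close>

lemma u2_or_gl2R:
  fixes a t c d :: "'a::real_vector \<Rightarrow> real"
  assumes lin: "linear_on L a" "linear_on L t" "linear_on L c" "linear_on L d"
    and inj: "\<And>x y. x \<in> L \<Longrightarrow> y \<in> L \<Longrightarrow> a x = a y \<Longrightarrow> t x = t y \<Longrightarrow> c x = c y \<Longrightarrow> d x = d y \<Longrightarrow> x = y"
    and surj: "\<And>r s u v. \<exists>x\<in>L. a x = r \<and> t x = s \<and> c x = u \<and> d x = v"
    and br: "\<And>x y. x \<in> L \<Longrightarrow> y \<in> L \<Longrightarrow> a (br x y) = 0"
      "\<And>x y. x \<in> L \<Longrightarrow> y \<in> L \<Longrightarrow> t (br x y) = c x * d y - d x * c y"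
      "\<And>x y. x \<in> L \<Longrightarrow> y \<in> L \<Longrightarrow> c (br x y) = m * (t y * d x - t x * d y)"
      "\<And>x y. x \<in> L \<Longrightarrow> y \<in> L \<Longrightarrow> d (br x y) = m * (t x * c y - t y * c x)"
    and m: "m \<noteq> 0"
  shows "lie_isomorphic L br u2 commutator \<or> lie_isomorphic L br gl2R commutator"
proof -
  define b where "b = sqrt \<bar>m\<bar>"
  have b: "b * b = \<bar>m\<bar>" "b \<noteq> 0" using m by (simp_all add: b_def)
  note lin' = lin[unfolded linear_on_def]
  note mat = vec_eq_iff forall_2 matrix_matrix_mult_def sum_2 commutator_def
  show ?thesis
  proof (cases "m < 0")
    case True
    then have bm: "m = - (b * b)" using b by simp
    \<comment> \<open>\<open>a\<close> multiplies the identity, \<open>c\<close> and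
      \<open>d\<close> the symmetric trace-free matrices, \<open>t\<close> the rotation generator;
      the halves adjust the structure constants.\<close>
    define f :: "'a \<Rightarrow> real ^ 2 ^ 2" where "f x = vector [vector [a x + b * c x / 2, (b * d x - m * t x) / 2],
      vector [(b * d x + m * t x) / 2, a x - b * c x / 2]]" for x
    have f: "f x $ 1 $ 1 = a x + b * c x / 2" "f x $ 1 $ 2 = (b * d x - m * t x) / 2"
      "f x $ 2 $ 1 = (b * d x + m * t x) / 2" "f x $ 2 $ 2 = a x - b * c x / 2" for x
      by (simp_all add: f_def vector_2)
    have "lie_isomorphic L br gl2R commutator"
    proof (rule lie_isomorphicI[of _ f])
      show "linear_on L f"
        using lin' by (simp add: linear_on_def mat f) (simp add: field_simps)
      show "x = y" if "x \<in> L" "y \<in> L" "f x = f y" for x y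
      proof (rule inj[OF that(1,2)])
        have e: "f x $ i $ j = f y $ i $ j" for i j using that by simp
        have "a x + b * c x / 2 = a y + b * c y / 2" "a x - b * c x / 2 = a y - b * c y / 2"
          "b * d x - m * t x = b * d y - m * t y" "b * d x + m * t x = b * d y + m * t y"
          using e[of 1 1] e[of 2 2] e[of 1 2] e[of 2 1] by (simp_all add: f)
        then have "a x = a y" "m * t x = m * t y" "b * c x = b * c y" "b * d x = b * d y" by linarith+
        then show "a x = a y" "t x = t y" "c x = c y" "d x = d y" using b(2) m by simp_all
      qed
      show "f ` L = gl2R"
      proof -
        have "M \<in> f ` L" for M
        proof -
          obtain x where "x \<in> L" "a x = (M $ 1 $ 1 + M $ 2 $ 2) / 2" "t x = (M $ 2 $ 1 - M $ 1 $ 2) / m"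
            "c x = (M $ 1 $ 1 - M $ 2 $ 2) / b" "d x = (M $ 1 $ 2 + M $ 2 $ 1) / b"
            using surj by blast
          then have "f x = M" using b m by (simp add: mat f field_simps)
          then show ?thesis using \<open>x \<in> L\<close> by blast
        qed
        then show ?thesis by (auto simp: gl2R_def)
      qed
      show "f (br x y) = commutator (f x) (f y)" if "x \<in> L" "y \<in> L" for x y
        by (simp add: mat f br that) (simp add: bm field_simps)
    qed
    then show ?thesis ..
  next
    case False
    then have bm: "m = b * b" using b by simp
    \<comment> \<open>\<open>a\<close> multiplies the imaginary scalar matrix, while
      \<open>t\<close>, \<open>c\<close>, \<open>d\<close> multiply a standard basis of su(2), again
      with halves for the structure constants.\<close>
    define f :: "'a \<Rightarrow> complex ^ 2 ^ 2" where "f x = vector [vector [Complex 0 (a x - m * t x / 2), Complex (- (b * d x / 2)) (- (b * c x / 2))],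
      vector [Complex (b * d x / 2) (- (b * c x / 2)), Complex 0 (a x + m * t x / 2)]]" for x
    have f: "f x $ 1 $ 1 = Complex 0 (a x - m * t x / 2)" "f x $ 1 $ 2 = Complex (- (b * d x / 2)) (- (b * c x / 2))"
      "f x $ 2 $ 1 = Complex (b * d x / 2) (- (b * c x / 2))" "f x $ 2 $ 2 = Complex 0 (a x + m * t x / 2)" for x
      by (simp_all add: f_def vector_2)
    have "lie_isomorphic L br u2 commutator"
    proof (rule lie_isomorphicI[of _ f])
      show "linear_on L f"
        using lin' by (simp add: linear_on_def mat f complex_eq_iff) (simp add: field_simps)
      show "x = y" if "x \<in> L" "y \<in> L" "f x = f y" for x y
      proof (rule inj[OF that(1,2)])
        have e: "f x $ i $ j = f y $ i $ j" for i j using that by simp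
        have "a x - m * t x / 2 = a y - m * t y / 2" "a x + m * t x / 2 = a y + m * t y / 2"
          "b * d x = b * d y" "b * c x = b * c y"
          using e[of 1 1] e[of 2 2] e[of 1 2] e[of 2 1] by (simp_all add: f)
        then have "a x = a y" "m * t x = m * t y" "b * c x = b * c y" "b * d x = b * d y" by linarith+
        then show "a x = a y" "t x = t y" "c x = c y" "d x = d y" using b(2) m by simp_all
      qed
      show "f ` L = u2"
      proof
        show "f ` L \<subseteq> u2" by (auto simp: u2_def forall_2 f complex_eq_iff)
        show "u2 \<subseteq> f ` L"
        proof
          fix M :: "complex ^ 2 ^ 2" assume M: "M \<in> u2"
          have M': "cnj (M $ 1 $ 1) = - (M $ 1 $ 1)" "cnj (M $ 2 $ 2) = - (M $ 2 $ 2)" "cnj (M $ 2 $ 1) = - (M $ 1 $ 2)"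
            using M by (auto simp: u2_def)
          obtain x where "x \<in> L" "a x = (Im (M $ 1 $ 1) + Im (M $ 2 $ 2)) / 2" "t x = (Im (M $ 2 $ 2) - Im (M $ 1 $ 1)) / m"
            "c x = - 2 * Im (M $ 2 $ 1) / b" "d x = 2 * Re (M $ 2 $ 1) / b"
            using surj by blast
          then have "f x = M" using b m M' by (simp add: mat f complex_eq_iff field_simps)
          then show "M \<in> f ` L" using \<open>x \<in> L\<close> by blast
        qed
      qed
      show "f (br x y) = commutator (f x) (f y)" if "x \<in> L" "y \<in> L" for x y
        by (simp add: mat f br that complex_eq_iff) (simp add: bm field_simps)
    qed
    then show ?thesis ..
  qed
qed

context vaisman_frame
begin

lemma dim_4_case:
  assumes E2: "card E = 2" and Dm: "Dh = m *\<^sub>R (J * Q)" and m: "m \<noteq> 0"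
  shows "lie_isomorphic (range (app P)) br u2 commutator \<or> lie_isomorphic (range (app P)) br gl2R commutator"
proof -
  let ?L = "range (app P)"
  obtain \<nu> where \<nu>: "nabla A = \<nu> *\<^sub>R (J * Q)" using h.skew_dim_2[OF E2 h_skew_A] by blast
  obtain e f where E: "E = {e, f}" "e \<noteq> f" using E2 by (meson card_2_iff)
  have Qe: "Q \<cdot> e = e" "Q \<cdot> f = f" "ip e e = 1" "ip f f = 1" "ip e f = 0" "ip f e = 0"
    using QE onE E by auto
  have Pe: "P \<cdot> e = e" using Q_simps(4)[of e] Qe by simp
  have Qx: "Q \<cdot> x = ip x e *\<^sub>R e + ip x f *\<^sub>R f" for x
    unfolding Q_sum using E by simp
  define c where "c = ip (J \<cdot> e) f"
  have Je: "J \<cdot> e = c *\<^sub>R f"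
    using Qx[of "J \<cdot> e"] skew_self[OF skew_J, of e] by (simp add: QJ Qe c_def)
  have cc: "c * c = 1" using ipJJ[of e e] by (simp add: Je Qe)
  have fJ: "f = c *\<^sub>R (J \<cdot> e)" by (simp add: Je cc)
  have Qx: "Q \<cdot> x = ip x e *\<^sub>R e + ip x (J \<cdot> e) *\<^sub>R (J \<cdot> e)" for x
    using Qx[of x] by (simp add: Je) (metis cc mult.commute mult.left_commute mult.left_neutral)
  have JJe: "J \<cdot> (J \<cdot> e) = - e" by (simp add: Pe)
  \<comment> \<open>On a plane each \<open>Gh x\<close> is a multiple of \<open>J\<close>, and a
    divergence-free family of such multiples is zero.\<close>
  have Gh0: "Gh x = 0" for x
  proof -
    have "\<exists>c. Gh x = c *\<^sub>R (J * Q)" for x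
      using h.skew_dim_2[OF E2 h_skew_Gh] by blast
    then obtain g where g: "\<And>x. Gh x = g x *\<^sub>R (J * Q)" by metis
    have s: "g e *\<^sub>R (J \<cdot> e) + g f *\<^sub>R (J \<cdot> f) = 0"
      using h.G_div E by (simp add: g Qe)
    have Jf: "J \<cdot> f = - c *\<^sub>R e" by (subst fJ) (simp add: Pe)
    have "g e = 0" "g f = 0"
      using arg_cong[OF s, of "\<lambda>v. ip v f"] arg_cong[OF s, of "\<lambda>v. ip v e"] cc by (auto simp: Je Jf Qe)
    then have "Gh e = 0" "Gh f = 0" by (simp_all add: g)
    have "Gh x = Gh (Q \<cdot> x)" by simp
    also have "\<dots> = 0"
      unfolding \<open>\<And>x. Q \<cdot> x = ip x e *\<^sub>R e + ip x (J \<cdot> e) *\<^sub>R (J \<cdot> e)\<close> Je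
      by (simp only: Gh_simps \<open>Gh e = 0\<close> \<open>Gh f = 0\<close>) simp
    finally show ?thesis .
  qed
  define a where "a x = \<theta> x / l" for x
  \<comment> \<open>On the plane \<open>A\<close> acts by \<nu> J and \<xi> by m J. The coordinate
    \<open>t\<close> measures the total action, which leaves A - (\<nu> / m) \<xi> as a central
    direction.\<close>
  define t where "t x = ip \<xi> x / l + \<nu> * a x / m" for x
  define u where "u x = ip x e" for x
  define v where "v x = ip x (J \<cdot> e)" for x
  have Qx': "Q \<cdot> x = u x *\<^sub>R e + v x *\<^sub>R (J \<cdot> e)" for x by (simp add: Qx u_def v_def)
  have ipe: "ip e (J \<cdot> e) = 0" "ip (J \<cdot> e) e = 0" "ip (J \<cdot> e) (J \<cdot> e) = 1"
    using skew_self[OF skew_J, of e] ip_sym[of e "J \<cdot> e"] by (simp_all add: ipJJ Qe)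
  have te: "\<theta> e = 0" "ip \<xi> e = 0" "\<theta> (J \<cdot> e) = 0" "ip \<xi> (J \<cdot> e) = 0"
    using Q_simps(1,2)[of e] by (simp_all add: Qe theta_J ip_xi_J)
  have JQ: "J \<cdot> (Q \<cdot> x) = u x *\<^sub>R (J \<cdot> e) - v x *\<^sub>R e" for x
    unfolding Qx' by (simp add: Pe)
  have br: "br x y = (u x * v y - v x * u y) *\<^sub>R \<xi> + (m * t x) *\<^sub>R (J \<cdot> (Q \<cdot> y)) - (m * t y) *\<^sub>R (J \<cdot> (Q \<cdot> x))" for x y
  proof -
    have h1: "ip (J \<cdot> (Q \<cdot> x)) (Q \<cdot> y) = u x * v y - v x * u y"
      unfolding JQ unfolding Qx' by (simp add: ipe Qe)
    have h2: "m * t x = \<nu> * (\<theta> x / l) + m * (ip \<xi> x / l)" for x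
      using m by (simp add: t_def a_def field_simps)
    show ?thesis
      unfolding br_formula[of x y] Gh0 \<nu> Dm h1 h2 by (simp add: algebra_simps)
  qed
  show ?thesis
  proof (rule u2_or_gl2R[of ?L a t u v br m])
    show "linear_on ?L a" "linear_on ?L t" "linear_on ?L u" "linear_on ?L v"
      using m by (simp_all add: linear_on_def a_def t_def u_def v_def field_simps)
    show "x = y" if "x \<in> ?L" "y \<in> ?L" "a x = a y" "t x = t y" "u x = u y" "v x = v y" for x y
    proof -
      have "\<theta> x = \<theta> y" "ip \<xi> x = ip \<xi> y" using that m by (auto simp: a_def t_def)
      moreover have "Q \<cdot> x = Q \<cdot> y" using that by (simp add: Qx')
      ultimately have "P \<cdot> x = P \<cdot> y" by (simp add: decomp)
      then show ?thesis using that by auto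
    qed
    show "\<exists>x\<in>?L. a x = r \<and> t x = s \<and> u x = i \<and> v x = j" for r s i j
    proof
      let ?x = "r *\<^sub>R A + (s - \<nu> * r / m) *\<^sub>R \<xi> + i *\<^sub>R e + j *\<^sub>R (J \<cdot> e)"
      show "a ?x = r \<and> t ?x = s \<and> u ?x = i \<and> v ?x = j"
        using te by (simp add: a_def t_def u_def v_def ipe Qe)
      have "?x = P \<cdot> ?x" by (simp add: Pe)
      then show "?x \<in> ?L" by (rule range_eqI)
    qed
    fix x y
    show "a (br x y) = 0" by (simp add: a_def)
    show "t (br x y) = u x * v y - v x * u y"
      unfolding br JQ by (simp add: t_def a_def te)
    show "u (br x y) = m * (t y * v x - t x * v y)"
      unfolding br JQ by (simp add: u_def[of "_ - _"] ipe Qe te algebra_simps)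
    show "v (br x y) = m * (t x * u y - t y * u x)"
      unfolding br JQ by (simp add: v_def[of "_ - _"] ipe Qe te algebra_simps)
  qed (rule m)
qed

end

section \<open>The classification\<close>

lemma (in frame) independent_E: "independent E"
proof
  assume "dependent E"
  then obtain u f where u: "f \<in> E" "u f \<noteq> (0::real)" "(\<Sum>g\<in>E. u g *\<^sub>R g) = 0"
    using dependent_finite[of E] by auto
  have "ip (\<Sum>g\<in>E. u g *\<^sub>R g) f = (\<Sum>g\<in>E. if g = f then u g else 0)"
    unfolding ip_sum by (rule sum.cong) (use u ip_E in auto)
  then show False using u by simp
qed

lemma (in frame) representation_E:
  assumes "P \<cdot> v = v" "b \<in> E"
  shows "representation E v b = ip v b"
proof -
  have "v = (\<Sum>e\<in>E. ip v e *\<^sub>R e)" using assms(1) by (simp add: P_app)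
  then have "representation E v = representation E (\<Sum>e\<in>E. ip v e *\<^sub>R e)" by simp
  also have "\<dots> = (\<lambda>b. \<Sum>e\<in>E. representation E (ip v e *\<^sub>R e) b)"
    by (rule representation_sum[OF independent_E]) (simp add: span_base span_scale)
  finally have "representation E v b = (\<Sum>e\<in>E. representation E (ip v e *\<^sub>R e) b)" by simp
  also have "\<dots> = (\<Sum>e\<in>E. if b = e then ip v e else 0)"
  proof (rule sum.cong[OF refl])
    fix e assume e: "e \<in> E"
    show "representation E (ip v e *\<^sub>R e) b = (if b = e then ip v e else 0)"
      unfolding representation_scale[OF independent_E span_base[OF e]] representation_basis[OF independent_E e]
      by simp
  qed
  finally show ?thesis using assms(2) by simp
qed

lemma subspace_projection:
  assumes "subspace (L :: 'a::real_vector set)"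
  obtains \<pi> where "linear \<pi>" "\<And>x. \<pi> x \<in> L" "\<And>x. x \<in> L \<Longrightarrow> \<pi> x = x"
proof -
  obtain B where B: "B \<subseteq> L" "independent B" "L \<subseteq> span B" using maximal_independent_subset by blast
  have L: "span B = L" using B assms by (simp add: span_minimal subset_antisym)
  obtain g where g: "linear g" "\<forall>x\<in>B. g x = id x" "range g = span (id ` B)"
    using linear_independent_extend_subspace[OF B(2), of id] by blast
  have "g x = x" if "x \<in> L" for x
    using linear_eq_on[OF g(1) linear_id, of x B] g(2) that L by (auto simp: id_def)
  moreover have "g x \<in> L" for x using g(3) L by auto
  ultimately show ?thesis using that g(1) by blast
qed

lemma linear_on_compose:
  assumes "linear \<pi>" "\<And>x. \<pi> x \<in> L" "linear_on L f"
  shows "linear (\<lambda>x. f (\<pi> x))"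
  using assms by (simp add: linear_iff linear_on_def)

lemma bilinear_on_compose:
  assumes "linear \<pi>" "\<And>x. \<pi> x \<in> L" "bilinear_on L f"
  shows "bilinear (\<lambda>x y. f (\<pi> x) (\<pi> y))"
  unfolding bilinear_def
proof (intro conjI allI)
  show "linear (\<lambda>y. f (\<pi> x) (\<pi> y))" for x
    by (rule linear_on_compose[OF assms(1,2)]) (use assms(2,3) in \<open>simp add: bilinear_on_def\<close>)
  show "linear (\<lambda>x. f (\<pi> x) (\<pi> y))" for y
    by (rule linear_on_compose[OF assms(1,2), of "\<lambda>x. f x (\<pi> y)"]) (use assms(2,3) in \<open>simp add: bilinear_on_def\<close>)
qed

lemma lie_isomorphic_cong:
  assumes "\<And>x y. x \<in> L \<Longrightarrow> y \<in> L \<Longrightarrow> br x y = br2 x y"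
  shows "lie_isomorphic L br L' br' \<longleftrightarrow> lie_isomorphic L br2 L' br'"
  unfolding lie_isomorphic_def using assms by simp

context vaisman
begin

lemma classification:
  assumes dim: "dim (range (app P)) \<ge> 4"
  shows "lie_isomorphic (range (app P)) br u2 commutator \<or> lie_isomorphic (range (app P)) br gl2R commutator \<or>
    (\<exists>p q \<psi>. linear_on (odd_space p) \<psi> \<and> \<psi> ` odd_space p \<subseteq> torus q \<and>
    (\<exists>\<phi>. linear_on (range (app P)) \<phi> \<and> bij_betw \<phi> (range (app P)) (gh p q) \<and>
      (\<forall>x\<in>range (app P). \<forall>y\<in>range (app P). \<phi> (br x y) = gh_bracket p q \<psi> (\<phi> x) (\<phi> y))))"
proof -
  obtain E where E: "finite E" "\<And>e. e \<in> E \<Longrightarrow> Q \<cdot> e = e"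
    "\<And>e f. e \<in> E \<Longrightarrow> f \<in> E \<Longrightarrow> ip e f = (if e = f then 1 else 0)" "\<And>x. Q \<cdot> x = (\<Sum>e\<in>E. ip x e *\<^sub>R e)"
    using transversal_basis by blast
  interpret vf: vaisman_frame ip B J br nabla \<theta> E
    by unfold_locales (use E in auto)
  \<comment> \<open>\<open>A\<close>, \<xi> and \<open>E\<close> span, so dimension at least four
    leaves two horizontal directions.\<close>
  have "card E \<ge> 2"
  proof -
    let ?W = "insert A (insert \<xi> E)"
    have "P \<cdot> x \<in> span ?W" for x
      unfolding decomp E(4) by (intro span_add span_scale span_sum span_base) auto
    then have "dim (range (app P)) \<le> card ?W"
      using E(1) by (intro dim_le_card) auto
    also have "card ?W \<le> card E + 2"
      using card_insert_le_m1[of "card E + 2" "insert \<xi> E" A] card_insert_le_m1[of "card E + 1" E \<xi>] by simp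
    finally show ?thesis using dim by simp
  qed
  note rig = vf.h.rigidity[OF this] vf.h.mu_0_or_2[OF this]
  show ?thesis
  proof (cases "vf.h.mu = 0")
    case True
    interpret fv: flat_vaisman ip B J br nabla \<theta> E
      by unfold_locales (use rig True in simp_all)
    show ?thesis using fv.flat_iso by blast
  next
    case False
    then have "card E = 2" using rig(3) by simp
    then show ?thesis using vf.dim_4_case[OF _ rig(2) False] by blast
  qed
qed

end

theorem theorem1:
  fixes L :: "'a::real_vector set" and br :: "'a \<Rightarrow> 'a \<Rightarrow> 'a"
  assumes "lie_algebra L br"
    and "unimodular L br"
    and "dim L \<ge> 4"
    and "\<exists>ip J. vaisman_structure L br ip J"
  shows "lie_isomorphic L br u2 commutator \<or>
    lie_isomorphic L br gl2R commutator \<or>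
    (\<exists>p q \<psi>. linear_on (odd_space p) \<psi> \<and> \<psi> ` odd_space p \<subseteq> torus q \<and>
       solvable (gh p q) (gh_bracket p q \<psi>) \<and> unimodular (gh p q) (gh_bracket p q \<psi>) \<and>
       lie_isomorphic L br (gh p q) (gh_bracket p q \<psi>))"
proof -
  obtain ip0 J0 \<theta>0 nabla0 where lck: "lck_structure L br ip0 J0 \<theta>0" and nz: "\<exists>x\<in>L. \<theta>0 x \<noteq> 0"
    and lc: "levi_civita L br ip0 nabla0" and par: "\<forall>x\<in>L. \<forall>y\<in>L. cov_deriv1 nabla0 \<theta>0 x y = 0"
    using assms(4) unfolding vaisman_structure_def by blast
  obtain B0 where B0: "finite B0" "L = span B0" using assms(1) by (auto simp: lie_algebra_def)
  have subL: "subspace L" by (simp add: B0)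
  obtain \<pi> where \<pi>: "linear \<pi>" "\<And>x. \<pi> x \<in> L" "\<And>x. x \<in> L \<Longrightarrow> \<pi> x = x"
    using subspace_projection[OF subL] by blast
  have \<pi>\<pi>: "\<pi> (\<pi> x) = \<pi> x" for x by (simp add: \<pi>)
  \<comment> \<open>Composition with the projection turns structures controlled only on
    \<open>L\<close> into total ones whose identities hold for all vectors, as the locale
    demands.\<close>
  define ip where "ip x y = ip0 (\<pi> x) (\<pi> y)" for x y
  define J where "J = Lin (\<lambda>x. J0 (\<pi> x))"
  define br' where "br' x y = br (\<pi> x) (\<pi> y)" for x y
  define nabla where "nabla x = Lin (\<lambda>y. nabla0 (\<pi> x) (\<pi> y))" for x
  define \<theta> where "\<theta> x = \<theta>0 (\<pi> x)" for x
  have herm: "hermitian_structure L br ip0 J0" using lck by (simp add: lck_structure_def)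
  have sp: "scalar_product_on L ip0" and endo: "endo_on L J0" and skJ: "skew_on L ip0 J0"
    and JJ0: "\<And>x. x \<in> L \<Longrightarrow> J0 (J0 x) = - x"
    and nij0: "\<And>x y. x \<in> L \<Longrightarrow> y \<in> L \<Longrightarrow> nijenhuis br J0 x y = 0"
    using herm by (auto simp: hermitian_structure_def)
  have J0L: "J0 x \<in> L" if "x \<in> L" for x using endo that by (simp add: endo_on_def)
  have J_app: "J \<cdot> x = J0 (\<pi> x)" for x
    unfolding J_def
    by (rule app_Lin, rule linear_on_compose[OF \<pi>(1,2)]) (use endo in \<open>simp add: endo_on_def\<close>)
  have brL: "br x y \<in> L" if "x \<in> L" "y \<in> L" for x y using assms(1) that by (simp add: lie_algebra_def)
  have nbil: "bilinear_on L nabla0" and nL: "\<And>x y. x \<in> L \<Longrightarrow> y \<in> L \<Longrightarrow> nabla0 x y \<in> L"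
    and nsk: "\<And>x. x \<in> L \<Longrightarrow> skew_on L ip0 (nabla0 x)"
    and ntor: "\<And>x y. x \<in> L \<Longrightarrow> y \<in> L \<Longrightarrow> nabla0 x y - nabla0 y x = br x y"
    using lc by (auto simp: levi_civita_def)
  have nabla_app: "nabla x \<cdot> y = nabla0 (\<pi> x) (\<pi> y)" for x y
    unfolding nabla_def
    by (rule app_Lin, rule linear_on_compose[OF \<pi>(1,2)]) (use nbil \<pi>(2) in \<open>simp add: bilinear_on_def\<close>)
  have ip_bil: "bilinear ip"
    unfolding ip_def by (rule bilinear_on_compose[OF \<pi>(1,2)]) (use sp in \<open>simp add: scalar_product_on_def\<close>)
  have ip_sym: "ip x y = ip y x" for x y
    using sp \<pi>(2) by (simp add: ip_def scalar_product_on_def)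
  have pos: "ip x x > 0" if "x \<in> L" "x \<noteq> 0" for x
    using sp that \<pi>(3) by (simp add: ip_def scalar_product_on_def)
  obtain B where B: "finite B" "B \<subseteq> L" "\<And>f g. f \<in> B \<Longrightarrow> g \<in> B \<Longrightarrow> ip f g = (if f = g then 1 else 0)"
    "\<And>x. x \<in> L \<Longrightarrow> (\<Sum>f\<in>B. ip x f *\<^sub>R f) = x"
    using gram_schmidt[OF B0(1) subL _ ip_bil ip_sym pos] B0(2) by blast
  have ip\<pi>: "ip (\<pi> x) y = ip x y" "ip x (\<pi> y) = ip x y" for x y by (simp_all add: ip_def \<pi>\<pi>)
  have \<pi>_sum: "\<pi> x = (\<Sum>f\<in>B. ip x f *\<^sub>R f)" for x
    using B(4)[OF \<pi>(2), of x] by (simp add: ip\<pi>)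
  interpret fr: frame ip B
  proof
    show "ip x y = (\<Sum>e\<in>B. ip x e * ip y e)" for x y
    proof -
      have "ip x y = ip x (\<Sum>f\<in>B. ip y f *\<^sub>R f)" using ip\<pi>(2)[of x y] \<pi>_sum[of y] by simp
      also have "\<dots> = (\<Sum>e\<in>B. ip x e * ip y e)"
        using ip_bil by (simp add: bilinear_def linear_sum linear_cmul mult.commute)
      finally show ?thesis .
    qed
  qed (use B ip_bil ip_sym in auto)
  have P: "fr.P \<cdot> x = \<pi> x" for x by (simp add: fr.P_app \<pi>_sum)
  have range_P: "range (app fr.P) = L" using \<pi>(2,3) by (auto simp: P image_iff) (metis \<pi>(3))
  interpret vaisman ip B J br' nabla \<theta>
  proof
    show "fr.skew J"
      unfolding fr.skew_def
      using skJ \<pi>(2) by (auto intro!: lin_eqI simp: P J_app \<pi>\<pi> \<pi>(3) J0L ip_def skew_on_def)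
    show "J * J = - fr.P"
      by (rule lin_eqI) (simp add: J_app P \<pi>(2,3) J0L JJ0)
    show "bilinear br'"
      unfolding br'_def by (rule bilinear_on_compose[OF \<pi>(1,2)]) (use assms(1) in \<open>simp add: lie_algebra_def\<close>)
    show "br' (fr.P \<cdot> x) y = br' x y" "fr.P \<cdot> br' x y = br' x y" for x y
      by (simp_all add: P br'_def \<pi>\<pi> \<pi>(2,3) brL)
    show "br' x x = 0" for x using assms(1) \<pi>(2) by (simp add: br'_def lie_algebra_def)
    show "br' x (br' y z) + br' y (br' z x) + br' z (br' x y) = 0" for x y z
      using assms(1) \<pi>(2) by (simp add: br'_def \<pi>(2,3) brL lie_algebra_def)
    show "br' (J \<cdot> x) (J \<cdot> y) - br' x y - J \<cdot> br' x (J \<cdot> y) - J \<cdot> br' (J \<cdot> x) y = 0" for x y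
      using nij0[OF \<pi>(2) \<pi>(2), of x y] by (simp add: br'_def J_app \<pi>(2,3) brL J0L nijenhuis_def)
    have "bilinear (\<lambda>x y. nabla0 (\<pi> x) (\<pi> y))" by (rule bilinear_on_compose[OF \<pi>(1,2) nbil])
    then show "nabla (x + y) = nabla x + nabla y" "nabla (c *\<^sub>R x) = c *\<^sub>R nabla x" for x y c
      by (auto intro!: lin_eqI simp: nabla_app bilinear_def linear_iff)
    show "nabla (fr.P \<cdot> x) = nabla x" for x by (rule lin_eqI) (simp add: nabla_app P \<pi>\<pi>)
    show "fr.skew (nabla x)" for x
      unfolding fr.skew_def
      using nsk[OF \<pi>(2), of x] \<pi>(2)
      by (auto intro!: lin_eqI simp: P nabla_app \<pi>\<pi> \<pi>(3) nL ip_def skew_on_def)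
    show "nabla x \<cdot> y - nabla y \<cdot> x = br' x y" for x y
      by (simp add: nabla_app br'_def ntor \<pi>(2))
    have "linear \<theta>"
      unfolding \<theta>_def by (rule linear_on_compose[OF \<pi>(1,2)]) (use lck in \<open>simp add: lck_structure_def\<close>)
    then show "\<theta> (x + y) = \<theta> x + \<theta> y" "\<theta> (c *\<^sub>R x) = c * \<theta> x" for x y c
      by (simp_all add: linear_add linear_cmul)
    show "\<theta> (fr.P \<cdot> x) = \<theta> x" for x by (simp add: \<theta>_def P \<pi>\<pi>)
    show "\<theta> (nabla x \<cdot> y) = 0" for x y
      using par \<pi>(2) by (simp add: \<theta>_def nabla_app \<pi>(3) nL cov_deriv1_def)
    show "- ip (br' x y) (J \<cdot> z) + ip (br' x z) (J \<cdot> y) - ip (br' y z) (J \<cdot> x)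
      = ip x (J \<cdot> y) * \<theta> z - ip x (J \<cdot> z) * \<theta> y + ip y (J \<cdot> z) * \<theta> x" for x y z
    proof -
      have "ce_d2 br (fundamental_form ip0 J0) (\<pi> x) (\<pi> y) (\<pi> z) = wedge21 (fundamental_form ip0 J0) \<theta>0 (\<pi> x) (\<pi> y) (\<pi> z)"
        using lck \<pi>(2) by (simp add: lck_structure_def)
      then show ?thesis
        by (simp add: ce_d2_def wedge21_def fundamental_form_def ip_def br'_def J_app \<theta>_def \<pi>(2,3) brL J0L)
    qed
    show "\<exists>x. \<theta> x \<noteq> 0" using nz \<pi>(3) by (metis \<theta>_def)
    \<comment> \<open>The trace is evaluated in the orthonormal basis \<open>B\<close>, where the
      coefficients are scalar products.\<close>
    show "(\<Sum>b\<in>B. ip (br' x b) b) = 0" for x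
    proof -
      have "span B = L"
      proof
        show "span B \<subseteq> L" using B(2) subL by (simp add: span_minimal)
        show "L \<subseteq> span B" using fr.P_app P \<pi>(3)
          by (metis (no_types, lifting) span_base span_scale span_sum subsetI)
      qed
      then have "trace_on L (br (\<pi> x)) = (\<Sum>b\<in>B. representation B (br (\<pi> x) b) b)"
        using assms(1) \<pi>(2) brL
        by (intro trace_on_basis fr.independent_E B(1)) (auto simp: lie_algebra_def bilinear_on_def)
      also have "\<dots> = (\<Sum>b\<in>B. ip (br' x b) b)"
      proof (rule sum.cong[OF refl])
        fix b assume b: "b \<in> B"
        then have "b \<in> L" using B(2) by auto
        then show "representation B (br (\<pi> x) b) b = ip (br' x b) b"
          using fr.representation_E[OF _ b, of "br (\<pi> x) b"] by (simp add: P br'_def \<pi>(2,3) brL)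
      qed
      finally show ?thesis using assms(2) \<pi>(2) by (simp add: unimodular_def)
    qed
  qed
  have br: "br' x y = br x y" if "x \<in> L" "y \<in> L" for x y using that by (simp add: br'_def \<pi>(3))
  have iso: "lie_isomorphic L br' u2 commutator \<longleftrightarrow> lie_isomorphic L br u2 commutator"
    "lie_isomorphic L br' gl2R commutator \<longleftrightarrow> lie_isomorphic L br gl2R commutator"
    by (rule lie_isomorphic_cong; rule br; assumption)+
  consider "lie_isomorphic L br u2 commutator" | "lie_isomorphic L br gl2R commutator"
    | p q \<psi> \<phi> where "linear_on (odd_space p) \<psi>" "\<psi> ` odd_space p \<subseteq> torus q" "linear_on L \<phi>"
      "bij_betw \<phi> L (gh p q)" "\<forall>x\<in>L. \<forall>y\<in>L. \<phi> (br' x y) = gh_bracket p q \<psi> (\<phi> x) (\<phi> y)"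
    using classification assms(3) unfolding range_P iso by blast
  then show ?thesis
  proof cases
    case (3 p q \<psi> \<phi>)
    have hom: "\<phi> (br x y) = gh_bracket p q \<psi> (\<phi> x) (\<phi> y)" if "x \<in> L" "y \<in> L" for x y
      using 3(5) that br by metis
    have "unimodular (gh p q) (gh_bracket p q \<psi>)"
      by (rule unimodular_iso[OF assms(1,2) 3(3,4) hom gh_bracket_linear[OF 3(1)]])
    moreover have "lie_isomorphic L br (gh p q) (gh_bracket p q \<psi>)"
      unfolding lie_isomorphic_def using 3(3,4) hom by blast
    ultimately show ?thesis using 3(1,2) gh_solvable[OF 3(1)] by blast
  qed blast+
qed

end
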